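(* Let $\mathfrak n$ be a nilradical in $\mathfrak g$ with optimisation $\tilde{\mathfrak n}$, let $\mathcal K(\mathfrak n)=\{\beta_1,\dots,\beta_k\}$, and let $\zeta\in\mathfrak k_0\subset\mathfrak n^*$ be a cascade point. Let $\tilde\zeta\in\tilde{\mathfrak n}^*$ be a cascade point for $\tilde{\mathfrak n}$. For $1\le j\le k$ put $\mathcal C_{\mathfrak n}(j)=\Delta(\mathfrak h_j)\setminus\Delta(\mathfrak n)$. Then: (i) $\mathfrak n^\zeta$ is $T$-stable and $$\mathfrak n^\zeta=\Bigl(\bigoplus_{j=1}^k\bigoplus_{\gamma\in\mathcal C_{\mathfrak n}(j)}\mathfrak g_{\beta_j-\gamma}\Bigr)\oplus\tilde{\mathfrak n}^{\tilde\zeta}=\Bigl(\bigoplus_{j=1}^k\bigoplus_{\gamma\in\mathcal C_{\mathfrak n}(j)}\mathfrak g_{\beta_j-\gamma}\Bigr)\oplus\Bigl(\bigoplus_{\beta\in\mathcal K(\mathfrak n)}\mathfrak g_\beta\Bigr);$$ (ii) $\Delta(\mathfrak n^\zeta)=\{\beta_j-\gamma\mid 1\le j\le k,\ \gamma\in\mathcal C_{\mathfrak n}(j)\}\sqcup\mathcal K(\mathfrak n)$; (iii) for any $\xi\in\mathfrak k_0$, we have $\mathfrak n^\xi=\mathfrak n^\zeta$.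
   Context: Everything is over $\mathbb C$. $G$ is a connected simple algebraic group, $\mathfrak g=\mathrm{Lie}\,G=\mathfrak u\oplus\mathfrak t\oplus\mathfrak u^-$ a fixed triangular decomposition, $\mathfrak b=\mathfrak u\oplus\mathfrak t$, $T\subset G$ the maximal torus with Lie algebra $\mathfrak t$. $\Delta$ is the root system of $(\mathfrak g,\mathfrak t)$, $\Delta^+$ the set of roots of $\mathfrak u$, $\Pi$ the simple roots, $\theta$ the highest root, $\mathfrak g_\gamma$ the root spaces, $[\gamma:\alpha]$ the coefficient of $\alpha\in\Pi$ in $\gamma$, $\mathrm{supp}(\gamma)=\{\alpha\in\Pi\mid[\gamma:\alpha]\ne0\}$. For a $\mathfrak t$-stable subspace $\mathfrak c\subset\mathfrak u$, $\Delta(\mathfrak c)$ is its set of roots. Nilradicals. A nilradical $\mathfrak n$ means the (nonzero) nilradical of a standard parabolic subalgebra $\mathfrak p\supset\mathfrak b$. Kostant cascade. For an irreducible root subsystem $\Delta'\subset\Delta$ with highest root $\beta'$, the descendants of $\beta'$ are the highest roots of the irreducible components of $\{\gamma\in\Delta'\mid(\gamma,\beta')=0\}$. The Kostant cascade $\mathcal K\subset\Delta^+$ is obtained from $(\Delta,\theta)$ by taking $\theta$ and iteratively taking descendants; its elements are numbered $\beta_1=\theta,\beta_2,\dots$ so that the elements of $\mathcal K(\mathfrak n)=\mathcal K\cap\Delta(\mathfrak n)$ are $\beta_1,\dots,\beta_k$. For $\beta_i\in\mathcal K$, $\Delta\langle i\rangle$ is the irreducible root system with simple roots $\mathrm{supp}(\beta_i)$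 (its highest root is $\beta_i$), $\mathcal H_{\beta_i}=\{\gamma\in\Delta\langle i\rangle\cap\Delta^+\mid(\gamma,\beta_i)\ne0\}$ and $\mathfrak h_i=\bigoplus_{\gamma\in\mathcal H_{\beta_i}}\mathfrak g_\gamma$. The optimisation of $\mathfrak n$ is $\tilde{\mathfrak n}=\bigoplus_{\beta_i\in\mathcal K(\mathfrak n)}\mathfrak h_i\supset\mathfrak n$, which is again a nilradical, with $\mathcal K(\tilde{\mathfrak n})=\mathcal K(\mathfrak n)$. Coadjoint action. For a nilradical $\mathfrak n$ of $\mathfrak p$, let $\mathfrak n^-$ be the opposite nilradical, $\Delta(\mathfrak n^-)=-\Delta(\mathfrak n)$, so $\mathfrak g=\mathfrak p\oplus\mathfrak n^-$. Identify $\mathfrak n^*\simeq\mathfrak g/\mathfrak p\simeq\mathfrak n^-$; then $x\in\mathfrak p$ acts on $\xi\in\mathfrak n^-$ by $x\cdot\xi=\mathrm{pr}_{\mathfrak n^-}([x,\xi])$, the projection having kernel $\mathfrak p$. The cascade subspace is $\mathfrak k=\bigoplus_{\beta\in\mathcal K(\mathfrak n)}\mathfrak g_{-\beta}\subset\mathfrak n^-\simeq\mathfrak n^*$; $\mathfrak k_0\subset\mathfrak k$ is the set of vectors all of whose components in the $\mathfrak g_{-\beta}$, $\beta\in\mathcal K(\mathfrak n)$, are nonzero; the elements of $\mathfrak k_0$ are the cascade points. For $\xi\in\mathfrak n^*$, $\mathfrak n^\xi$ is its stabiliser in $\mathfrak n$; similarly for $\tilde{\mathfrak n}$. *)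

theory Defs
  imports "HOL-Analysis.Analysis" "HOL-Library.Function_Algebras"
begin

section \<open>Complex matrices and functionals as complex vector spaces\<close>

type_synonym 'n cmat = "complex^'n^'n"
type_synonym 'n functional = "complex^'n^'n \<Rightarrow> complex"

definition mscale :: "complex \<Rightarrow> complex^'n^'n \<Rightarrow> complex^'n^'n" where
  "mscale c X = (\<chi> i j. c * X $ i $ j)"

definition fscale :: "complex \<Rightarrow> ('a \<Rightarrow> complex) \<Rightarrow> ('a \<Rightarrow> complex)" where
  "fscale c f = (\<lambda>x. c * f x)"

interpretation cmat: vector_space "mscale :: complex \<Rightarrow> complex^'n^'n \<Rightarrow> complex^'n^'n"
  by unfold_locales (auto simp: mscale_def vec_eq_iff algebra_simps)

interpretation cfun: vector_space "fscale :: complex \<Rightarrow> ('a \<Rightarrow> complex) \<Rightarrow> ('a \<Rightarrow> complex)"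
  by unfold_locales (auto simp: fscale_def fun_eq_iff algebra_simps)

definition is_direct_sum :: "'n::finite cmat set \<Rightarrow> 'i set \<Rightarrow> ('i \<Rightarrow> 'n cmat set) \<Rightarrow> bool" where
  "is_direct_sum V I W \<longleftrightarrow>
     finite I \<and> (\<forall>i\<in>I. cmat.subspace (W i)) \<and>
     V = {\<Sum>i\<in>I. w i | w. \<forall>i\<in>I. w i \<in> W i} \<and>
     (\<forall>w. (\<forall>i\<in>I. w i \<in> W i) \<and> (\<Sum>i\<in>I. w i) = 0 \<longrightarrow> (\<forall>i\<in>I. w i = 0))"

definition is_direct_sum2 :: "'n::finite cmat set \<Rightarrow> 'n cmat set \<Rightarrow> 'n cmat set \<Rightarrow> bool" where
  "is_direct_sum2 V A B \<longleftrightarrow>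
     cmat.subspace A \<and> cmat.subspace B \<and>
     V = {a + b | a b. a \<in> A \<and> b \<in> B} \<and> A \<inter> B = {0}"

text \<open>Trace of an endomorphism \<open>f\<close> of the subspace \<open>V\<close>, computed in some basis of \<open>V\<close>.\<close>
definition trace_on :: "'n::finite cmat set \<Rightarrow> ('n cmat \<Rightarrow> 'n cmat) \<Rightarrow> complex" where
  "trace_on V f =
     (let B = (SOME B. cmat.independent B \<and> cmat.span B = V)
      in \<Sum>b\<in>B. cmat.representation B (f b) b)"

section \<open>Lie algebras of matrices\<close>

definition lie_bracket :: "'n::finite cmat \<Rightarrow> 'n cmat \<Rightarrow> 'n cmat" where
  "lie_bracket X Y = X ** Y - Y ** X"

definition lie_subalgebra :: "'n::finite cmat set \<Rightarrow> bool" where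
  "lie_subalgebra L \<longleftrightarrow> cmat.subspace L \<and> (\<forall>x\<in>L. \<forall>y\<in>L. lie_bracket x y \<in> L)"

definition lie_ideal :: "'n::finite cmat set \<Rightarrow> 'n cmat set \<Rightarrow> bool" where
  "lie_ideal L I \<longleftrightarrow> cmat.subspace I \<and> I \<subseteq> L \<and> (\<forall>x\<in>L. \<forall>y\<in>I. lie_bracket x y \<in> I)"

definition simple_lie_algebra :: "'n::finite cmat set \<Rightarrow> bool" where
  "simple_lie_algebra L \<longleftrightarrow>
     lie_subalgebra L \<and> (\<exists>x\<in>L. \<exists>y\<in>L. lie_bracket x y \<noteq> 0) \<and>
     (\<forall>I. lie_ideal L I \<longrightarrow> I = {0} \<or> I = L)"

primrec lower_central :: "'n::finite cmat set \<Rightarrow> nat \<Rightarrow> 'n cmat set" where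
  "lower_central L 0 = L"
| "lower_central L (Suc i) = cmat.span {lie_bracket x y | x y. x \<in> L \<and> y \<in> lower_central L i}"

definition nilpotent_lie :: "'n::finite cmat set \<Rightarrow> bool" where
  "nilpotent_lie L \<longleftrightarrow> lie_subalgebra L \<and> (\<exists>i. lower_central L i = {0})"

text \<open>\<open>N\<close> is the nilradical (largest nilpotent ideal) of \<open>P\<close>.\<close>
definition is_nilradical_of :: "'n::finite cmat set \<Rightarrow> 'n cmat set \<Rightarrow> bool" where
  "is_nilradical_of P N \<longleftrightarrow>
     lie_ideal P N \<and> nilpotent_lie N \<and>
     (\<forall>I. lie_ideal P I \<and> nilpotent_lie I \<longrightarrow> I \<subseteq> N)"

definition killing :: "'n::finite cmat set \<Rightarrow> 'n cmat \<Rightarrow> 'n cmat \<Rightarrow> complex" where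
  "killing L x y = trace_on L (\<lambda>z. lie_bracket x (lie_bracket y z))"

text \<open>Cartan subalgebras of a semisimple Lie algebra: self-centralising abelian subalgebras
  whose elements are ad-diagonalisable.\<close>
definition cartan_subalgebra :: "'n::finite cmat set \<Rightarrow> 'n cmat set \<Rightarrow> bool" where
  "cartan_subalgebra L H \<longleftrightarrow>
     cmat.subspace H \<and> H \<subseteq> L \<and>
     (\<forall>x\<in>H. \<forall>y\<in>H. lie_bracket x y = 0) \<and>
     (\<forall>x\<in>L. (\<forall>h\<in>H. lie_bracket h x = 0) \<longrightarrow> x \<in> H) \<and>
     (\<forall>h\<in>H. L \<subseteq> cmat.span {x \<in> L. \<exists>c. lie_bracket h x = mscale c x})"

section \<open>Linear algebraic groups\<close>

inductive polyfun :: "(complex^'n::finite^'n \<Rightarrow> complex) \<Rightarrow> bool" where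
  const: "polyfun (\<lambda>A. c)"
| entry: "polyfun (\<lambda>A. A $ i $ j)"
| add: "polyfun f \<Longrightarrow> polyfun g \<Longrightarrow> polyfun (\<lambda>A. f A + g A)"
| mult: "polyfun f \<Longrightarrow> polyfun g \<Longrightarrow> polyfun (\<lambda>A. f A * g A)"

definition zariski_closed :: "'n::finite cmat set \<Rightarrow> bool" where
  "zariski_closed Z \<longleftrightarrow> (\<exists>P. (\<forall>f\<in>P. polyfun f) \<and> Z = {A. \<forall>f\<in>P. f A = 0})"

definition zariski_connected :: "'n::finite cmat set \<Rightarrow> bool" where
  "zariski_connected S \<longleftrightarrow>
     \<not> (\<exists>Z1 Z2. zariski_closed Z1 \<and> zariski_closed Z2 \<and> S \<subseteq> Z1 \<union> Z2 \<and>
          S \<inter> Z1 \<noteq> {} \<and> S \<inter> Z2 \<noteq> {} \<and> S \<inter> Z1 \<inter> Z2 = {})"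

definition linear_algebraic_group :: "'n::finite cmat set \<Rightarrow> bool" where
  "linear_algebraic_group G \<longleftrightarrow>
     mat 1 \<in> G \<and> (\<forall>A\<in>G. \<forall>B\<in>G. A ** B \<in> G) \<and> (\<forall>A\<in>G. matrix_inv A \<in> G) \<and>
     (\<exists>Z. zariski_closed Z \<and> G = {A \<in> Z. invertible A})"

text \<open>The tangent space at the identity: all \<open>X\<close> such that every polynomial vanishing on \<open>G\<close> has
  zero derivative at the identity in the direction \<open>X\<close>.\<close>
definition Lie :: "'n::finite cmat set \<Rightarrow> 'n cmat set" where
  "Lie G = {X. \<forall>f. polyfun f \<and> (\<forall>A\<in>G. f A = 0) \<longrightarrow>
              ((\<lambda>s. f (mat 1 + mscale s X)) has_field_derivative 0) (at 0)}"

text \<open>Simplicity of an algebraic group is taken in the sense of Lie theory: finite (central)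
  normal subgroups are allowed, i.e. the Lie algebra is simple.\<close>
definition connected_simple_group :: "'n::finite cmat set \<Rightarrow> bool" where
  "connected_simple_group G \<longleftrightarrow>
     linear_algebraic_group G \<and> zariski_connected G \<and> simple_lie_algebra (Lie G)"

text \<open>A torus is a connected diagonalisable algebraic group.\<close>
definition torus :: "'n::finite cmat set \<Rightarrow> bool" where
  "torus T \<longleftrightarrow>
     linear_algebraic_group T \<and> zariski_connected T \<and>
     (\<exists>P :: 'n cmat. invertible P \<and> (\<forall>A\<in>T. \<forall>i j. i \<noteq> j \<longrightarrow> (P ** A ** matrix_inv P) $ i $ j = 0))"

definition maximal_torus :: "'n::finite cmat set \<Rightarrow> 'n cmat set \<Rightarrow> bool" where
  "maximal_torus G T \<longleftrightarrow>
     torus T \<and> T \<subseteq> G \<and> (\<forall>T'. torus T' \<and> T \<subseteq> T' \<and> T' \<subseteq> G \<longrightarrow> T' = T)"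

text \<open>Stability under the adjoint action.\<close>
definition Ad_stable :: "'n::finite cmat set \<Rightarrow> 'n cmat set \<Rightarrow> bool" where
  "Ad_stable T V \<longleftrightarrow> (\<forall>A\<in>T. \<forall>x\<in>V. A ** x ** matrix_inv A \<in> V)"

section \<open>Roots, nilradicals and the Kostant cascade\<close>

text \<open>\<open>\<gg>\<close> is a Lie algebra, \<open>\<tt>\<close> a Cartan subalgebra, \<open>\<Psi>\<close> a set of simple roots; the
  corresponding hypotheses are collected in \<open>triangular_decomposition\<close> below.\<close>

locale lie_data =
  fixes \<gg> :: "(complex^'n::finite^'n) set"
    and \<tt> :: "(complex^'n^'n) set"
    and \<Psi> :: "(complex^'n^'n \<Rightarrow> complex) set"
begin

text \<open>The dual space of \<open>\<tt>\<close>; functionals are extended by \<open>0\<close> outside \<open>\<tt>\<close>, so that equality of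
  functionals on \<open>\<tt>\<close> is equality of functions.\<close>
definition dual_space :: "'n functional set" where
  "dual_space = {\<gamma>. (\<forall>x\<in>\<tt>. \<forall>y\<in>\<tt>. \<gamma> (x + y) = \<gamma> x + \<gamma> y) \<and>
                    (\<forall>c. \<forall>x\<in>\<tt>. \<gamma> (mscale c x) = c * \<gamma> x) \<and>
                    (\<forall>x. x \<notin> \<tt> \<longrightarrow> \<gamma> x = 0)}"

definition root_space :: "'n functional \<Rightarrow> 'n cmat set" where
  "root_space \<gamma> = {x \<in> \<gg>. \<forall>h\<in>\<tt>. lie_bracket h x = mscale (\<gamma> h) x}"

definition roots :: "'n functional set" where
  "roots = {\<gamma> \<in> dual_space. \<gamma> \<noteq> 0 \<and> root_space \<gamma> \<noteq> {0}}"

text \<open>The bilinear form on \<open>\<tt>\<^sup>*\<close> induced by the Killing form of \<open>\<gg>\<close>.\<close>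
definition dual_vector :: "'n functional \<Rightarrow> 'n cmat" where
  "dual_vector \<gamma> = (THE h. h \<in> \<tt> \<and> (\<forall>h'\<in>\<tt>. killing \<gg> h h' = \<gamma> h'))"

definition root_inner :: "'n functional \<Rightarrow> 'n functional \<Rightarrow> complex" where
  "root_inner \<gamma> \<delta> = killing \<gg> (dual_vector \<gamma>) (dual_vector \<delta>)"

text \<open>\<open>[\<gamma>:\<alpha>]\<close>\<close>
definition root_coeff :: "'n functional \<Rightarrow> 'n functional \<Rightarrow> complex" where
  "root_coeff \<gamma> \<alpha> = cfun.representation \<Psi> \<gamma> \<alpha>"

definition supp :: "'n functional \<Rightarrow> 'n functional set" where
  "supp \<gamma> = {\<alpha> \<in> \<Psi>. root_coeff \<gamma> \<alpha> \<noteq> 0}"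

definition is_base :: bool where
  "is_base \<longleftrightarrow>
     \<Psi> \<subseteq> roots \<and> cfun.independent \<Psi> \<and> roots \<subseteq> cfun.span \<Psi> \<and>
     (\<forall>\<gamma>\<in>roots. (\<forall>\<alpha>\<in>\<Psi>. root_coeff \<gamma> \<alpha> \<in> \<nat>) \<or> (\<forall>\<alpha>\<in>\<Psi>. - root_coeff \<gamma> \<alpha> \<in> \<nat>))"

definition pos_roots :: "'n functional set" where
  "pos_roots = {\<gamma> \<in> roots. \<forall>\<alpha>\<in>\<Psi>. root_coeff \<gamma> \<alpha> \<in> \<nat>}"

text \<open>The sum of the root spaces belonging to a set of roots.\<close>
definition root_span :: "'n functional set \<Rightarrow> 'n cmat set" where
  "root_span S = cmat.span (\<Union>\<gamma>\<in>S. root_space \<gamma>)"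

text \<open>A triangular decomposition \<open>\<gg> = \<uu> \<oplus> \<tt> \<oplus> \<uu>\<^sup>-\<close> is given by a Cartan subalgebra \<open>\<tt>\<close> and a base \<open>\<Psi>\<close>
  of the root system; \<open>\<uu>\<close> and \<open>\<uu>\<^sup>-\<close> are the sums of the positive and of the negative root spaces.\<close>
definition triangular_decomposition :: bool where
  "triangular_decomposition \<longleftrightarrow> cartan_subalgebra \<gg> \<tt> \<and> is_base"

definition borel :: "'n cmat set" where
  "borel = cmat.span (root_span pos_roots \<union> \<tt>)"

definition standard_parabolic :: "'n cmat set \<Rightarrow> bool" where
  "standard_parabolic \<pp> \<longleftrightarrow> lie_subalgebra \<pp> \<and> borel \<subseteq> \<pp> \<and> \<pp> \<subseteq> \<gg>"

definition nilradical :: "'n cmat set \<Rightarrow> bool" where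
  "nilradical \<nn> \<longleftrightarrow> \<nn> \<noteq> {0} \<and> (\<exists>\<pp>. standard_parabolic \<pp> \<and> is_nilradical_of \<pp> \<nn>)"

text \<open>\<open>\<Delta>(\<cc>)\<close>\<close>
definition roots_of :: "'n cmat set \<Rightarrow> 'n functional set" where
  "roots_of \<cc> = {\<gamma> \<in> roots. \<exists>x\<in>\<cc>. x \<noteq> 0 \<and> x \<in> root_space \<gamma>}"

definition irreducible_roots :: "'n functional set \<Rightarrow> bool" where
  "irreducible_roots S \<longleftrightarrow>
     S \<noteq> {} \<and>
     \<not> (\<exists>A B. A \<noteq> {} \<and> B \<noteq> {} \<and> A \<union> B = S \<and> A \<inter> B = {} \<and> (\<forall>\<gamma>\<in>A. \<forall>\<delta>\<in>B. root_inner \<gamma> \<delta> = 0))"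

definition irreducible_component :: "'n functional set \<Rightarrow> 'n functional set \<Rightarrow> bool" where
  "irreducible_component S C \<longleftrightarrow>
     C \<subseteq> S \<and> irreducible_roots C \<and> (\<forall>\<gamma>\<in>C. \<forall>\<delta>\<in>S - C. root_inner \<gamma> \<delta> = 0)"

text \<open>\<open>\<beta>\<close> is the largest element of \<open>S\<close> with respect to the root order of \<open>S\<close>: for every \<open>\<gamma> \<in> S\<close>,
  the difference \<open>\<beta> - \<gamma>\<close> is a (possibly empty) sum of positive roots of \<open>S\<close>.\<close>
definition is_highest_root :: "'n functional set \<Rightarrow> 'n functional \<Rightarrow> bool" where
  "is_highest_root S \<beta> \<longleftrightarrow>
     \<beta> \<in> S \<and> (\<forall>\<gamma>\<in>S. \<exists>\<delta>s. set \<delta>s \<subseteq> S \<inter> pos_roots \<and> \<beta> = \<gamma> + sum_list \<delta>s)"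

text \<open>The irreducible root subsystems whose highest roots form the Kostant cascade.\<close>
inductive_set cascade_systems :: "'n functional set set" where
  whole: "roots \<in> cascade_systems"
| descend: "S \<in> cascade_systems \<Longrightarrow> is_highest_root S \<beta> \<Longrightarrow>
            irreducible_component {\<gamma> \<in> S. root_inner \<gamma> \<beta> = 0} C \<Longrightarrow> C \<in> cascade_systems"

definition cascade :: "'n functional set" where
  "cascade = {\<beta>. \<exists>S\<in>cascade_systems. is_highest_root S \<beta>}"

text \<open>\<open>\<K>(\<nn>)\<close>\<close>
definition cascade_of :: "'n cmat set \<Rightarrow> 'n functional set" where
  "cascade_of \<nn> = cascade \<inter> roots_of \<nn>"

text \<open>A numbering \<open>\<beta> 1, \<dots>, \<beta> m\<close> of the cascade that starts with the highest root \<open>\<theta>\<close> and lists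
  the elements of \<open>\<K>(\<nn>)\<close> first, as \<open>\<beta> 1, \<dots>, \<beta> k\<close>.\<close>
definition cascade_numbering ::
    "'n cmat set \<Rightarrow> nat \<Rightarrow> nat \<Rightarrow> (nat \<Rightarrow> 'n functional) \<Rightarrow> bool" where
  "cascade_numbering \<nn> k m \<beta> \<longleftrightarrow>
     bij_betw \<beta> {1..m} cascade \<and> is_highest_root roots (\<beta> 1) \<and>
     k \<le> m \<and> \<beta> ` {1..k} = cascade_of \<nn>"

text \<open>For \<open>\<beta> = \<beta>\<^sub>i\<close>: \<open>\<Delta>\<langle>i\<rangle>\<close>, \<open>\<H>\<^bsub>\<beta>\<^esub>\<close> and \<open>\<hh>\<^sub>i\<close>.\<close>
definition supp_system :: "'n functional \<Rightarrow> 'n functional set" where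
  "supp_system \<beta> = {\<gamma> \<in> roots. supp \<gamma> \<subseteq> supp \<beta>}"

definition heis_roots :: "'n functional \<Rightarrow> 'n functional set" where
  "heis_roots \<beta> = {\<gamma> \<in> supp_system \<beta> \<inter> pos_roots. root_inner \<gamma> \<beta> \<noteq> 0}"

definition heis :: "'n functional \<Rightarrow> 'n cmat set" where
  "heis \<beta> = root_span (heis_roots \<beta>)"

definition optimisation :: "'n cmat set \<Rightarrow> 'n cmat set" where
  "optimisation \<nn> = cmat.span (\<Union>\<beta>\<in>cascade_of \<nn>. heis \<beta>)"

section \<open>The coadjoint action of a nilradical\<close>

text \<open>The standard parabolic subalgebra with the given nilradical.\<close>
definition parabolic_of :: "'n cmat set \<Rightarrow> 'n cmat set" where
  "parabolic_of \<nn> = (THE \<pp>. standard_parabolic \<pp> \<and> is_nilradical_of \<pp> \<nn>)"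

text \<open>The opposite nilradical \<open>\<nn>\<^sup>-\<close>, which is identified with \<open>\<nn>\<^sup>*\<close>.\<close>
definition opposite :: "'n cmat set \<Rightarrow> 'n cmat set" where
  "opposite \<nn> = root_span {- \<gamma> | \<gamma>. \<gamma> \<in> roots_of \<nn>}"

text \<open>The projection onto \<open>\<nn>\<^sup>-\<close> along \<open>\<pp>\<close>.\<close>
definition proj_opposite :: "'n cmat set \<Rightarrow> 'n cmat \<Rightarrow> 'n cmat" where
  "proj_opposite \<nn> x = (THE y. y \<in> opposite \<nn> \<and> x - y \<in> parabolic_of \<nn>)"

text \<open>\<open>\<nn>\<^sup>\<xi>\<close> for \<open>\<xi>\<close> in the opposite nilradical.\<close>
definition stabiliser :: "'n cmat set \<Rightarrow> 'n cmat \<Rightarrow> 'n cmat set" where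
  "stabiliser \<nn> \<xi> = {x \<in> \<nn>. proj_opposite \<nn> (lie_bracket x \<xi>) = 0}"

text \<open>\<open>\<kk>\<^sub>0\<close>\<close>
definition cascade_points :: "'n cmat set \<Rightarrow> 'n cmat set" where
  "cascade_points \<nn> =
     {\<Sum>\<beta>\<in>cascade_of \<nn>. e \<beta> | e. \<forall>\<beta>\<in>cascade_of \<nn>. e \<beta> \<in> root_space (- \<beta>) \<and> e \<beta> \<noteq> 0}"

text \<open>\<open>\<C>\<^bsub>\<nn>\<^esub>(j)\<close> for \<open>\<beta> = \<beta>\<^sub>j\<close>.\<close>
definition missing_roots :: "'n cmat set \<Rightarrow> 'n functional \<Rightarrow> 'n functional set" where
  "missing_roots \<nn> \<beta> = roots_of (heis \<beta>) - roots_of \<nn>"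

end

end

theory Submission
  imports Defs
begin

text \<open>
  That the Killing form of \<open>\<gg>\<close> is nonzero, hence
  nondegenerate, is read off from the integrality of the weights with respect to the base, so that Cartan's
  criterion is not needed; the theory of root strings then follows from \<open>\<ss>\<ll>\<^sub>2\<close>-chains as usual.

  The positive roots are the disjoint union of the sets \<open>\<H>\<^bsub>\<beta>\<^esub>\<close>, \<open>\<beta>\<close> in the cascade, and a sum
  \<open>\<gamma> + \<delta> = \<beta>\<close> of positive roots forces \<open>\<gamma>, \<delta> \<in> \<H>\<^bsub>\<beta>\<^esub>\<close>. Hence for a cascade point \<open>\<zeta>\<close> and \<open>\<gamma> \<in> \<Delta>(\<nn>)\<close> at most
  one summand of \<open>\<zeta>\<close> moves a root vector of weight \<open>\<gamma>\<close> into \<open>\<nn>\<^sup>-\<close>, namely the one for \<open>\<beta>\<close> with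
  \<open>\<gamma> \<in> \<H>\<^bsub>\<beta>\<^esub>\<close>, and the images for different \<open>\<gamma>\<close> are of different weights. So the stabiliser is the sum of the
  root spaces \<open>\<gg>\<^sub>\<gamma>\<close> with \<open>\<gamma> \<in> \<Delta>(\<nn>)\<close> and \<open>\<beta> - \<gamma> \<notin> \<Delta>(\<nn>)\<close> for all \<open>\<beta> \<in> \<K>(\<nn>)\<close>.
\<close>

text \<open>The passage from this description to the theorem rests on one number: for a positive
  root \<gamma> \<noteq> \<beta> of a subsystem with highest root \<beta>, the Cartan integer of
  \<gamma> against \<beta> is 0 or 1. Two positive roots with sum \<beta> have Cartan integers
  adding to 2, so both are 1. Hence complementing to \<beta> is an involution of
  \<open>heis_roots \<beta>\<close> without \<beta>, and a root of the stabiliser is either some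
  \<beta> or the complement of a missing root; in the optimisation nothing is missing, which leaves
  the cascade. The obstacle: cascade systems arise from orthogonality and from splitting into
  orthogonal parts, while highest roots and supports refer to one fixed base. So each step must be
  shown to return the full subsystem of some simple roots; dominance of \<beta> gives this for
  orthogonal complements, positive definiteness for components. Stability under T is separate: T
  commutes with its Lie algebra, hence preserves every weight space.\<close>

abbreviation mlinear :: "('n::finite cmat \<Rightarrow> 'n cmat) \<Rightarrow> bool" where
  "mlinear \<equiv> module_hom mscale mscale"

lemma mlinearI:
  assumes "\<And>x y. f (x + y) = f x + f y" and "\<And>c x. f (mscale c x) = mscale c (f x)"
  shows "mlinear f"
  using assms by unfold_locales auto

lemma mlinear_comp: "mlinear f \<Longrightarrow> mlinear g \<Longrightarrow> mlinear (\<lambda>x. f (g x))"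
  by (intro mlinearI) (simp_all add: module_hom.add module_hom.scale)

lemma mscale_component [simp]: "mscale c X $ i $ j = c * X $ i $ j"
  by (simp add: mscale_def)

lemma mscale_matrix_mult:
  "mscale c X ** Y = mscale c (X ** Y)" "X ** mscale c Y = mscale c (X ** Y)"
  by (simp_all add: vec_eq_iff matrix_matrix_mult_def sum_distrib_left ac_simps)

lemma cmat_finite_basis: "\<exists>B::'n::finite cmat set. finite B \<and> cmat.span B = UNIV"
proof -
  let ?E = "\<lambda>(i, j). (\<chi> k l. if k = i \<and> l = j then 1 else 0) :: 'n cmat"
  have "X \<in> cmat.span (range ?E)" for X :: "'n cmat"
  proof -
    have "X = (\<Sum>p\<in>UNIV. mscale (X $ fst p $ snd p) (?E p))"
    proof -
      have "(\<Sum>p\<in>UNIV. mscale (X $ fst p $ snd p) (?E p)) $ k $ l =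
          (\<Sum>p\<in>UNIV. if p = (k, l) then X $ k $ l else 0)" for k l
        unfolding sum_component by (intro sum.cong refl) (auto split: if_splits)
      then show ?thesis by (simp add: vec_eq_iff)
    qed
    moreover have "\<dots> \<in> cmat.span (range ?E)"
      by (intro cmat.span_sum cmat.span_scale cmat.span_base) auto
    ultimately show ?thesis by simp
  qed
  then show ?thesis by (intro exI[of _ "range ?E"]) auto
qed

lemma cmat_independent_finite: "cmat.independent B \<Longrightarrow> finite B"
  using cmat_finite_basis cmat.independent_span_bound by (metis subset_UNIV)

lemma cmat_basis_exists:
  assumes "V = cmat.span S"
  obtains B where "B \<subseteq> S" "finite B" "cmat.independent B" "cmat.span B = V"
proof -
  obtain B where B: "B \<subseteq> S" "cmat.independent B" "S \<subseteq> cmat.span B"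
    using cmat.maximal_independent_subset by blast
  then have "cmat.span B = V"
    using assms by (simp add: cmat.span_minimal cmat.span_mono subset_antisym)
  with B show ?thesis using that cmat_independent_finite by blast
qed

section \<open>The Lie bracket of matrices\<close>

lemma lie_bracket_add_left: "lie_bracket (x + y) z = lie_bracket x z + lie_bracket y z"
  by (simp add: lie_bracket_def vec_eq_iff matrix_matrix_mult_def sum.distrib algebra_simps)

lemma lie_bracket_antisym: "lie_bracket x y = - lie_bracket y x"
  by (simp add: lie_bracket_def)

lemma lie_bracket_self [simp]: "lie_bracket x x = 0"
  by (simp add: lie_bracket_def)

lemma lie_bracket_add_right: "lie_bracket z (x + y) = lie_bracket z x + lie_bracket z y"
  using lie_bracket_add_left[of x y z] lie_bracket_antisym[of z] by simp

lemma lie_bracket_scale_left: "lie_bracket (mscale c x) y = mscale c (lie_bracket x y)"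
  by (simp add: lie_bracket_def mscale_matrix_mult cmat.scale_right_diff_distrib)

lemma lie_bracket_scale_right: "lie_bracket x (mscale c y) = mscale c (lie_bracket x y)"
  by (simp add: lie_bracket_def mscale_matrix_mult cmat.scale_right_diff_distrib)

lemma mlinear_bracket: "mlinear (lie_bracket x)" "mlinear (\<lambda>y. lie_bracket y x)"
  by (intro mlinearI; simp add: lie_bracket_add_left lie_bracket_add_right
      lie_bracket_scale_left lie_bracket_scale_right)+

lemma lie_bracket_zero [simp]: "lie_bracket 0 x = 0" "lie_bracket x 0 = 0"
  using module_hom.zero[OF mlinear_bracket(1)] module_hom.zero[OF mlinear_bracket(2)] by auto

lemma lie_bracket_minus: "lie_bracket (- x) y = - lie_bracket x y" "lie_bracket x (- y) = - lie_bracket x y"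
  using module_hom.neg[OF mlinear_bracket(1)] module_hom.neg[OF mlinear_bracket(2)] by auto

lemma lie_bracket_diff:
  "lie_bracket (x - y) z = lie_bracket x z - lie_bracket y z"
  "lie_bracket z (x - y) = lie_bracket z x - lie_bracket z y"
  using module_hom.diff[OF mlinear_bracket(1)] module_hom.diff[OF mlinear_bracket(2)] by auto

lemma lie_bracket_sum:
  "lie_bracket (\<Sum>i\<in>I. f i) z = (\<Sum>i\<in>I. lie_bracket (f i) z)"
  "lie_bracket z (\<Sum>i\<in>I. f i) = (\<Sum>i\<in>I. lie_bracket z (f i))"
  using module_hom.sum[OF mlinear_bracket(1)] module_hom.sum[OF mlinear_bracket(2)] by auto

text \<open>The form ad [x, y] = ad x ad y - ad y ad x, in which brackets inside traces and
  sl2-chains are expanded.\<close>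

lemma jacobi:
  fixes x y z :: "'n::finite cmat"
  shows "lie_bracket (lie_bracket x y) z = lie_bracket x (lie_bracket y z) - lie_bracket y (lie_bracket x z)"
proof -
  have d: "A ** (B - C) = A ** B - A ** C" "(B - C) ** A = B ** A - C ** A" for A B C :: "'n cmat"
    by (simp_all add: vec_eq_iff matrix_matrix_mult_def sum_subtractf algebra_simps)
  show ?thesis by (simp add: lie_bracket_def d matrix_mul_assoc)
qed

lemma mlinear_bracket2:
  "mlinear (\<lambda>v. lie_bracket x (lie_bracket y v))"
  "mlinear (\<lambda>v. lie_bracket x (lie_bracket y (lie_bracket z v)))"
  by (intro mlinearI; simp add: lie_bracket_add_right lie_bracket_scale_right)+

text \<open>Reduces closure statements for ideals and subalgebras to spanning vectors, in practice
  root vectors.\<close>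

lemma bracket_in_span:
  assumes "x \<in> cmat.span A" "y \<in> cmat.span B" "cmat.subspace V"
    and "\<And>a b. a \<in> A \<Longrightarrow> b \<in> B \<Longrightarrow> lie_bracket a b \<in> V"
  shows "lie_bracket x y \<in> V"
proof -
  have 1: "lie_bracket a y \<in> V" if "a \<in> A" for a
    using assms(2)
  proof (induction rule: cmat.span_induct_alt)
    case base then show ?case using assms(3) by (simp add: cmat.subspace_0)
  next
    case (step c x y) then show ?case using assms(3,4) that
      by (simp add: lie_bracket_add_right lie_bracket_scale_right cmat.subspace_add cmat.subspace_scale)
  qed
  show ?thesis using assms(1)
  proof (induction rule: cmat.span_induct_alt)
    case base then show ?case using assms(3) by (simp add: cmat.subspace_0)
  next
    case (step c x y) then show ?case using assms(3) 1
      by (simp add: lie_bracket_add_left lie_bracket_scale_left cmat.subspace_add cmat.subspace_scale)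
  qed
qed

section \<open>Traces and the Killing form\<close>

text \<open>\<open>trace_on\<close> takes its basis from a choice operator. With the basis as an
  argument, independence of the basis can be expressed and a basis of weight vectors
  inserted.\<close>

definition basis_trace :: "'n::finite cmat set \<Rightarrow> ('n cmat \<Rightarrow> 'n cmat) \<Rightarrow> complex" where
  "basis_trace B f = (\<Sum>b\<in>B. cmat.representation B (f b) b)"

text \<open>Change of basis without matrices: expanding every b in C and every f c in B turns both
  traces into the same double sum.\<close>

lemma basis_trace_unique:
  assumes B: "cmat.independent B" and C: "cmat.independent C" and eq: "cmat.span B = cmat.span C"
    and f: "mlinear f" and st: "\<And>v. v \<in> cmat.span B \<Longrightarrow> f v \<in> cmat.span B"
  shows "basis_trace B f = basis_trace C f"
proof -
  note fin = cmat_independent_finite[OF B] cmat_independent_finite[OF C]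
  let ?b = "cmat.representation B" and ?c = "cmat.representation C"
  have bC: "b \<in> cmat.span C" if "b \<in> B" for b using that eq cmat.span_base by blast
  have bc: "f v \<in> cmat.span B" if "v \<in> B \<union> C" for v
    using that st eq cmat.span_base by blast
  have "basis_trace B f = (\<Sum>b\<in>B. ?b (f (\<Sum>c\<in>C. mscale (?c b c) c)) b)"
    unfolding basis_trace_def
    by (intro sum.cong refl, subst cmat.sum_representation_eq[OF C _ fin(2) order.refl])
      (simp_all add: eq[symmetric] cmat.span_base)
  also have "\<dots> = (\<Sum>b\<in>B. \<Sum>c\<in>C. ?c b c * ?b (f c) b)"
    using bc by (intro sum.cong refl)
      (simp add: module_hom.sum[OF f] module_hom.scale[OF f] cmat.representation_sum[OF B]
        cmat.representation_scale[OF B] cmat.span_scale)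
  also have "\<dots> = (\<Sum>c\<in>C. \<Sum>b\<in>B. ?c b c * ?b (f c) b)"
    by (rule sum.swap)
  also have "\<dots> = (\<Sum>c\<in>C. ?c (\<Sum>b\<in>B. mscale (?b (f c) b) b) c)"
    by (intro sum.cong refl, subst cmat.representation_sum[OF C])
       (auto simp: cmat.representation_scale[OF C bC] bC mult.commute
          intro!: cmat.span_scale sum.cong)
  also have "\<dots> = basis_trace C f"
    unfolding basis_trace_def
    using cmat.sum_representation_eq[OF B _ fin(1) order.refl] bc
    by (intro sum.cong refl) auto
  finally show ?thesis .
qed

lemma trace_on_eq:
  assumes B: "cmat.independent B" and eq: "cmat.span B = V"
    and f: "mlinear f" and st: "\<And>v. v \<in> V \<Longrightarrow> f v \<in> V"
  shows "trace_on V f = basis_trace B f"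
proof -
  define C where "C = (SOME B. cmat.independent B \<and> cmat.span B = V)"
  have "cmat.independent C \<and> cmat.span C = V"
    unfolding C_def by (rule someI[of _ B]) (use assms in auto)
  then have "basis_trace C f = basis_trace B f"
    by (intro basis_trace_unique) (use assms in auto)
  then show ?thesis by (simp add: trace_on_def C_def basis_trace_def Let_def)
qed

context
  fixes V :: "'n::finite cmat set"
  assumes V: "cmat.subspace V"
begin

lemma subspace_basis:
  obtains B where "B \<subseteq> V" "finite B" "cmat.independent B" "cmat.span B = V"
  using cmat_basis_exists[of V V] V by (metis cmat.span_eq_iff)

lemma trace_on_add:
  assumes "mlinear f" "mlinear g" and "\<And>v. v \<in> V \<Longrightarrow> f v \<in> V" "\<And>v. v \<in> V \<Longrightarrow> g v \<in> V"
  shows "trace_on V (\<lambda>x. f x + g x) = trace_on V f + trace_on V g"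
proof -
  obtain B where B: "B \<subseteq> V" "finite B" "cmat.independent B" "cmat.span B = V"
    by (rule subspace_basis)
  have l: "mlinear (\<lambda>x. f x + g x)"
    using assms(1,2) by (intro mlinearI)
      (simp_all add: module_hom.add module_hom.scale cmat.scale_right_distrib)
  have s: "f v + g v \<in> V" if "v \<in> V" for v using that assms V by (simp add: cmat.subspace_add)
  show ?thesis
    unfolding trace_on_eq[OF B(3,4) l s, simplified] trace_on_eq[OF B(3,4) assms(1,3), simplified]
      trace_on_eq[OF B(3,4) assms(2,4), simplified] basis_trace_def sum.distrib[symmetric]
    by (rule sum.cong[OF refl], subst cmat.representation_add)
      (use B assms in \<open>auto simp: subset_iff\<close>)
qed

lemma trace_on_scale:
  assumes "mlinear f" and "\<And>v. v \<in> V \<Longrightarrow> f v \<in> V"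
  shows "trace_on V (\<lambda>x. mscale c (f x)) = c * trace_on V f"
proof -
  obtain B where B: "B \<subseteq> V" "finite B" "cmat.independent B" "cmat.span B = V"
    by (rule subspace_basis)
  have l: "mlinear (\<lambda>x. mscale c (f x))"
    using assms(1) by (intro mlinearI)
      (simp_all add: module_hom.add module_hom.scale cmat.scale_right_distrib mult.commute)
  have s: "mscale c (f v) \<in> V" if "v \<in> V" for v using that assms V by (simp add: cmat.subspace_scale)
  show ?thesis
    unfolding trace_on_eq[OF B(3,4) l s, simplified] trace_on_eq[OF B(3,4) assms, simplified]
      basis_trace_def sum_distrib_left
    by (rule sum.cong[OF refl], subst cmat.representation_scale)
      (use B assms in \<open>auto simp: subset_iff\<close>)
qed

lemma trace_on_commute:
  assumes f: "mlinear f" and g: "mlinear g"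
    and sf: "\<And>v. v \<in> V \<Longrightarrow> f v \<in> V" and sg: "\<And>v. v \<in> V \<Longrightarrow> g v \<in> V"
  shows "trace_on V (\<lambda>x. f (g x)) = trace_on V (\<lambda>x. g (f x))"
proof -
  obtain B where B: "B \<subseteq> V" "finite B" "cmat.independent B" "cmat.span B = V"
    by (rule subspace_basis)
  let ?r = "cmat.representation B"
  have *: "?r (f (g b)) b = (\<Sum>c\<in>B. ?r (g b) c * ?r (f c) b)"
    if b: "b \<in> B" and f: "mlinear f" and sf: "\<And>v. v \<in> V \<Longrightarrow> f v \<in> V"
      and sg: "\<And>v. v \<in> V \<Longrightarrow> g v \<in> V" for b f g
  proof -
    have "g b = (\<Sum>c\<in>B. mscale (?r (g b) c) c)"
      using cmat.sum_representation_eq[OF B(3) _ B(2) order.refl] B sg b by auto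
    then have "f (g b) = (\<Sum>c\<in>B. mscale (?r (g b) c) (f c))"
      by (metis (no_types, lifting) module_hom.sum[OF f] module_hom.scale[OF f] sum.cong)
    moreover have "?r (\<Sum>c\<in>B. mscale (?r (g b) c) (f c)) b = (\<Sum>c\<in>B. ?r (g b) c * ?r (f c) b)"
    proof -
      have fc: "f c \<in> cmat.span B" if "c \<in> B" for c using that B sf by auto
      then show ?thesis
        by (subst cmat.representation_sum[OF B(3)])
          (auto simp: cmat.representation_scale[OF B(3)] intro!: cmat.span_scale)
    qed
    ultimately show ?thesis by simp
  qed
  have "basis_trace B (\<lambda>x. f (g x)) = (\<Sum>b\<in>B. \<Sum>c\<in>B. ?r (g b) c * ?r (f c) b)"
    unfolding basis_trace_def using *[OF _ f sf sg] by (intro sum.cong) auto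
  also have "\<dots> = (\<Sum>c\<in>B. \<Sum>b\<in>B. ?r (g b) c * ?r (f c) b)" by (rule sum.swap)
  also have "\<dots> = basis_trace B (\<lambda>x. g (f x))"
    unfolding basis_trace_def by (intro sum.cong refl) (simp add: *[of _ g f, OF _ g sg sf] mult.commute)
  finally show ?thesis
    using trace_on_eq[OF B(3,4) mlinear_comp[OF f g]] trace_on_eq[OF B(3,4) mlinear_comp[OF g f]]
      sf sg by auto
qed

text \<open>The trace is c times the size of a basis, and that size is a nonzero complex
  number.\<close>

lemma trace_on_scalar:
  assumes "mlinear f" and f: "\<And>v. v \<in> V \<Longrightarrow> f v = mscale c v" and "trace_on V f = 0" and "V \<noteq> {0}"
  shows "c = 0"
proof -
  obtain B where B: "B \<subseteq> V" "finite B" "cmat.independent B" "cmat.span B = V"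
    by (rule subspace_basis)
  have "trace_on V f = basis_trace B f"
    using f V by (intro trace_on_eq[OF B(3,4) assms(1)]) (simp add: cmat.subspace_scale)
  also have "\<dots> = (\<Sum>b\<in>B. c)"
    unfolding basis_trace_def using B f by (intro sum.cong refl)
      (auto simp: cmat.representation_scale cmat.span_base cmat.representation_basis subset_iff)
  moreover have "B \<noteq> {}" using B(4) assms(4) by auto
  ultimately show ?thesis using assms(3) B(2) by simp
qed

end

context
  fixes L :: "'n::finite cmat set"
  assumes L: "lie_subalgebra L"
begin

lemma subalgebra_subspace: "cmat.subspace L"
  and subalgebra_bracket: "x \<in> L \<Longrightarrow> y \<in> L \<Longrightarrow> lie_bracket x y \<in> L"
  using L by (auto simp: lie_subalgebra_def)

lemma killing_add_left:
  assumes "x \<in> L" "y \<in> L" "z \<in> L"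
  shows "killing L (x + y) z = killing L x z + killing L y z"
  unfolding killing_def lie_bracket_add_left
  by (intro trace_on_add mlinear_bracket2 subalgebra_subspace subalgebra_bracket assms)

lemma killing_scale_left:
  assumes "x \<in> L" "z \<in> L"
  shows "killing L (mscale c x) z = c * killing L x z"
  unfolding killing_def lie_bracket_scale_left
  by (intro trace_on_scale mlinear_bracket2 subalgebra_subspace subalgebra_bracket assms)

lemma killing_sym:
  assumes "x \<in> L" "y \<in> L"
  shows "killing L x y = killing L y x"
  unfolding killing_def
  by (intro trace_on_commute mlinear_bracket subalgebra_subspace subalgebra_bracket assms)

lemma killing_add_right:
  assumes "x \<in> L" "y \<in> L" "z \<in> L"
  shows "killing L z (x + y) = killing L z x + killing L z y"
  using assms killing_add_left killing_sym cmat.subspace_add[OF subalgebra_subspace] by metis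

lemma killing_scale_right:
  assumes "x \<in> L" "z \<in> L"
  shows "killing L z (mscale c x) = c * killing L z x"
  using assms killing_scale_left killing_sym cmat.subspace_scale[OF subalgebra_subspace] by metis

lemma killing_zero [simp]: "x \<in> L \<Longrightarrow> killing L 0 x = 0" "x \<in> L \<Longrightarrow> killing L x 0 = 0"
  using killing_scale_left[of x x 0] killing_scale_right[of x x 0] by auto

lemma killing_minus_left: "x \<in> L \<Longrightarrow> z \<in> L \<Longrightarrow> killing L (- x) z = - killing L x z"
  using killing_scale_left[of x z "-1"] by simp

text \<open>Both sides equal tr(ad x ad y ad z) - tr(ad x ad z ad y); on the left the second term
  arises from tr(ad y ad x ad z) by moving ad y to the end.\<close>

lemma killing_invariant:
  assumes "x \<in> L" "y \<in> L" "z \<in> L"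
  shows "killing L (lie_bracket x y) z = killing L x (lie_bracket y z)"
proof -
  let ?t = "trace_on L" and ?b = lie_bracket
  note l = mlinear_bracket(1) mlinear_bracket2 and s = subalgebra_subspace subalgebra_bracket assms
  have mneg: "- X = mscale (-1) X" for X :: "'n cmat" by (simp add: vec_eq_iff)
  \<comment> \<open>The difference is written as a sum with a factor -1, to match
    \<open>trace_on_add\<close> and \<open>trace_on_scale\<close>.\<close>
  have "killing L (?b x y) z = ?t (\<lambda>v. ?b x (?b y (?b z v)) + mscale (-1) (?b y (?b x (?b z v))))"
    by (simp add: killing_def jacobi)
  also have "\<dots> = ?t (\<lambda>v. ?b x (?b y (?b z v))) + ?t (\<lambda>v. mscale (-1) (?b y (?b x (?b z v))))"
    by (rule trace_on_add)
       (intro l s cmat.subspace_scale | intro mlinearI | simp add: lie_bracket_add_right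
          lie_bracket_scale_right cmat.scale_right_diff_distrib mult.commute)+
  also have "?t (\<lambda>v. mscale (-1) (?b y (?b x (?b z v)))) = -1 * ?t (\<lambda>v. ?b y (?b x (?b z v)))"
    by (rule trace_on_scale) (intro l s)+
  also have "?t (\<lambda>v. ?b y (?b x (?b z v))) = ?t (\<lambda>v. ?b x (?b z (?b y v)))"
    by (rule trace_on_commute[of L "?b y" "\<lambda>v. ?b x (?b z v)"]) (simp_all add: l s)
  finally have 1: "killing L (?b x y) z = ?t (\<lambda>v. ?b x (?b y (?b z v))) - ?t (\<lambda>v. ?b x (?b z (?b y v)))"
    by simp
  have "killing L x (?b y z) = ?t (\<lambda>v. ?b x (?b y (?b z v)) + mscale (-1) (?b x (?b z (?b y v))))"
    by (simp add: killing_def jacobi lie_bracket_diff)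
  also have "\<dots> = ?t (\<lambda>v. ?b x (?b y (?b z v))) + ?t (\<lambda>v. mscale (-1) (?b x (?b z (?b y v))))"
    by (rule trace_on_add)
       (intro l s cmat.subspace_scale | intro mlinearI | simp add: lie_bracket_add_right
          lie_bracket_scale_right cmat.scale_right_diff_distrib mult.commute)+
  also have "?t (\<lambda>v. mscale (-1) (?b x (?b z (?b y v)))) = -1 * ?t (\<lambda>v. ?b x (?b z (?b y v)))"
    by (rule trace_on_scale) (intro l s)+
  finally show ?thesis using 1 by simp
qed

end

section \<open>Weight spaces\<close>

text \<open>The index set may be infinite, for instance all candidate eigenvalues of an operator.
  The components are therefore a function that vanishes outside a finite F.\<close>

lemma span_Union_subspaces:
  fixes W :: "'i \<Rightarrow> 'n::finite cmat set"
  assumes W: "\<And>i. i \<in> I \<Longrightarrow> cmat.subspace (W i)" and x: "x \<in> cmat.span (\<Union>i\<in>I. W i)"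
  obtains F w where "finite F" "F \<subseteq> I" "\<And>i. i \<in> I \<Longrightarrow> w i \<in> W i" "\<And>i. i \<notin> F \<Longrightarrow> w i = 0"
    "x = (\<Sum>i\<in>F. w i)"
proof -
  have "\<exists>F w. finite F \<and> F \<subseteq> I \<and> (\<forall>i\<in>I. w i \<in> W i) \<and> (\<forall>i. i \<notin> F \<longrightarrow> w i = 0) \<and> x = (\<Sum>i\<in>F. w i)"
    using x
  proof (induction rule: cmat.span_induct_alt)
    case base
    show ?case using W by (intro exI[of _ "{}"] exI[of _ "\<lambda>_. 0"]) (auto simp: cmat.subspace_0)
  next
    case (step c y x)
    then obtain F w i where F: "finite F" "F \<subseteq> I" "\<forall>i\<in>I. w i \<in> W i" "\<forall>i. i \<notin> F \<longrightarrow> w i = 0"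
      "x = (\<Sum>i\<in>F. w i)" and i: "i \<in> I" "y \<in> W i" by auto
    define v where "v = (\<lambda>j. if j = i then mscale c y + w i else w j)"
    have "(\<Sum>j\<in>insert i F. v j) = (\<Sum>j\<in>insert i F. w j + (if j = i then mscale c y else 0))"
      by (intro sum.cong) (auto simp: v_def)
    also have "\<dots> = (\<Sum>j\<in>insert i F. w j) + mscale c y"
      using F(1) by (simp add: sum.distrib)
    also have "(\<Sum>j\<in>insert i F. w j) = x"
      unfolding F(5) by (rule sum.mono_neutral_right) (use F in auto)
    finally have "mscale c y + x = (\<Sum>j\<in>insert i F. v j)" by simp
    moreover have "\<forall>j\<in>I. v j \<in> W j"
      using F(3) i W by (auto simp: v_def cmat.subspace_add cmat.subspace_scale)
    ultimately show ?case using F i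
      by (intro exI[of _ "insert i F"] exI[of _ v]) (auto simp: v_def)
  qed
  then show ?thesis using that by blast
qed

text \<open>Elimination of one weight \<delta> at a time: if h separates \<gamma> from \<delta>, the
  operator ad h - \<delta>(h) preserves V, kills the \<delta>-component and multiplies the
  \<gamma>-component by a nonzero number. With V = {0} this becomes independence of weight
  vectors.\<close>

lemma weight_components_in_subspace:
  fixes w :: "('n::finite cmat \<Rightarrow> complex) \<Rightarrow> 'n cmat"
  assumes V: "cmat.subspace V" and stable: "\<And>h x. h \<in> H \<Longrightarrow> x \<in> V \<Longrightarrow> lie_bracket h x \<in> V"
    and "finite F"
    and "\<And>\<gamma> \<delta>. \<gamma> \<in> F \<Longrightarrow> \<delta> \<in> F \<Longrightarrow> \<gamma> \<noteq> \<delta> \<Longrightarrow> \<exists>h\<in>H. \<gamma> h \<noteq> \<delta> h"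
    and "\<And>\<gamma> h. \<gamma> \<in> F \<Longrightarrow> h \<in> H \<Longrightarrow> lie_bracket h (w \<gamma>) = mscale (\<gamma> h) (w \<gamma>)"
    and "(\<Sum>\<gamma>\<in>F. w \<gamma>) \<in> V" and "\<gamma> \<in> F"
  shows "w \<gamma> \<in> V"
  using assms(3-)
proof (induction F arbitrary: w \<gamma> rule: finite_induct)
  case empty then show ?case by simp
next
  case (insert \<delta> F)
  have z: "w \<gamma> \<in> V" if \<gamma>: "\<gamma> \<in> F" for \<gamma>
  proof -
    obtain h where h: "h \<in> H" "\<gamma> h \<noteq> \<delta> h" using insert \<gamma> by (metis insertCI)
    define v where "v = (\<lambda>\<gamma>. mscale (\<gamma> h - \<delta> h) (w \<gamma>))"
    have "(\<Sum>\<gamma>\<in>F. v \<gamma>) = (\<Sum>\<gamma>\<in>insert \<delta> F. v \<gamma>)"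
      using insert.hyps by (simp add: v_def)
    also have "\<dots> = (\<Sum>\<gamma>\<in>insert \<delta> F. lie_bracket h (w \<gamma>) - mscale (\<delta> h) (w \<gamma>))"
      using insert.prems(2) h(1)
      by (intro sum.cong refl) (simp add: v_def cmat.scale_left_diff_distrib)
    also have "\<dots> = lie_bracket h (\<Sum>\<gamma>\<in>insert \<delta> F. w \<gamma>) - mscale (\<delta> h) (\<Sum>\<gamma>\<in>insert \<delta> F. w \<gamma>)"
      by (simp only: sum_subtractf lie_bracket_sum cmat.scale_sum_right)
    also have "\<dots> \<in> V"
      using insert.prems(3) V stable[OF h(1)] by (simp only: cmat.subspace_diff cmat.subspace_scale)
    finally have "v \<gamma> \<in> V"
    proof (rule insert.IH[rotated 2])
      show "lie_bracket h' (v \<gamma>) = mscale (\<gamma> h') (v \<gamma>)" if "\<gamma> \<in> F" "h' \<in> H" for \<gamma> h'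
        using insert.prems(2)[of \<gamma> h'] that
        by (simp add: v_def lie_bracket_scale_right mult.commute)
    qed (use insert.prems \<gamma> in auto)
    then have "mscale (inverse (\<gamma> h - \<delta> h)) (v \<gamma>) \<in> V" using V by (simp add: cmat.subspace_scale)
    then show ?thesis using h by (simp add: v_def)
  qed
  have "w \<delta> = (\<Sum>\<gamma>\<in>insert \<delta> F. w \<gamma>) - (\<Sum>\<gamma>\<in>F. w \<gamma>)" using insert.hyps by simp
  also have "\<dots> \<in> V" by (rule cmat.subspace_diff[OF V insert.prems(3) cmat.subspace_sum[OF V z]])
  finally show ?case using z insert.prems(4) by auto
qed

lemma weight_vectors_independent:
  fixes w :: "('n::finite cmat \<Rightarrow> complex) \<Rightarrow> 'n cmat"
  assumes "finite F"
    and "\<And>\<gamma> \<delta>. \<gamma> \<in> F \<Longrightarrow> \<delta> \<in> F \<Longrightarrow> \<gamma> \<noteq> \<delta> \<Longrightarrow> \<exists>h\<in>H. \<gamma> h \<noteq> \<delta> h"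
    and "\<And>\<gamma> h. \<gamma> \<in> F \<Longrightarrow> h \<in> H \<Longrightarrow> lie_bracket h (w \<gamma>) = mscale (\<gamma> h) (w \<gamma>)"
    and "(\<Sum>\<gamma>\<in>F. w \<gamma>) = 0" and "\<gamma> \<in> F"
  shows "w \<gamma> = 0"
  using weight_components_in_subspace[of "{0}" H F w \<gamma>] assms by (simp add: cmat.subspace_def)

text \<open>Split a joint eigenvector x of S into eigenvectors w c of the new element h. As s in S
  commutes with h, the vectors [s, w c] - d w c are again eigenvectors of h for distinct
  eigenvalues; their sum is zero, so each of them is, and every w c is still an eigenvector of
  s.\<close>

lemma simultaneous_eigenvectors:
  fixes L :: "'n::finite cmat set"
  assumes L: "cmat.subspace L" and "finite S"
    and comm: "\<And>s t. s \<in> S \<Longrightarrow> t \<in> S \<Longrightarrow> lie_bracket s t = 0"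
    and diag: "\<And>s. s \<in> S \<Longrightarrow> L \<subseteq> cmat.span {x \<in> L. \<exists>c. lie_bracket s x = mscale c x}"
  shows "L \<subseteq> cmat.span {x \<in> L. \<forall>s\<in>S. \<exists>c. lie_bracket s x = mscale c x}"
  using assms(2-)
proof (induction S rule: finite_induct)
  case empty then show ?case by (simp add: cmat.span_superset)
next
  case (insert h S)
  let ?E = "{x \<in> L. \<forall>s\<in>insert h S. \<exists>c. lie_bracket s x = mscale c x}"
  let ?W = "\<lambda>c. {x \<in> L. lie_bracket h x = mscale c x}"
  have W: "cmat.subspace (?W c)" for c
    using L by (auto simp: cmat.subspace_def lie_bracket_add_right lie_bracket_scale_right
        cmat.scale_right_distrib mult.commute)
  have "{x \<in> L. \<forall>s\<in>S. \<exists>c. lie_bracket s x = mscale c x} \<subseteq> cmat.span ?E"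
  proof
    fix x assume x: "x \<in> {x \<in> L. \<forall>s\<in>S. \<exists>c. lie_bracket s x = mscale c x}"
    have "x \<in> cmat.span (\<Union>c\<in>UNIV. ?W c)"
    proof -
      have "(\<Union>c\<in>UNIV. ?W c) = {x \<in> L. \<exists>c. lie_bracket h x = mscale c x}" by auto
      moreover have "x \<in> L" using x by simp
      ultimately show ?thesis using insert.prems(2)[of h] by auto
    qed
    from span_Union_subspaces[OF W this] obtain F w where
      F: "finite F" and F': "\<And>c. c \<in> UNIV \<Longrightarrow> w c \<in> ?W c" and xw: "x = (\<Sum>c\<in>F. w c)" by blast
    note F = F F'[OF UNIV_I]
    have "w c \<in> ?E" if c: "c \<in> F" for c
    proof -
      have "\<exists>d. lie_bracket s (w c) = mscale d (w c)" if s: "s \<in> S" for s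
      proof -
        obtain d where d: "lie_bracket s x = mscale d x" using x s by auto
        define v where "v = (\<lambda>c. lie_bracket s (w c) - mscale d (w c))"
        have hv: "lie_bracket h (v c) = mscale c (v c)" for c
        proof -
          have "lie_bracket h (lie_bracket s (w c)) = lie_bracket s (lie_bracket h (w c))"
            using jacobi[of h s "w c"] insert.prems(1)[of h s] s by simp
          then show ?thesis using F(2)[of c]
            by (simp add: v_def lie_bracket_diff lie_bracket_scale_right
                cmat.scale_right_diff_distrib mult.commute)
        qed
        have "(\<Sum>c\<in>F. v c) = 0"
          using d unfolding xw by (simp add: v_def sum_subtractf lie_bracket_sum cmat.scale_sum_right)
        \<comment> \<open>Eigenvalues of the single operator h are encoded as constant functions, so
          that the statement on weight vectors applies with H = {h}.\<close>
        moreover have inj: "inj_on (\<lambda>c (_::'n cmat). c) F" by (auto simp: inj_on_def fun_eq_iff)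
        ultimately have "(\<Sum>\<gamma>\<in>(\<lambda>c _. c) ` F. v (\<gamma> h)) = 0"
          by (subst sum.reindex) auto
        then have "v ((\<lambda>_. c) h) = 0"
          by (rule weight_vectors_independent[of "(\<lambda>c _. c) ` F" "{h}" "\<lambda>\<gamma>. v (\<gamma> h)", rotated 3])
            (use F c hv in \<open>auto simp: fun_eq_iff\<close>)
        then show ?thesis by (auto simp: v_def)
      qed
      then show ?thesis using F(2)[of c] by auto
    qed
    then show "x \<in> cmat.span ?E" unfolding xw by (intro cmat.span_sum cmat.span_base)
  qed
  then have "cmat.span {x \<in> L. \<forall>s\<in>S. \<exists>c. lie_bracket s x = mscale c x} \<subseteq> cmat.span ?E"
    by (rule cmat.span_minimal) simp
  then show ?case using insert by blast
qed

section \<open>The simple Lie algebra and its root space decomposition\<close>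

locale simple_lie = lie_data \<gg> \<tt> \<Psi>
  for \<gg> \<tt> :: "(complex^'n::finite^'n) set" and \<Psi> :: "(complex^'n^'n \<Rightarrow> complex) set" +
  assumes simple: "simple_lie_algebra \<gg>"
    and tri: "triangular_decomposition"
begin

notation lie_bracket ("\<lbrakk>_, _\<rbrakk>")

abbreviation \<kappa> where "\<kappa> \<equiv> killing \<gg>"

lemma subalg: "lie_subalgebra \<gg>"
  using simple by (simp add: simple_lie_algebra_def)

lemma ideal_cases: "lie_ideal \<gg> I \<Longrightarrow> I = {0} \<or> I = \<gg>"
  using simple by (simp add: simple_lie_algebra_def)

lemma nonabelian: "\<exists>x\<in>\<gg>. \<exists>y\<in>\<gg>. \<lbrakk>x, y\<rbrakk> \<noteq> 0"
  using simple by (simp add: simple_lie_algebra_def)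

lemmas \<gg>_subspace = subalgebra_subspace[OF subalg]
lemmas \<gg>_bracket = subalgebra_bracket[OF subalg]
lemmas \<gg>_closed = cmat.subspace_0[OF \<gg>_subspace] cmat.subspace_add[OF \<gg>_subspace]
  cmat.subspace_scale[OF \<gg>_subspace] cmat.subspace_diff[OF \<gg>_subspace]
  cmat.subspace_neg[OF \<gg>_subspace]

lemma cartan: "cartan_subalgebra \<gg> \<tt>" and base: is_base
  using tri by (auto simp: triangular_decomposition_def)

lemma \<tt>_subspace: "cmat.subspace \<tt>"
  and \<tt>_sub: "\<tt> \<subseteq> \<gg>"
  and \<tt>_abelian: "x \<in> \<tt> \<Longrightarrow> y \<in> \<tt> \<Longrightarrow> \<lbrakk>x, y\<rbrakk> = 0"
  and \<tt>_self: "x \<in> \<gg> \<Longrightarrow> (\<And>h. h \<in> \<tt> \<Longrightarrow> \<lbrakk>h, x\<rbrakk> = 0) \<Longrightarrow> x \<in> \<tt>"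
  and \<tt>_diag: "h \<in> \<tt> \<Longrightarrow> \<gg> \<subseteq> cmat.span {x \<in> \<gg>. \<exists>c. \<lbrakk>h, x\<rbrakk> = mscale c x}"
  using cartan by (auto simp: cartan_subalgebra_def)

lemmas \<tt>_closed = cmat.subspace_0[OF \<tt>_subspace] cmat.subspace_add[OF \<tt>_subspace]
  cmat.subspace_scale[OF \<tt>_subspace] cmat.subspace_diff[OF \<tt>_subspace]
  cmat.subspace_neg[OF \<tt>_subspace]

lemma \<tt>_in_\<gg>: "h \<in> \<tt> \<Longrightarrow> h \<in> \<gg>" using \<tt>_sub by auto

lemma dual_space_subspace: "cfun.subspace dual_space"
  by (auto simp: cfun.subspace_def dual_space_def fscale_def algebra_simps)

lemmas dual_closed = cfun.subspace_0[OF dual_space_subspace] cfun.subspace_add[OF dual_space_subspace]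
  cfun.subspace_scale[OF dual_space_subspace] cfun.subspace_diff[OF dual_space_subspace]
  cfun.subspace_neg[OF dual_space_subspace] cfun.subspace_sum[OF dual_space_subspace]

lemma dual_scale: "\<gamma> \<in> dual_space \<Longrightarrow> x \<in> \<tt> \<Longrightarrow> \<gamma> (mscale c x) = c * \<gamma> x"
  by (auto simp: dual_space_def)

lemma dual_zero: "\<gamma> \<in> dual_space \<Longrightarrow> \<gamma> 0 = 0"
  using dual_scale[of \<gamma> 0 0] \<tt>_closed(1) by simp

lemma dual_eqI: "\<gamma> \<in> dual_space \<Longrightarrow> \<delta> \<in> dual_space \<Longrightarrow> (\<And>h. h \<in> \<tt> \<Longrightarrow> \<gamma> h = \<delta> h) \<Longrightarrow> \<gamma> = \<delta>"
  by (auto simp: fun_eq_iff dual_space_def) metis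

lemma root_space_in_\<gg>: "x \<in> root_space \<gamma> \<Longrightarrow> x \<in> \<gg>"
  and root_space_eigen: "x \<in> root_space \<gamma> \<Longrightarrow> h \<in> \<tt> \<Longrightarrow> \<lbrakk>h, x\<rbrakk> = mscale (\<gamma> h) x"
  by (auto simp: root_space_def)

lemma root_space_subspace: "cmat.subspace (root_space \<gamma>)"
  using \<gg>_closed by (auto simp: cmat.subspace_def root_space_def lie_bracket_add_right
      lie_bracket_scale_right cmat.scale_right_distrib mult.commute)

lemmas root_space_closed = cmat.subspace_0[OF root_space_subspace] cmat.subspace_add[OF root_space_subspace]
  cmat.subspace_scale[OF root_space_subspace] cmat.subspace_diff[OF root_space_subspace]
  cmat.subspace_neg[OF root_space_subspace]

lemma root_space_zero: "root_space 0 = \<tt>"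
  using \<tt>_self \<tt>_sub \<tt>_abelian by (auto simp: root_space_def)

lemma root_space_bracket:
  assumes x: "x \<in> root_space \<gamma>" and y: "y \<in> root_space \<delta>"
  shows "\<lbrakk>x, y\<rbrakk> \<in> root_space (\<gamma> + \<delta>)"
proof -
  have "\<lbrakk>h, \<lbrakk>x, y\<rbrakk>\<rbrakk> = mscale (\<gamma> h + \<delta> h) \<lbrakk>x, y\<rbrakk>" if "h \<in> \<tt>" for h
    using jacobi[of h x y] root_space_eigen[OF x that] root_space_eigen[OF y that]
    by (simp add: lie_bracket_scale_left lie_bracket_scale_right cmat.scale_left_distrib algebra_simps)
  then show ?thesis using x y \<gg>_bracket by (auto simp: root_space_def)
qed

text \<open>The weight 0 stands for the Cartan subalgebra, which is \<open>root_space 0\<close>, so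
  that one sum over \<open>weights\<close> decomposes the whole algebra.\<close>

definition weights :: "'n functional set" where
  "weights = insert 0 roots"

lemma root_dual: "\<gamma> \<in> roots \<Longrightarrow> \<gamma> \<in> dual_space"
  and root_nonzero: "\<gamma> \<in> roots \<Longrightarrow> \<gamma> \<noteq> 0"
  by (auto simp: roots_def)

lemma zero_not_root: "0 \<notin> roots" using root_nonzero by blast

lemma root_vector: "\<gamma> \<in> roots \<Longrightarrow> \<exists>x\<in>root_space \<gamma>. x \<noteq> 0"
  using root_space_closed(1) by (force simp: roots_def)

lemma weight_dual: "\<gamma> \<in> weights \<Longrightarrow> \<gamma> \<in> dual_space"
  using root_dual dual_closed(1) by (auto simp: weights_def)

lemma weightI: "\<gamma> \<in> dual_space \<Longrightarrow> x \<in> root_space \<gamma> \<Longrightarrow> x \<noteq> 0 \<Longrightarrow> \<gamma> \<in> weights"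
  by (auto simp: weights_def roots_def)

lemma rootI: "\<gamma> \<in> dual_space \<Longrightarrow> x \<in> root_space \<gamma> \<Longrightarrow> x \<noteq> 0 \<Longrightarrow> \<gamma> \<noteq> 0 \<Longrightarrow> \<gamma> \<in> roots"
  by (auto simp: roots_def)

lemma root_space_eq_zero: "\<gamma> \<in> dual_space \<Longrightarrow> \<gamma> \<notin> weights \<Longrightarrow> x \<in> root_space \<gamma> \<Longrightarrow> x = 0"
  using weightI by blast

lemma root_spaces_independent:
  assumes "finite F" "F \<subseteq> dual_space" "\<And>\<gamma>. \<gamma> \<in> F \<Longrightarrow> w \<gamma> \<in> root_space \<gamma>" "(\<Sum>\<gamma>\<in>F. w \<gamma>) = 0" "\<gamma> \<in> F"
  shows "w \<gamma> = 0"
proof (rule weight_vectors_independent[of F \<tt>])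
  show "\<exists>h\<in>\<tt>. \<gamma> h \<noteq> \<delta> h" if "\<gamma> \<in> F" "\<delta> \<in> F" "\<gamma> \<noteq> \<delta>" for \<gamma> \<delta>
    using that assms(2) dual_eqI by blast
qed (use assms root_space_eigen in auto)

lemma root_spaces_disjoint:
  assumes "\<gamma> \<in> dual_space" "\<delta> \<in> dual_space" "\<gamma> \<noteq> \<delta>" "x \<in> root_space \<gamma>" "x \<in> root_space \<delta>"
  shows "x = 0"
proof (rule ccontr)
  assume "x \<noteq> 0"
  then have "\<gamma> h = \<delta> h" if "h \<in> \<tt>" for h
    using root_space_eigen[OF assms(4) that] root_space_eigen[OF assms(5) that] by simp
  then show False using assms dual_eqI by blast
qed

text \<open>One nonzero vector per root gives an independent family in a finite-dimensional space of
  matrices.\<close>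

lemma roots_finite: "finite roots"
proof -
  obtain e where e: "\<And>\<gamma>. \<gamma> \<in> roots \<Longrightarrow> e \<gamma> \<in> root_space \<gamma> \<and> e \<gamma> \<noteq> 0" using root_vector by metis
  have inj: "inj_on e roots"
    using e root_dual root_spaces_disjoint by (metis inj_onI)
  have "cmat.independent (e ` roots)"
    unfolding cmat.independent_explicit_finite_subsets
  proof (intro allI impI ballI)
    fix S u v assume S: "S \<subseteq> e ` roots" "finite S" "(\<Sum>v\<in>S. mscale (u v) v) = 0" "v \<in> S"
    obtain F where F: "F \<subseteq> roots" "S = e ` F" using S(1) by (meson subset_imageE)
    have injF: "inj_on e F" using inj F by (meson inj_on_subset)
    then have fin: "finite F" using S F finite_imageD by blast
    have "(\<Sum>\<gamma>\<in>F. mscale (u (e \<gamma>)) (e \<gamma>)) = 0"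
      using S(3) unfolding F(2) by (subst (asm) sum.reindex[OF injF]) simp
    then have "mscale (u (e \<gamma>)) (e \<gamma>) = 0" if "\<gamma> \<in> F" for \<gamma>
      using root_spaces_independent[OF fin, of "\<lambda>\<gamma>. mscale (u (e \<gamma>)) (e \<gamma>)"] e root_dual F that
        root_space_closed(3) by blast
    then show "u v = 0" using S(4) F e by (metis (no_types, lifting) cmat.scale_eq_0_iff imageE subsetD)
  qed
  then show ?thesis using cmat_independent_finite inj finite_imageD by blast
qed

lemma weights_finite: "finite weights"
  by (simp add: weights_def roots_finite)

text \<open>A finite spanning set S of \<tt> consists of commuting diagonalisable elements, so joint
  eigenvectors of S span. Such a vector is an eigenvector of all of \<tt>, and its eigenvalue is
  linear in h because the vector is nonzero.\<close>

lemma weight_root_vectors_span: "\<gg> = cmat.span (\<Union>\<gamma>\<in>weights. root_space \<gamma>)"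
proof
  show "cmat.span (\<Union>\<gamma>\<in>weights. root_space \<gamma>) \<subseteq> \<gg>"
    using root_space_in_\<gg> \<gg>_subspace by (intro cmat.span_minimal) auto
  obtain S where S: "S \<subseteq> \<tt>" "finite S" "cmat.span S = \<tt>"
    using subspace_basis[OF \<tt>_subspace] by metis
  have "\<gg> \<subseteq> cmat.span {x \<in> \<gg>. \<forall>s\<in>S. \<exists>c. \<lbrakk>s, x\<rbrakk> = mscale c x}"
    by (rule simultaneous_eigenvectors[OF \<gg>_subspace S(2)])
       (use S(1) \<tt>_abelian \<tt>_diag in blast)+
  moreover have "{x \<in> \<gg>. \<forall>s\<in>S. \<exists>c. \<lbrakk>s, x\<rbrakk> = mscale c x} \<subseteq> cmat.span (\<Union>\<gamma>\<in>weights. root_space \<gamma>)"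
  proof
    fix x assume x: "x \<in> {x \<in> \<gg>. \<forall>s\<in>S. \<exists>c. \<lbrakk>s, x\<rbrakk> = mscale c x}"
    show "x \<in> cmat.span (\<Union>\<gamma>\<in>weights. root_space \<gamma>)"
    proof (cases "x = 0")
      case True then show ?thesis by (simp add: cmat.span_zero)
    next
      case False
      have "\<exists>c. \<lbrakk>h, x\<rbrakk> = mscale c x" if "h \<in> \<tt>" for h
        using that unfolding S(3)[symmetric]
      proof (induction rule: cmat.span_induct_alt)
        case base show ?case by (intro exI[of _ 0]) simp
      next
        case (step c s h)
        then obtain a b where "\<lbrakk>s, x\<rbrakk> = mscale a x" "\<lbrakk>h, x\<rbrakk> = mscale b x" using x by blast
        then show ?case by (intro exI[of _ "c * a + b"])
          (simp add: lie_bracket_add_left lie_bracket_scale_left cmat.scale_left_distrib)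
      qed
      then obtain f where f: "\<And>h. h \<in> \<tt> \<Longrightarrow> \<lbrakk>h, x\<rbrakk> = mscale (f h) x" by metis
      \<comment> \<open>Cut off outside \<tt>, as membership in \<open>dual_space\<close>
        demands.\<close>
      define \<gamma> where "\<gamma> = (\<lambda>h. if h \<in> \<tt> then f h else 0)"
      have "f (a + b) = f a + f b" if "a \<in> \<tt>" "b \<in> \<tt>" for a b
        using f[of "a + b"] f[of a] f[of b] that \<tt>_closed False
        by (simp add: lie_bracket_add_left cmat.scale_left_distrib[symmetric])
      moreover have "f (mscale c a) = c * f a" if "a \<in> \<tt>" for a c
        using f[of "mscale c a"] f[of a] that \<tt>_closed False
        by (simp add: lie_bracket_scale_left)
      ultimately have "\<gamma> \<in> dual_space"
        using \<tt>_closed by (auto simp: dual_space_def \<gamma>_def)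
      moreover have "x \<in> root_space \<gamma>" using x f by (auto simp: root_space_def \<gamma>_def)
      ultimately show ?thesis using weightI False by (blast intro: cmat.span_base)
    qed
  qed
  ultimately show "\<gg> \<subseteq> cmat.span (\<Union>\<gamma>\<in>weights. root_space \<gamma>)"
    by (meson cmat.span_minimal cmat.subspace_span order_trans)
qed

text \<open>The components are indexed by all weights, with zeros outside F, so that decompositions
  obtained from different F can be compared by \<open>decomp_unique\<close>.\<close>

lemma span_root_spaces_decomp:
  assumes "F \<subseteq> weights" "x \<in> cmat.span (\<Union>\<gamma>\<in>F. root_space \<gamma>)"
  obtains w where "\<And>\<gamma>. w \<gamma> \<in> root_space \<gamma>" "\<And>\<gamma>. \<gamma> \<notin> F \<Longrightarrow> w \<gamma> = 0" "x = (\<Sum>\<gamma>\<in>weights. w \<gamma>)"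
proof -
  from span_Union_subspaces[OF root_space_subspace assms(2)] obtain E w where
    E: "finite E" "E \<subseteq> F" "\<And>i. i \<in> F \<Longrightarrow> w i \<in> root_space i" "\<And>i. i \<notin> E \<Longrightarrow> w i = 0" "x = (\<Sum>i\<in>E. w i)"
    by blast
  have "x = (\<Sum>\<gamma>\<in>weights. w \<gamma>)"
    unfolding E(5) using E assms weights_finite by (intro sum.mono_neutral_left) auto
  moreover have "w \<gamma> \<in> root_space \<gamma>" for \<gamma>
    using E root_space_closed(1) by (metis subsetD)
  ultimately show ?thesis using that[of w] E by blast
qed

lemma \<gg>_decomp:
  assumes "x \<in> \<gg>"
  obtains w where "\<And>\<gamma>. w \<gamma> \<in> root_space \<gamma>" "x = (\<Sum>\<gamma>\<in>weights. w \<gamma>)"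
  using span_root_spaces_decomp[of weights x] assms weight_root_vectors_span by auto

lemma decomp_unique:
  assumes "\<And>\<gamma>. w \<gamma> \<in> root_space \<gamma>" "\<And>\<gamma>. v \<gamma> \<in> root_space \<gamma>"
    and "(\<Sum>\<gamma>\<in>weights. w \<gamma>) = (\<Sum>\<gamma>\<in>weights. v \<gamma>)" "\<gamma> \<in> weights"
  shows "w \<gamma> = v \<gamma>"
proof -
  have "w \<gamma> - v \<gamma> = 0"
    by (rule root_spaces_independent[OF weights_finite])
       (use assms weight_dual root_space_closed(4) in \<open>auto simp: sum_subtractf\<close>)
  then show ?thesis by simp
qed

section \<open>Nondegeneracy of the Killing form\<close>

lemmas \<kappa>_add_left = killing_add_left[OF subalg]
lemmas \<kappa>_add_right = killing_add_right[OF subalg]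
lemmas \<kappa>_scale_left = killing_scale_left[OF subalg]
lemmas \<kappa>_scale_right = killing_scale_right[OF subalg]
lemmas \<kappa>_sym = killing_sym[OF subalg]
lemmas \<kappa>_invariant = killing_invariant[OF subalg]
lemmas \<kappa>_zero = killing_zero[OF subalg]

text \<open>For h with (\<gamma> + \<delta>)(h) nonzero, moving h across the form by invariance
  gives (\<gamma> + \<delta>)(h) \<kappa>(x, y) = 0.\<close>

lemma \<kappa>_root_spaces:
  assumes d: "\<gamma> \<in> dual_space" "\<delta> \<in> dual_space" "\<gamma> + \<delta> \<noteq> 0"
    and x: "x \<in> root_space \<gamma>" and y: "y \<in> root_space \<delta>"
  shows "\<kappa> x y = 0"
proof -
  obtain h where h: "h \<in> \<tt>" "\<gamma> h + \<delta> h \<noteq> 0"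
    using dual_eqI[of "\<gamma> + \<delta>" 0] d dual_closed(1,2) by auto
  note g = root_space_in_\<gg>[OF x] root_space_in_\<gg>[OF y] \<tt>_in_\<gg>[OF h(1)]
  have "\<gamma> h * \<kappa> x y = - \<kappa> \<lbrakk>x, h\<rbrakk> y"
    using root_space_eigen[OF x h(1)] g
    by (simp add: \<kappa>_scale_left killing_minus_left[OF subalg] \<gg>_bracket lie_bracket_antisym[of x h] \<gg>_closed)
  also have "\<dots> = - (\<delta> h * \<kappa> x y)"
    using \<kappa>_invariant[OF g(1,3,2)] root_space_eigen[OF y h(1)] g by (simp add: \<kappa>_scale_right)
  finally have "(\<gamma> h + \<delta> h) * \<kappa> x y = 0" by (simp add: algebra_simps add_eq_0_iff)
  then show ?thesis using h by simp
qed

text \<open>The last clause lets a vanishing of all \<open>wt b\<close> be transferred to the roots.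
  If it failed for \<gamma>, then B would lie in the other weight spaces, and a nonzero vector of
  weight \<gamma> would have two decompositions.\<close>

lemma weight_basis:
  obtains B wt where "finite B" "cmat.independent B" "cmat.span B = \<gg>"
    "\<And>b. b \<in> B \<Longrightarrow> wt b \<in> weights" "\<And>b. b \<in> B \<Longrightarrow> b \<in> root_space (wt b)"
    "\<And>\<gamma>. \<gamma> \<in> weights \<Longrightarrow> root_space \<gamma> \<noteq> {0} \<Longrightarrow> \<gamma> \<in> wt ` B"
proof -
  obtain B where B: "B \<subseteq> (\<Union>\<gamma>\<in>weights. root_space \<gamma>)" "finite B" "cmat.independent B" "cmat.span B = \<gg>"
    using cmat_basis_exists[OF weight_root_vectors_span] by metis
  then have "\<forall>b\<in>B. \<exists>\<gamma>\<in>weights. b \<in> root_space \<gamma>" by auto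
  then obtain wt where wt: "\<And>b. b \<in> B \<Longrightarrow> wt b \<in> weights" "\<And>b. b \<in> B \<Longrightarrow> b \<in> root_space (wt b)"
    by metis
  have "\<gamma> \<in> wt ` B" if \<gamma>: "\<gamma> \<in> weights" and ne: "root_space \<gamma> \<noteq> {0}" for \<gamma>
  proof (rule ccontr)
    assume no: "\<gamma> \<notin> wt ` B"
    obtain x where x: "x \<in> root_space \<gamma>" "x \<noteq> 0" using ne root_space_closed(1) by blast
    have "B \<subseteq> (\<Union>\<delta>\<in>weights - {\<gamma>}. root_space \<delta>)" using wt no by blast
    then have "x \<in> cmat.span (\<Union>\<delta>\<in>weights - {\<gamma>}. root_space \<delta>)"
      using cmat.span_mono B(4) root_space_in_\<gg>[OF x(1)] by blast
    from span_root_spaces_decomp[OF _ this] obtain w where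
      w: "\<And>\<delta>. w \<delta> \<in> root_space \<delta>" "\<And>\<delta>. \<delta> \<notin> weights - {\<gamma>} \<Longrightarrow> w \<delta> = 0" "x = (\<Sum>\<delta>\<in>weights. w \<delta>)"
      by auto
    have "(\<lambda>\<delta>. if \<delta> = \<gamma> then x else 0) \<gamma> = w \<gamma>"
      by (rule decomp_unique) (use x w \<gamma> weights_finite root_space_closed(1) in auto)
    then show False using w(2)[of \<gamma>] x by simp
  qed
  with B wt show ?thesis using that by blast
qed

text \<open>Elements of \<tt> act diagonally on a weight basis. Summing over basis vectors and not
  over roots accounts for the multiplicities, since root spaces are not yet known to be
  one-dimensional.\<close>

lemma \<kappa>_cartan:
  assumes "finite B" "cmat.independent B" "cmat.span B = \<gg>"
    "\<And>b. b \<in> B \<Longrightarrow> wt b \<in> weights" "\<And>b. b \<in> B \<Longrightarrow> b \<in> root_space (wt b)"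
    and h: "h \<in> \<tt>" "h' \<in> \<tt>"
  shows "\<kappa> h h' = (\<Sum>b\<in>B. wt b h * wt b h')"
proof -
  have "\<kappa> h h' = basis_trace B (\<lambda>z. \<lbrakk>h, \<lbrakk>h', z\<rbrakk>\<rbrakk>)"
    unfolding killing_def
    by (rule trace_on_eq[OF assms(2,3) mlinear_bracket2(1)]) (simp add: \<gg>_bracket \<tt>_in_\<gg> h)
  also have "\<dots> = (\<Sum>b\<in>B. wt b h * wt b h')"
    unfolding basis_trace_def
  proof (intro sum.cong refl)
    fix b assume b: "b \<in> B"
    have "\<lbrakk>h, \<lbrakk>h', b\<rbrakk>\<rbrakk> = mscale (wt b h * wt b h') b"
      using root_space_eigen[OF assms(5)[OF b] h(1)] root_space_eigen[OF assms(5)[OF b] h(2)]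
      by (simp add: lie_bracket_scale_right mult.commute)
    then show "cmat.representation B \<lbrakk>h, \<lbrakk>h', b\<rbrakk>\<rbrakk> b = wt b h * wt b h'"
      using assms(2) b by (simp add: cmat.representation_scale cmat.span_base cmat.representation_basis)
  qed
  finally show ?thesis .
qed

section \<open>Coefficients with respect to the base, and nonvanishing of the Killing form\<close>

lemma base_independent: "cfun.independent \<Psi>"
  and base_roots: "\<Psi> \<subseteq> roots"
  and roots_span_base: "\<gamma> \<in> roots \<Longrightarrow> \<gamma> \<in> cfun.span \<Psi>"
  and base_sign: "\<gamma> \<in> roots \<Longrightarrow> (\<forall>\<alpha>\<in>\<Psi>. root_coeff \<gamma> \<alpha> \<in> \<nat>) \<or> (\<forall>\<alpha>\<in>\<Psi>. - root_coeff \<gamma> \<alpha> \<in> \<nat>)"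
  using base by (auto simp: is_base_def)

lemma base_finite: "finite \<Psi>"
  using base_roots roots_finite finite_subset by blast

lemma weights_span_base: "\<gamma> \<in> weights \<Longrightarrow> \<gamma> \<in> cfun.span \<Psi>"
  using roots_span_base cfun.span_zero by (auto simp: weights_def)

lemma root_coeff_add: "\<gamma> \<in> cfun.span \<Psi> \<Longrightarrow> \<delta> \<in> cfun.span \<Psi> \<Longrightarrow> root_coeff (\<gamma> + \<delta>) \<alpha> = root_coeff \<gamma> \<alpha> + root_coeff \<delta> \<alpha>"
  and root_coeff_scale: "\<gamma> \<in> cfun.span \<Psi> \<Longrightarrow> root_coeff (fscale c \<gamma>) \<alpha> = c * root_coeff \<gamma> \<alpha>"
  and root_coeff_neg: "\<gamma> \<in> cfun.span \<Psi> \<Longrightarrow> root_coeff (- \<gamma>) \<alpha> = - root_coeff \<gamma> \<alpha>"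
  and root_coeff_diff: "\<gamma> \<in> cfun.span \<Psi> \<Longrightarrow> \<delta> \<in> cfun.span \<Psi> \<Longrightarrow> root_coeff (\<gamma> - \<delta>) \<alpha> = root_coeff \<gamma> \<alpha> - root_coeff \<delta> \<alpha>"
  and root_coeff_zero: "root_coeff 0 \<alpha> = 0"
  and root_coeff_simple: "\<delta> \<in> \<Psi> \<Longrightarrow> root_coeff \<delta> \<alpha> = (if \<alpha> = \<delta> then 1 else 0)"
  using base_independent
  by (simp_all add: root_coeff_def cfun.representation_add cfun.representation_scale cfun.representation_neg
      cfun.representation_diff cfun.representation_zero cfun.representation_basis)

lemma root_coeff_sum:
  "(\<And>i. i \<in> I \<Longrightarrow> f i \<in> cfun.span \<Psi>) \<Longrightarrow> root_coeff (\<Sum>i\<in>I. f i) \<alpha> = (\<Sum>i\<in>I. root_coeff (f i) \<alpha>)"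
  by (simp add: root_coeff_def cfun.representation_sum[OF base_independent])

lemma root_coeff_expand: "\<gamma> \<in> cfun.span \<Psi> \<Longrightarrow> \<gamma> = (\<Sum>\<alpha>\<in>\<Psi>. fscale (root_coeff \<gamma> \<alpha>) \<alpha>)"
  unfolding root_coeff_def using cfun.sum_representation_eq[OF base_independent _ base_finite] by simp

lemma root_coeff_eqI:
  "\<gamma> \<in> cfun.span \<Psi> \<Longrightarrow> \<delta> \<in> cfun.span \<Psi> \<Longrightarrow> (\<And>\<alpha>. \<alpha> \<in> \<Psi> \<Longrightarrow> root_coeff \<gamma> \<alpha> = root_coeff \<delta> \<alpha>) \<Longrightarrow> \<gamma> = \<delta>"
  using root_coeff_expand[of \<gamma>] root_coeff_expand[of \<delta>] by simp

lemma roots_nonempty: "roots \<noteq> {}"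
proof
  assume "roots = {}"
  then have "\<gg> = \<tt>"
    using weight_root_vectors_span \<tt>_subspace by (simp add: weights_def root_space_zero)
  then show False using nonabelian \<tt>_abelian by blast
qed

text \<open>Squares of complex numbers can cancel; integrality makes the values real, and the sum
  becomes one of nonnegative reals.\<close>

lemma sum_Ints_squares_zero:
  fixes f :: "'a \<Rightarrow> complex"
  assumes "finite A" "\<And>a. a \<in> A \<Longrightarrow> f a \<in> \<int>" "(\<Sum>a\<in>A. f a * f a) = 0" "a \<in> A"
  shows "f a = 0"
proof -
  have r: "f a = of_real (Re (f a))" if "a \<in> A" for a
    using assms(2)[OF that] by (auto elim!: Ints_cases)
  have "of_real (\<Sum>a\<in>A. (Re (f a))\<^sup>2) = (\<Sum>a\<in>A. f a * f a)"
    unfolding of_real_sum by (intro sum.cong refl) (subst (2 3) r, auto simp: power2_eq_square)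
  also have "\<dots> = of_real 0" using assms(3) by simp
  finally have "(\<Sum>a\<in>A. (Re (f a))\<^sup>2) = 0" unfolding of_real_eq_iff .
  then show ?thesis using assms(1,4) r[OF assms(4)]
    by (subst (asm) sum_nonneg_eq_0_iff) auto
qed

text \<open>If \<open>\<kappa>\<close> vanished on \<open>\<tt>\<close>, then \<open>\<Sum>\<^sub>b wt\<^sub>b(h) wt\<^sub>b(h') = 0\<close> identically; reading off the coefficient
  of a simple root in both factors gives a vanishing sum of squares of integers.\<close>
lemma \<kappa>_nonzero: "\<exists>h\<in>\<tt>. \<exists>h'\<in>\<tt>. \<kappa> h h' \<noteq> 0"
proof (rule ccontr)
  assume "\<not> ?thesis"
  then have z: "\<kappa> h h' = 0" if "h \<in> \<tt>" "h' \<in> \<tt>" for h h' using that by blast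
  obtain B wt where B: "finite B" "cmat.independent B" "cmat.span B = \<gg>"
    "\<And>b. b \<in> B \<Longrightarrow> wt b \<in> weights" "\<And>b. b \<in> B \<Longrightarrow> b \<in> root_space (wt b)"
    "\<And>\<gamma>. \<gamma> \<in> weights \<Longrightarrow> root_space \<gamma> \<noteq> {0} \<Longrightarrow> \<gamma> \<in> wt ` B"
    using weight_basis by metis
  note sp = weights_span_base[OF B(4)]
  have eval: "(\<Sum>b\<in>B. fscale (c b) (wt b)) = 0" if "\<And>h. h \<in> \<tt> \<Longrightarrow> (\<Sum>b\<in>B. c b * wt b h) = 0" for c
  proof (rule dual_eqI)
    show "(\<Sum>b\<in>B. fscale (c b) (wt b)) \<in> dual_space"
      using B(4) weight_dual by (intro dual_closed) auto
    have *: "(\<Sum>b\<in>B. fscale (c b) (wt b)) h = (\<Sum>b\<in>B. c b * wt b h)" for h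
      using B(1) by (induction B rule: finite_induct) (auto simp: fscale_def)
    show "(\<Sum>b\<in>B. fscale (c b) (wt b)) h = 0 h" if "h \<in> \<tt>" for h
      using \<open>\<And>h. h \<in> \<tt> \<Longrightarrow> _ = 0\<close>[OF that] by (simp add: *)
  qed (rule dual_closed)
  have coeff: "(\<Sum>b\<in>B. c b * root_coeff (wt b) \<alpha>) = 0"
    if "\<And>h. h \<in> \<tt> \<Longrightarrow> (\<Sum>b\<in>B. c b * wt b h) = 0" for c \<alpha>
    using arg_cong[OF eval[OF that], of "\<lambda>f. root_coeff f \<alpha>"] sp
    by (simp add: root_coeff_sum root_coeff_scale cfun.span_scale root_coeff_zero)
  have 1: "(\<Sum>b\<in>B. wt b h * root_coeff (wt b) \<alpha>) = 0" if "h \<in> \<tt>" for h \<alpha>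
    using coeff[of "\<lambda>b. wt b h"] \<kappa>_cartan[OF B(1-5) that] z[OF that] by simp
  \<comment> \<open>For fixed \<alpha>, \<open>1\<close> says that the coefficients of \<alpha> in
    the \<open>wt b\<close> satisfy the hypothesis of \<open>coeff\<close>, which then extracts the
    same coefficient from the other factor.\<close>
  have 2: "(\<Sum>b\<in>B. root_coeff (wt b) \<alpha> * root_coeff (wt b) \<alpha>) = 0" for \<alpha>
    using coeff[of "\<lambda>b. root_coeff (wt b) \<alpha>"] 1 by (simp add: mult.commute)
  have int: "root_coeff (wt b) \<alpha> \<in> \<int>" if "b \<in> B" "\<alpha> \<in> \<Psi>" for b \<alpha>
    using B(4)[OF that(1)] base_sign[of "wt b"] that(2) root_coeff_zero
    by (auto simp: weights_def) (metis Ints_minus Nats_subset_Ints add.inverse_inverse subsetD)+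
  have "wt b = 0" if b: "b \<in> B" for b
  proof (rule root_coeff_eqI)
    show "root_coeff (wt b) \<alpha> = root_coeff 0 \<alpha>" if "\<alpha> \<in> \<Psi>" for \<alpha>
      using sum_Ints_squares_zero[OF B(1) int 2 b] that by (simp add: root_coeff_zero)
  qed (use sp b cfun.span_zero in auto)
  moreover obtain \<gamma> where "\<gamma> \<in> roots" using roots_nonempty by blast
  moreover from this have "\<gamma> \<in> wt ` B" using B(6) by (auto simp: weights_def roots_def)
  ultimately show False using root_nonzero by auto
qed

text \<open>The radical is an ideal by invariance, and \<open>\<kappa>_nonzero\<close> keeps it from
  being everything; simplicity leaves {0}.\<close>

lemma \<kappa>_nondegenerate:
  assumes "x \<in> \<gg>" "\<And>y. y \<in> \<gg> \<Longrightarrow> \<kappa> x y = 0"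
  shows "x = 0"
proof -
  let ?R = "{x \<in> \<gg>. \<forall>y\<in>\<gg>. \<kappa> x y = 0}"
  have "lie_ideal \<gg> ?R"
    unfolding lie_ideal_def
  proof (intro conjI ballI)
    show "cmat.subspace ?R"
      by (auto simp: cmat.subspace_def \<gg>_closed \<kappa>_add_left \<kappa>_scale_left \<kappa>_zero)
    show "\<lbrakk>x, y\<rbrakk> \<in> ?R" if x: "x \<in> \<gg>" and y: "y \<in> ?R" for x y
    proof -
      have "\<kappa> \<lbrakk>x, y\<rbrakk> z = 0" if z: "z \<in> \<gg>" for z
      proof -
        have "\<kappa> \<lbrakk>x, y\<rbrakk> z = - \<kappa> \<lbrakk>y, x\<rbrakk> z"
          using x y z by (simp add: lie_bracket_antisym[of x y] killing_minus_left[OF subalg] \<gg>_bracket)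
        also have "\<dots> = 0" using x y z \<kappa>_invariant[of y x z] by (simp add: \<gg>_bracket)
        finally show ?thesis .
      qed
      then show ?thesis using x y \<gg>_bracket by auto
    qed
  qed auto
  moreover have "?R \<noteq> \<gg>"
    using \<kappa>_nonzero \<tt>_in_\<gg> by blast
  ultimately have "?R = {0}" using ideal_cases by blast
  then show ?thesis using assms by blast
qed

text \<open>The root spaces are orthogonal to \<tt>, so an element of \<tt> orthogonal to \<tt> is
  orthogonal to the whole algebra.\<close>

lemma \<kappa>_nondegenerate_cartan:
  assumes h: "h \<in> \<tt>" "\<And>h'. h' \<in> \<tt> \<Longrightarrow> \<kappa> h h' = 0"
  shows "h = 0"
proof (rule \<kappa>_nondegenerate)
  show "\<kappa> h y = 0" if y: "y \<in> \<gg>" for y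
  proof -
    have "y \<in> cmat.span (\<Union>\<gamma>\<in>weights. root_space \<gamma>)" using y weight_root_vectors_span by simp
    then have "y \<in> \<gg> \<and> \<kappa> h y = 0"
    proof (induction rule: cmat.span_induct_alt)
      case base show ?case using \<gg>_closed \<kappa>_zero \<tt>_in_\<gg>[OF h(1)] by simp
    next
      case (step c x y)
      then obtain \<gamma> where \<gamma>: "\<gamma> \<in> weights" "x \<in> root_space \<gamma>" by auto
      have "\<kappa> h x = 0"
      proof (cases "\<gamma> = 0")
        case True then show ?thesis using h \<gamma> root_space_zero by simp
      next
        case False then show ?thesis
          using \<kappa>_root_spaces[of 0 \<gamma> h x] h \<gamma> root_space_zero dual_closed(1) weight_dual by simp
      qed
      then show ?case using step root_space_in_\<gg>[OF \<gamma>(2)] \<gg>_closed \<tt>_in_\<gg>[OF h(1)]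
        by (simp add: \<kappa>_add_right \<kappa>_scale_right)
    qed
    then show ?thesis by simp
  qed
qed (use h \<tt>_in_\<gg> in auto)

text \<open>Nondegeneracy supplies a partner for x in some weight space, and orthogonality of weight
  spaces with nonzero sum forces its weight to be -\<gamma>.\<close>

lemma root_space_pairing:
  assumes "\<gamma> \<in> weights" "x \<in> root_space \<gamma>" "x \<noteq> 0"
  obtains y where "y \<in> root_space (- \<gamma>)" "\<kappa> x y \<noteq> 0"
proof -
  note x = root_space_in_\<gg>[OF assms(2)]
  obtain y where y: "y \<in> \<gg>" "\<kappa> x y \<noteq> 0" using \<kappa>_nondegenerate x assms(3) by blast
  have "\<exists>\<delta>\<in>weights. \<exists>y\<in>root_space \<delta>. \<kappa> x y \<noteq> 0"
  proof (rule ccontr)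
    assume no: "\<not> ?thesis"
    have "y \<in> cmat.span (\<Union>\<gamma>\<in>weights. root_space \<gamma>)" using y(1) weight_root_vectors_span by simp
    then have "y \<in> \<gg> \<and> \<kappa> x y = 0"
    proof (induction rule: cmat.span_induct_alt)
      case base show ?case using \<gg>_closed \<kappa>_zero x by simp
    next
      case (step c y z)
      then have "\<kappa> x y = 0" "y \<in> \<gg>" using no root_space_in_\<gg> by auto
      then show ?case using step \<gg>_closed x by (simp add: \<kappa>_add_right \<kappa>_scale_right)
    qed
    then show False using y by simp
  qed
  then obtain \<delta> y where d: "\<delta> \<in> weights" "y \<in> root_space \<delta>" "\<kappa> x y \<noteq> 0" by blast
  then have "\<gamma> + \<delta> = 0" using \<kappa>_root_spaces assms weight_dual by blast
  then have "\<delta> = - \<gamma>" by (simp add: eq_neg_iff_add_eq_0 add.commute)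
  then show ?thesis using that d by auto
qed

lemma root_neg: "\<gamma> \<in> roots \<Longrightarrow> - \<gamma> \<in> roots"
proof -
  assume g: "\<gamma> \<in> roots"
  obtain x where x: "x \<in> root_space \<gamma>" "x \<noteq> 0" using root_vector[OF g] by blast
  obtain y where y: "y \<in> root_space (- \<gamma>)" "\<kappa> x y \<noteq> 0"
    using root_space_pairing[OF _ x] g by (auto simp: weights_def)
  have "y \<noteq> 0" using y(2) \<kappa>_zero root_space_in_\<gg>[OF x(1)] by auto
  then show ?thesis using rootI[OF _ y(1)] dual_closed(5)[OF root_dual[OF g]] root_nonzero[OF g] by auto
qed

text \<open>\<open>dual_vector \<nu>\<close> is an arbitrary value unless \<open>\<nu>\<close> is represented by an element of \<open>\<tt>\<close>.\<close>
definition represented :: "'n functional \<Rightarrow> bool" where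
  "represented \<nu> \<longleftrightarrow> \<nu> \<in> dual_space \<and> dual_vector \<nu> \<in> \<tt> \<and> (\<forall>h\<in>\<tt>. \<kappa> (dual_vector \<nu>) h = \<nu> h)"

lemma dual_vector_eqI:
  assumes h: "h \<in> \<tt>" "\<And>h'. h' \<in> \<tt> \<Longrightarrow> \<kappa> h h' = \<nu> h'"
  shows "dual_vector \<nu> = h"
  unfolding dual_vector_def
proof (rule the_equality)
  fix k assume k: "k \<in> \<tt> \<and> (\<forall>h'\<in>\<tt>. \<kappa> k h' = \<nu> h')"
  have "k + mscale (-1) h = 0"
  proof (rule \<kappa>_nondegenerate_cartan)
    show "\<kappa> (k + mscale (-1) h) h' = 0" if "h' \<in> \<tt>" for h'
      using k h that by (subst \<kappa>_add_left, simp_all add: killing_minus_left[OF subalg] \<tt>_in_\<gg> \<gg>_closed)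
  qed (use k h \<tt>_closed in auto)
  then show "k = h" by (simp add: add_eq_0_iff)
qed (use assms in auto)

lemma representedI:
  assumes "\<nu> \<in> dual_space" "h \<in> \<tt>" "\<And>h'. h' \<in> \<tt> \<Longrightarrow> \<kappa> h h' = \<nu> h'"
  shows "represented \<nu>"
  using dual_vector_eqI[OF assms(2,3)] assms by (simp add: represented_def)

lemma bracket_opposite:
  assumes a: "\<alpha> \<in> roots" and x: "x \<in> root_space \<alpha>" and y: "y \<in> root_space (- \<alpha>)"
  shows "\<lbrakk>x, y\<rbrakk> \<in> \<tt>" "h \<in> \<tt> \<Longrightarrow> \<kappa> \<lbrakk>x, y\<rbrakk> h = \<kappa> x y * \<alpha> h"
proof -
  show "\<lbrakk>x, y\<rbrakk> \<in> \<tt>" using root_space_bracket[OF x y] by (simp add: root_space_zero)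
  assume h: "h \<in> \<tt>"
  have "\<kappa> \<lbrakk>x, y\<rbrakk> h = \<kappa> x \<lbrakk>y, h\<rbrakk>"
    using \<kappa>_invariant root_space_in_\<gg> x y \<tt>_in_\<gg> h by blast
  also have "\<lbrakk>y, h\<rbrakk> = mscale (\<alpha> h) y"
    using root_space_eigen[OF y h] lie_bracket_antisym[of y h] by simp
  finally show "\<kappa> \<lbrakk>x, y\<rbrakk> h = \<kappa> x y * \<alpha> h"
    using root_space_in_\<gg>[OF x] root_space_in_\<gg>[OF y] by (simp add: \<kappa>_scale_right)
qed

text \<open>The representing element is explicit: by invariance [x, y] represents \<kappa>(x, y)
  times \<alpha>, so it only has to be normalised.\<close>

lemma root_represented:
  assumes a: "\<alpha> \<in> roots" shows "represented \<alpha>"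
proof -
  obtain x where x: "x \<in> root_space \<alpha>" "x \<noteq> 0" using root_vector[OF a] by blast
  obtain y where y: "y \<in> root_space (- \<alpha>)" "\<kappa> x y \<noteq> 0"
    using root_space_pairing[OF _ x] a by (auto simp: weights_def)
  show ?thesis
  proof (rule representedI)
    show "mscale (1 / \<kappa> x y) \<lbrakk>x, y\<rbrakk> \<in> \<tt>" using bracket_opposite[OF a x(1) y(1)] \<tt>_closed by simp
    show "\<kappa> (mscale (1 / \<kappa> x y) \<lbrakk>x, y\<rbrakk>) h = \<alpha> h" if "h \<in> \<tt>" for h
      using bracket_opposite[OF a x(1) y(1)] that y \<tt>_in_\<gg> by (simp add: \<kappa>_scale_left)
  qed (rule root_dual[OF a])
qed

lemma bracket_eq_dual_vector:
  assumes a: "\<alpha> \<in> roots" and x: "x \<in> root_space \<alpha>" and y: "y \<in> root_space (- \<alpha>)"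
  shows "\<lbrakk>x, y\<rbrakk> = mscale (\<kappa> x y) (dual_vector \<alpha>)"
proof -
  let ?t = "dual_vector \<alpha>"
  note r = root_represented[OF a, unfolded represented_def]
  have "\<lbrakk>x, y\<rbrakk> + mscale (- \<kappa> x y) ?t = 0"
  proof (rule \<kappa>_nondegenerate_cartan)
    show "\<kappa> (\<lbrakk>x, y\<rbrakk> + mscale (- \<kappa> x y) ?t) h' = 0" if "h' \<in> \<tt>" for h'
      using r bracket_opposite[OF a x y] that
      by (subst \<kappa>_add_left) (simp_all add: \<kappa>_scale_left[of "dual_vector \<alpha>" h' "- \<kappa> x y", simplified] \<kappa>_scale_left \<tt>_in_\<gg> \<gg>_closed)
  qed (use r bracket_opposite[OF a x y] \<tt>_closed in auto)
  then show ?thesis by (simp add: add_eq_0_iff)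
qed

lemma represented_zero: "represented 0"
  by (rule representedI[of _ 0]) (use dual_closed \<tt>_closed \<kappa>_zero \<tt>_in_\<gg> in auto)

lemma represented_add:
  assumes "represented \<nu>" "represented \<mu>"
  shows "represented (\<nu> + \<mu>)" "dual_vector (\<nu> + \<mu>) = dual_vector \<nu> + dual_vector \<mu>"
proof -
  have *: "\<nu> + \<mu> \<in> dual_space" "dual_vector \<nu> + dual_vector \<mu> \<in> \<tt>"
    "\<And>h'. h' \<in> \<tt> \<Longrightarrow> \<kappa> (dual_vector \<nu> + dual_vector \<mu>) h' = (\<nu> + \<mu>) h'"
    using assms dual_closed \<tt>_closed \<tt>_in_\<gg> by (auto simp: represented_def \<kappa>_add_left)
  show "represented (\<nu> + \<mu>)" by (rule representedI[OF *])
  show "dual_vector (\<nu> + \<mu>) = dual_vector \<nu> + dual_vector \<mu>" by (rule dual_vector_eqI[OF *(2,3)])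
qed

lemma represented_scale:
  assumes "represented \<nu>"
  shows "represented (fscale c \<nu>)" "dual_vector (fscale c \<nu>) = mscale c (dual_vector \<nu>)"
proof -
  have *: "fscale c \<nu> \<in> dual_space" "mscale c (dual_vector \<nu>) \<in> \<tt>"
    "\<And>h'. h' \<in> \<tt> \<Longrightarrow> \<kappa> (mscale c (dual_vector \<nu>)) h' = (fscale c \<nu>) h'"
    using assms dual_closed \<tt>_closed \<tt>_in_\<gg> by (auto simp: represented_def \<kappa>_scale_left fscale_def)
  show "represented (fscale c \<nu>)" by (rule representedI[OF *])
  show "dual_vector (fscale c \<nu>) = mscale c (dual_vector \<nu>)" by (rule dual_vector_eqI[OF *(2,3)])
qed

lemma root_inner_eval: "represented \<nu> \<Longrightarrow> represented \<mu> \<Longrightarrow> root_inner \<nu> \<mu> = \<nu> (dual_vector \<mu>)"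
  by (simp add: root_inner_def represented_def)

lemma root_inner_sym: "represented \<nu> \<Longrightarrow> represented \<mu> \<Longrightarrow> root_inner \<nu> \<mu> = root_inner \<mu> \<nu>"
  by (simp add: root_inner_def represented_def \<kappa>_sym \<tt>_in_\<gg>)

lemma root_inner_add_left:
  "represented \<nu> \<Longrightarrow> represented \<nu>' \<Longrightarrow> represented \<mu> \<Longrightarrow> root_inner (\<nu> + \<nu>') \<mu> = root_inner \<nu> \<mu> + root_inner \<nu>' \<mu>"
  by (simp add: root_inner_eval represented_add)

lemma root_inner_scale_left:
  "represented \<nu> \<Longrightarrow> represented \<mu> \<Longrightarrow> root_inner (fscale c \<nu>) \<mu> = c * root_inner \<nu> \<mu>"
  by (simp add: root_inner_eval represented_scale) (simp add: fscale_def)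

text \<open>If \<open>\<alpha>(t) = 0\<close> for \<open>t = [x, y]\<close>, then \<open>t\<close> acts on \<open>V = \<Oplus>\<^sub>k \<gg>\<^bsub>\<beta>+k\<alpha>\<^esub>\<close> as the scalar \<open>\<beta>(t)\<close> and, being a
  commutator, has trace \<open>0\<close> on \<open>V\<close>. So every root \<open>\<beta>\<close> vanishes at \<open>t\<close>.\<close>
lemma root_self_inner_nonzero:
  assumes a: "\<alpha> \<in> roots" shows "root_inner \<alpha> \<alpha> \<noteq> 0"
proof
  assume "root_inner \<alpha> \<alpha> = 0"
  define t where "t = dual_vector \<alpha>"
  have t: "t \<in> \<tt>" "\<And>h. h \<in> \<tt> \<Longrightarrow> \<kappa> t h = \<alpha> h"
    using root_represented[OF a] by (auto simp: represented_def t_def)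
  have at: "\<alpha> t = 0"
    using \<open>root_inner \<alpha> \<alpha> = 0\<close> root_inner_eval root_represented[OF a] by (simp add: t_def)
  obtain x where x: "x \<in> root_space \<alpha>" "x \<noteq> 0" using root_vector[OF a] by blast
  obtain y' where y': "y' \<in> root_space (- \<alpha>)" "\<kappa> x y' \<noteq> 0"
    using root_space_pairing[OF _ x] a by (auto simp: weights_def)
  define y where "y = mscale (1 / \<kappa> x y') y'"
  have y: "y \<in> root_space (- \<alpha>)" using y' root_space_closed by (simp add: y_def)
  have xy: "\<lbrakk>x, y\<rbrakk> = t"
    using bracket_eq_dual_vector[OF a x(1) y'(1)] y' by (simp add: y_def t_def lie_bracket_scale_right)
  have bt: "\<beta> t = 0" if b: "\<beta> \<in> roots" for \<beta>
  proof -
    \<comment> \<open>All integers k are allowed: functionals that are not weights contribute {0},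
      and V is stable under x, y and t without knowing where the string ends.\<close>
    let ?W = "\<lambda>k::int. root_space (\<beta> + fscale (of_int k) \<alpha>)"
    let ?V = "cmat.span (\<Union>k\<in>UNIV. ?W k)"
    have shift: "\<lbrakk>u, v\<rbrakk> \<in> ?V" if "u \<in> root_space (fscale (of_int j) \<alpha>)" "v \<in> ?V" for u v j
    proof (rule bracket_in_span[of u "{u}" v "\<Union>k\<in>UNIV. ?W k"])
      fix a c assume *: "a \<in> {u}" "c \<in> (\<Union>k\<in>UNIV. ?W k)"
      then obtain k where k: "c \<in> ?W k" by auto
      have "fscale (of_int j) \<alpha> + (\<beta> + fscale (of_int k) \<alpha>) = \<beta> + fscale (of_int (j + k)) \<alpha>"
        by (auto simp: fun_eq_iff fscale_def algebra_simps)
      then have "\<lbrakk>a, c\<rbrakk> \<in> ?W (j + k)" using root_space_bracket[OF that(1) k] *(1) by (metis singletonD)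
      then show "\<lbrakk>a, c\<rbrakk> \<in> ?V" by (intro cmat.span_base) blast
    qed (use that in \<open>auto simp: cmat.span_base\<close>)
    have fx: "fscale (of_int 1) \<alpha> = \<alpha>" "fscale (of_int (-1)) \<alpha> = - \<alpha>" "fscale (of_int 0) \<alpha> = 0"
      by (auto simp: fun_eq_iff fscale_def)
    have sx: "\<lbrakk>x, v\<rbrakk> \<in> ?V" and sy: "\<lbrakk>y, v\<rbrakk> \<in> ?V" and stt: "\<lbrakk>t, v\<rbrakk> \<in> ?V" if "v \<in> ?V" for v
      using shift[of x 1 v] shift[of y "-1" v] shift[of t 0 v] x y t that fx by (simp_all add: root_space_zero)
    have scal: "\<lbrakk>t, v\<rbrakk> = mscale (\<beta> t) v" if "v \<in> ?V" for v
      using that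
    proof (induction rule: cmat.span_induct_alt)
      case base show ?case by simp
    next
      case (step c u v)
      then obtain k where k: "u \<in> ?W k" by auto
      have "\<lbrakk>t, u\<rbrakk> = mscale (\<beta> t) u"
        using root_space_eigen[OF k t(1)] at by (simp add: fscale_def)
      with step show ?case
        by (simp add: lie_bracket_add_right lie_bracket_scale_right cmat.scale_right_distrib mult.commute)
    qed
    have "trace_on ?V (lie_bracket t) = trace_on ?V (\<lambda>v. \<lbrakk>x, \<lbrakk>y, v\<rbrakk>\<rbrakk> + mscale (-1) \<lbrakk>y, \<lbrakk>x, v\<rbrakk>\<rbrakk>)"
      by (rule arg_cong[of _ _ "trace_on ?V"]) (use xy jacobi[of x y] in \<open>simp add: fun_eq_iff\<close>)
    also have "\<dots> = trace_on ?V (\<lambda>v. \<lbrakk>x, \<lbrakk>y, v\<rbrakk>\<rbrakk>) + trace_on ?V (\<lambda>v. mscale (-1) \<lbrakk>y, \<lbrakk>x, v\<rbrakk>\<rbrakk>)"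
      by (rule trace_on_add)
         (auto intro!: mlinear_bracket2 sx sy cmat.span_neg mlinearI
           simp: lie_bracket_add_right lie_bracket_scale_right cmat.scale_right_diff_distrib mult.commute)
    also have "trace_on ?V (\<lambda>v. mscale (-1) \<lbrakk>y, \<lbrakk>x, v\<rbrakk>\<rbrakk>) = -1 * trace_on ?V (\<lambda>v. \<lbrakk>y, \<lbrakk>x, v\<rbrakk>\<rbrakk>)"
      by (rule trace_on_scale) (auto intro!: mlinear_bracket2 sx sy)
    also have "trace_on ?V (\<lambda>v. \<lbrakk>y, \<lbrakk>x, v\<rbrakk>\<rbrakk>) = trace_on ?V (\<lambda>v. \<lbrakk>x, \<lbrakk>y, v\<rbrakk>\<rbrakk>)"
      by (rule trace_on_commute) (auto intro!: mlinear_bracket sx sy)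
    finally have tr: "trace_on ?V (lie_bracket t) = 0"
      by (simp only: mult_minus_left mult_1 add.right_inverse)
    obtain b where b: "b \<in> root_space \<beta>" "b \<noteq> 0" using root_vector[OF b] by blast
    have "b \<in> ?V" using b fx(3) by (intro cmat.span_base UN_I[of 0]) auto
    then show ?thesis
      using trace_on_scalar[OF _ mlinear_bracket(1) scal tr] b by auto
  qed
  obtain B wt where B: "finite B" "cmat.independent B" "cmat.span B = \<gg>"
    "\<And>b. b \<in> B \<Longrightarrow> wt b \<in> weights" "\<And>b. b \<in> B \<Longrightarrow> b \<in> root_space (wt b)"
    using weight_basis by metis
  \<comment> \<open>As all weights vanish at t, the trace formula makes t orthogonal to \<tt>. But t
    represents \<alpha>, so \<alpha> would be zero.\<close>
  have "wt b t = 0" if "b \<in> B" for b using B(4)[OF that] bt by (auto simp: weights_def)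
  then have "\<kappa> t h = 0" if "h \<in> \<tt>" for h
    using \<kappa>_cartan[OF B t(1) that] by simp
  then have "\<alpha> = 0"
    using t(2) root_dual[OF a] dual_closed(1) by (intro dual_eqI) auto
  then show False using root_nonzero[OF a] by simp
qed

section \<open>Root strings\<close>

definition coroot :: "'n functional \<Rightarrow> 'n cmat" where
  "coroot \<alpha> = mscale (2 / root_inner \<alpha> \<alpha>) (dual_vector \<alpha>)"

lemma coroot_in: "\<alpha> \<in> roots \<Longrightarrow> coroot \<alpha> \<in> \<tt>"
  using root_represented \<tt>_closed by (simp add: coroot_def represented_def)

lemma eval_coroot:
  assumes "\<alpha> \<in> roots" "represented \<beta>"
  shows "\<beta> (coroot \<alpha>) = 2 * root_inner \<beta> \<alpha> / root_inner \<alpha> \<alpha>"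
  using assms root_represented[OF assms(1)] root_inner_eval[OF assms(2) root_represented[OF assms(1)]]
  by (simp add: coroot_def represented_def dual_scale)

lemma root_coroot_self: "\<alpha> \<in> roots \<Longrightarrow> \<alpha> (coroot \<alpha>) = 2"
  using eval_coroot[of \<alpha> \<alpha>] root_represented[of \<alpha>] root_self_inner_nonzero[of \<alpha>] by simp

lemma fscale_minus_one: "fscale (-1) f = - f"
  by (simp add: fscale_def fun_eq_iff)

lemma represented_neg:
  assumes "represented \<nu>" shows "represented (- \<nu>)" "dual_vector (- \<nu>) = - dual_vector \<nu>"
  using represented_scale[OF assms, of "-1"] by (simp_all add: fscale_minus_one)

lemma coroot_neg:
  assumes "\<alpha> \<in> roots" shows "coroot (- \<alpha>) = - coroot \<alpha>"
proof -
  note r = root_represented[OF assms]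
  have "root_inner (- \<alpha>) (- \<alpha>) = root_inner \<alpha> \<alpha>"
    using root_inner_scale_left[OF r represented_neg(1)[OF r], of "-1"]
      root_inner_scale_left[OF r r, of "-1"] root_inner_sym[OF r represented_neg(1)[OF r]]
    by (simp add: fscale_minus_one)
  then show ?thesis using represented_neg(2)[OF r] by (simp add: coroot_def)
qed

text \<open>The remaining sl2 relations need no statement of their own: x and y are root vectors,
  and \<alpha> takes the value 2 at \<open>coroot \<alpha>\<close>.\<close>

lemma sl2_triple:
  assumes a: "\<alpha> \<in> roots" and x: "x \<in> root_space \<alpha>" "x \<noteq> 0"
  obtains y where "y \<in> root_space (- \<alpha>)" "\<lbrakk>x, y\<rbrakk> = coroot \<alpha>"
proof -
  obtain y where y: "y \<in> root_space (- \<alpha>)" "\<kappa> x y \<noteq> 0"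
    using root_space_pairing[OF _ x] a by (auto simp: weights_def)
  show ?thesis
  proof (rule that)
    show "\<lbrakk>x, mscale (2 / root_inner \<alpha> \<alpha> / \<kappa> x y) y\<rbrakk> = coroot \<alpha>"
      using y by (simp add: lie_bracket_scale_right bracket_eq_dual_vector[OF a x(1) y(1)] coroot_def)
  qed (use y root_space_closed in auto)
qed

lemma chain_in:
  assumes x: "x \<in> root_space \<alpha>" and z: "z \<in> root_space \<beta>"
  shows "(lie_bracket x ^^ i) z \<in> root_space (\<beta> + fscale (of_nat i) \<alpha>)"
proof (induction i)
  case 0
  have "\<beta> + fscale 0 \<alpha> = \<beta>" by (simp add: fun_eq_iff fscale_def)
  then show ?case using z by simp
next
  case (Suc i)
  have "\<alpha> + (\<beta> + fscale (of_nat i) \<alpha>) = \<beta> + fscale (of_nat (Suc i)) \<alpha>"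
    by (auto simp: fun_eq_iff fscale_def algebra_simps)
  then show ?case using root_space_bracket[OF x Suc] by (simp only: funpow.simps o_apply)
qed

text \<open>The weights \<beta> + i \<alpha> are pairwise distinct, as their values at the coroot
  show, and there are only finitely many weights. The number n is the last index before the first
  zero.\<close>

lemma chain_stops:
  assumes a: "\<alpha> \<in> roots" and x: "x \<in> root_space \<alpha>" and b: "\<beta> \<in> dual_space" and z: "z \<in> root_space \<beta>" "z \<noteq> 0"
  obtains n where "\<forall>i\<le>n. (lie_bracket x ^^ i) z \<noteq> 0" "\<lbrakk>x, (lie_bracket x ^^ n) z\<rbrakk> = 0"
proof -
  let ?X = "\<lambda>i. (lie_bracket x ^^ i) z"
  have "inj (\<lambda>i::nat. \<beta> + fscale (of_nat i) \<alpha>)"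
  proof (rule injI)
    fix i j :: nat assume "\<beta> + fscale (of_nat i) \<alpha> = \<beta> + fscale (of_nat j) \<alpha>"
    then have "fscale (of_nat i) \<alpha> (coroot \<alpha>) = fscale (of_nat j) \<alpha> (coroot \<alpha>)"
      by (simp add: fun_eq_iff)
    then show "i = j" using root_coroot_self[OF a] by (simp add: fscale_def)
  qed
  then have "\<not> range (\<lambda>i::nat. \<beta> + fscale (of_nat i) \<alpha>) \<subseteq> weights"
    using weights_finite range_inj_infinite finite_subset by blast
  then obtain i where "\<beta> + fscale (of_nat i) \<alpha> \<notin> weights" by auto
  then have ex: "\<exists>i. ?X i = 0"
    using weightI[OF dual_closed(2)[OF b dual_closed(3)[OF root_dual[OF a]]] chain_in[OF x z(1), of i]] by metis
  define m where "m = (LEAST i. ?X i = 0)"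
  have m: "?X m = 0" unfolding m_def using ex by (rule LeastI_ex)
  then obtain n where n: "m = Suc n" using z by (cases m) auto
  show ?thesis
  proof (rule that)
    show "\<forall>i\<le>n. ?X i \<noteq> 0"
      using not_less_Least[of _ "\<lambda>i. ?X i = 0"] n unfolding m_def[symmetric] by (metis le_imp_less_Suc)
    show "\<lbrakk>x, ?X n\<rbrakk> = 0" using m n by simp
  qed
qed

text \<open>Moving y past the j-th factor x costs -(\<beta>(h) + 2 j), h the coroot. Summing over j
  = 0, ..., i gives the constant -(i + 1)(\<beta>(h) + i).\<close>

lemma chain_lower:
  assumes a: "\<alpha> \<in> roots" and x: "x \<in> root_space \<alpha>" and xy: "\<lbrakk>x, y\<rbrakk> = coroot \<alpha>"
    and b: "\<beta> \<in> dual_space" and z: "z \<in> root_space \<beta>" "\<lbrakk>y, z\<rbrakk> = 0"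
  shows "\<lbrakk>y, (lie_bracket x ^^ Suc i) z\<rbrakk>
    = mscale (- ((of_nat i + 1) * (\<beta> (coroot \<alpha>) + of_nat i))) ((lie_bracket x ^^ i) z)"
proof -
  let ?X = "\<lambda>i. (lie_bracket x ^^ i) z" and ?b = "\<beta> (coroot \<alpha>)"
  have h: "\<lbrakk>coroot \<alpha>, ?X i\<rbrakk> = mscale (?b + 2 * of_nat i) (?X i)" for i
    using root_space_eigen[OF chain_in[OF x z(1)] coroot_in[OF a], of i] root_coroot_self[OF a]
    by (simp add: fscale_def mult.commute)
  have step: "\<lbrakk>y, \<lbrakk>x, v\<rbrakk>\<rbrakk> = \<lbrakk>x, \<lbrakk>y, v\<rbrakk>\<rbrakk> - \<lbrakk>coroot \<alpha>, v\<rbrakk>" for v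
    using jacobi[of x y v] xy by simp
  show ?thesis
  proof (induction i)
    case 0
    show ?case using step[of z] h[of 0] z by simp
  next
    case (Suc i)
    have "\<lbrakk>y, ?X (Suc (Suc i))\<rbrakk> = \<lbrakk>x, \<lbrakk>y, ?X (Suc i)\<rbrakk>\<rbrakk> - \<lbrakk>coroot \<alpha>, ?X (Suc i)\<rbrakk>"
      using step[of "?X (Suc i)"] by simp
    also have "\<dots> = mscale (- ((of_nat i + 1) * (?b + of_nat i))) (?X (Suc i))
        - mscale (?b + 2 * of_nat (Suc i)) (?X (Suc i))"
      unfolding Suc h by (simp add: lie_bracket_scale_right lie_bracket_minus)
    also have "\<dots> = mscale (- ((of_nat (Suc i) + 1) * (?b + of_nat (Suc i)))) (?X (Suc i))"
      unfolding cmat.scale_left_diff_distrib[symmetric] by (rule arg_cong[of _ _ "\<lambda>c. mscale c _"])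
        (simp add: algebra_simps)
    finally show ?case .
  qed
qed

text \<open>Apply \<open>chain_lower\<close> at the top of the chain: there raising gives 0, so the
  coefficient (n + 1)(\<beta>(h) + n) must vanish.\<close>

lemma lowest_weight:
  assumes a: "\<alpha> \<in> roots" and x: "x \<in> root_space \<alpha>" and xy: "\<lbrakk>x, y\<rbrakk> = coroot \<alpha>"
    and b: "\<beta> \<in> dual_space" and z: "z \<in> root_space \<beta>" "z \<noteq> 0" "\<lbrakk>y, z\<rbrakk> = 0"
  obtains n where "\<beta> (coroot \<alpha>) = - of_nat n" "\<forall>i\<le>n. (lie_bracket x ^^ i) z \<noteq> 0"
proof -
  obtain n where n: "\<forall>i\<le>n. (lie_bracket x ^^ i) z \<noteq> 0" "\<lbrakk>x, (lie_bracket x ^^ n) z\<rbrakk> = 0"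
    by (rule chain_stops[OF a x b z(1,2)])
  have "mscale (- ((of_nat n + 1) * (\<beta> (coroot \<alpha>) + of_nat n))) ((lie_bracket x ^^ n) z) = 0"
    using chain_lower[OF a x xy b z(1,3), of n] n(2) by simp
  then have "(of_nat n + 1) * (\<beta> (coroot \<alpha>) + of_nat n) = 0" using n(1) by simp
  moreover have "of_nat n + 1 \<noteq> (0::complex)" using of_nat_neq_0[of n] by (simp add: add.commute)
  ultimately have "\<beta> (coroot \<alpha>) = - of_nat n" by (simp add: add_eq_0_iff2)
  with n show ?thesis using that by blast
qed

text \<open>Through this, \<open>lowest_weight\<close> for \<open>-\<alpha>\<close> becomes a statement about highest weight vectors.\<close>
lemma sl2_swap:
  assumes "\<alpha> \<in> roots" "\<lbrakk>x, y\<rbrakk> = coroot \<alpha>"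
  shows "\<lbrakk>y, x\<rbrakk> = coroot (- \<alpha>)"
  using assms coroot_neg lie_bracket_antisym[of y x] by simp

lemma eval_coroot_neg: "\<alpha> \<in> roots \<Longrightarrow> \<beta> \<in> dual_space \<Longrightarrow> \<beta> (coroot (- \<alpha>)) = - \<beta> (coroot \<alpha>)"
  using dual_scale[of \<beta> "coroot \<alpha>" "-1"] coroot_in[of \<alpha>] by (simp add: coroot_neg)

text \<open>Lower a vector of weight \<beta> to the bottom of its string, s steps down. The bottom
  weight \<beta> - s \<alpha> has value -n at the coroot, whence \<beta>(h) = 2 s - n, and the n
  raisings from the bottom stay nonzero. In this numbering \<beta> has index s.\<close>

lemma weight_string:
  assumes a: "\<alpha> \<in> roots" and b: "\<beta> \<in> weights"
  obtains s n where "\<beta> (coroot \<alpha>) = of_int (2 * int s - int n)"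
    "\<forall>i\<le>n. \<beta> + fscale (of_int (int i - int s)) \<alpha> \<in> weights"
proof -
  obtain x where x: "x \<in> root_space \<alpha>" "x \<noteq> 0" using root_vector[OF a] by blast
  obtain y where y: "y \<in> root_space (- \<alpha>)" "\<lbrakk>x, y\<rbrakk> = coroot \<alpha>" using sl2_triple[OF a x] .
  obtain z where z: "z \<in> root_space \<beta>" "z \<noteq> 0"
  \<comment> \<open>For the weight 0 the coroot itself serves as the nonzero vector.\<close>
  proof (cases "\<beta> = 0")
    case True
    have "\<alpha> (coroot \<alpha>) \<noteq> \<alpha> 0" using root_coroot_self[OF a] dual_zero[OF root_dual[OF a]] by simp
    then have "coroot \<alpha> \<noteq> 0" by auto
    then show ?thesis using that[of "coroot \<alpha>"] True coroot_in[OF a] by (simp add: root_space_zero)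
  next
    case False then show ?thesis using that b root_vector by (auto simp: weights_def)
  qed
  note bd = weight_dual[OF b]
  obtain s where s: "\<forall>i\<le>s. (lie_bracket y ^^ i) z \<noteq> 0" "\<lbrakk>y, (lie_bracket y ^^ s) z\<rbrakk> = 0"
    by (rule chain_stops[OF root_neg[OF a] y(1) bd z])
  let ?\<delta> = "\<beta> + fscale (of_nat s) (- \<alpha>)"
  have \<delta>: "?\<delta> \<in> dual_space" by (intro dual_closed(2,3,5) bd root_dual a)
  note zs = chain_in[OF y(1) z(1), of s]
  obtain n where n: "?\<delta> (coroot \<alpha>) = - of_nat n"
    "\<forall>i\<le>n. (lie_bracket x ^^ i) ((lie_bracket y ^^ s) z) \<noteq> 0"
    by (rule lowest_weight[OF a x(1) y(2) \<delta> zs s(1)[rule_format, OF order.refl] s(2)])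
  show ?thesis
  proof (rule that)
    show "\<beta> (coroot \<alpha>) = of_int (2 * int s - int n)"
      using n(1) root_coroot_self[OF a] by (simp add: fscale_def algebra_simps)
    show "\<forall>i\<le>n. \<beta> + fscale (of_int (int i - int s)) \<alpha> \<in> weights"
    proof (intro allI impI)
      fix i assume i: "i \<le> n"
      show "\<beta> + fscale (of_int (int i - int s)) \<alpha> \<in> weights"
      proof (rule weightI)
      have "?\<delta> + fscale (of_nat i) \<alpha> = \<beta> + fscale (of_int (int i - int s)) \<alpha>"
        by (auto simp: fun_eq_iff fscale_def algebra_simps)
      then show "(lie_bracket x ^^ i) ((lie_bracket y ^^ s) z) \<in> root_space (\<beta> + fscale (of_int (int i - int s)) \<alpha>)"
        using chain_in[OF x(1) zs, of i] by (simp only:)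
      qed (intro n(2)[rule_format, OF i] dual_closed(2,3) bd root_dual a)+
    qed
  qed
qed

lemma coroot_integral: "\<alpha> \<in> roots \<Longrightarrow> \<beta> \<in> weights \<Longrightarrow> \<beta> (coroot \<alpha>) \<in> \<int>"
  using weight_string by (metis Ints_of_int)

text \<open>The value at a coroot is a complex number; rounding its real part down moves it to type
  \<open>int\<close>, and is exact whenever \<alpha> is a root and \<beta> a weight.\<close>

definition cartan_int :: "'n functional \<Rightarrow> 'n functional \<Rightarrow> int" where
  "cartan_int \<beta> \<alpha> = \<lfloor>Re (\<beta> (coroot \<alpha>))\<rfloor>"

lemma cartan_int: "\<alpha> \<in> roots \<Longrightarrow> \<beta> \<in> weights \<Longrightarrow> \<beta> (coroot \<alpha>) = of_int (cartan_int \<beta> \<alpha>)"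
  using coroot_integral[of \<alpha> \<beta>] by (auto simp: cartan_int_def elim!: Ints_cases)

text \<open>The reflection of member s of the string is its mirror image, member n - s, when
  \<beta>(h) \<le> 0. The other sign is reduced to this one by replacing \<alpha> with -\<alpha>,
  which defines the same reflection.\<close>

lemma reflection_weight:
  assumes a: "\<alpha> \<in> roots" and b: "\<beta> \<in> weights"
  shows "\<beta> - fscale (\<beta> (coroot \<alpha>)) \<alpha> \<in> weights"
proof -
  have *: "\<beta> - fscale (\<beta> (coroot \<alpha>)) \<alpha> \<in> weights"
    if a: "\<alpha> \<in> roots" and m: "\<beta> (coroot \<alpha>) = of_int m" "m \<le> 0" for \<alpha> m
  proof -
    obtain s n where sn: "\<beta> (coroot \<alpha>) = of_int (2 * int s - int n)"
      "\<forall>i\<le>n. \<beta> + fscale (of_int (int i - int s)) \<alpha> \<in> weights"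
      by (rule weight_string[OF a b])
    then have "m = 2 * int s - int n" using m by (metis of_int_eq_iff)
    \<comment> \<open>Natural subtraction is exact here, because m \<le> 0 means 2 s \<le>
      n.\<close>
    with m have "int (n - s) - int s = - m" "n - s \<le> n" by auto
    then have "\<beta> + fscale (of_int (- m)) \<alpha> \<in> weights" using sn(2)[rule_format, of "n - s"] by simp
    moreover have "\<beta> + fscale (of_int (- m)) \<alpha> = \<beta> - fscale (\<beta> (coroot \<alpha>)) \<alpha>"
      using m by (auto simp: fun_eq_iff fscale_def)
    ultimately show ?thesis by (simp only:)
  qed
  show ?thesis
  proof (cases "cartan_int \<beta> \<alpha> \<le> 0")
    case True then show ?thesis using *[OF a cartan_int[OF a b]] by simp
  next
    case False
    have "\<beta> (coroot (- \<alpha>)) = of_int (- cartan_int \<beta> \<alpha>)"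
      using eval_coroot_neg[OF a weight_dual[OF b]] cartan_int[OF a b] by simp
    from *[OF root_neg[OF a] this] False
    have "\<beta> - fscale (\<beta> (coroot (- \<alpha>))) (- \<alpha>) \<in> weights" by simp
    moreover have "\<beta> - fscale (\<beta> (coroot (- \<alpha>))) (- \<alpha>) = \<beta> - fscale (\<beta> (coroot \<alpha>)) \<alpha>"
      using eval_coroot_neg[OF a weight_dual[OF b]] by (simp add: fun_eq_iff fscale_def)
    ultimately show ?thesis by simp
  qed
qed

text \<open>A vector killed by x is a lowest weight vector for -\<alpha>. Used contrapositively: a
  negative value at the coroot forces [x, z] to be nonzero.\<close>

lemma raising_nonzero:
  assumes a: "\<alpha> \<in> roots" and x: "x \<in> root_space \<alpha>" "x \<noteq> 0" and b: "\<beta> \<in> dual_space"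
    and z: "z \<in> root_space \<beta>" "z \<noteq> 0" "\<lbrakk>x, z\<rbrakk> = 0"
  shows "\<exists>n. \<beta> (coroot \<alpha>) = of_nat n"
proof -
  obtain y where y: "y \<in> root_space (- \<alpha>)" "\<lbrakk>x, y\<rbrakk> = coroot \<alpha>" using sl2_triple[OF a x] .
  obtain n where "\<beta> (coroot (- \<alpha>)) = - of_nat n"
    by (rule lowest_weight[OF root_neg[OF a] y(1) sl2_swap[OF a y(2)] b z])
  then show ?thesis using eval_coroot_neg[OF a b] by simp
qed

text \<open>Orthogonality to y means [z, y] = 0. A nonzero z would then be a lowest weight vector of
  weight \<alpha>, although \<alpha> has value 2, which is not of the form -n.\<close>

lemma root_space_orthogonal_zero:
  assumes a: "\<alpha> \<in> roots" and x: "x \<in> root_space \<alpha>" "x \<noteq> 0" and y: "y \<in> root_space (- \<alpha>)" "\<lbrakk>x, y\<rbrakk> = coroot \<alpha>"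
    and z: "z \<in> root_space \<alpha>" "\<kappa> z y = 0"
  shows "z = 0"
proof (rule ccontr)
  assume "z \<noteq> 0"
  moreover have "\<lbrakk>y, z\<rbrakk> = 0"
    using bracket_eq_dual_vector[OF a z(1) y(1)] z(2) lie_bracket_antisym[of y z] by simp
  ultimately obtain n where "\<alpha> (coroot \<alpha>) = - of_nat n"
    by (rule lowest_weight[OF a x(1) y(2) root_dual[OF a] z(1)])
  then have "Re 2 = Re (- of_nat n)" using root_coroot_self[OF a] by metis
  then show False by simp
qed

text \<open>Pairing with y is a linear functional on the root space whose kernel is zero by the
  preceding lemma.\<close>

lemma root_space_one_dim:
  assumes a: "\<alpha> \<in> roots" and x: "x \<in> root_space \<alpha>" "x \<noteq> 0" and z: "z \<in> root_space \<alpha>"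
  shows "\<exists>c. z = mscale c x"
proof -
  obtain y where y: "y \<in> root_space (- \<alpha>)" "\<lbrakk>x, y\<rbrakk> = coroot \<alpha>" using sl2_triple[OF a x] .
  note g = root_space_in_\<gg>[OF x(1)] root_space_in_\<gg>[OF y(1)] root_space_in_\<gg>[OF z]
  have n: "\<kappa> x y \<noteq> 0" using root_space_orthogonal_zero[OF a x y x(1)] x by auto
  define c where "c = \<kappa> z y / \<kappa> x y"
  have "z + mscale (- c) x = 0"
  proof (rule root_space_orthogonal_zero[OF a x y])
    show "\<kappa> (z + mscale (- c) x) y = 0"
      using g n by (subst \<kappa>_add_left)
        (simp_all add: \<gg>_closed killing_minus_left[OF subalg] \<kappa>_scale_left c_def)
  qed (use x z root_space_closed in auto)
  then show ?thesis by (intro exI[of _ c]) (simp add: add_eq_0_iff)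
qed

text \<open>Raise a vector of \<open>\<gg>\<^bsub>\<alpha>+\<beta>\<^esub>\<close> to the top of its \<open>\<alpha>\<close>-string and lower it again down to \<open>\<gg>\<^sub>\<beta>\<close>: the result
  is not killed by \<open>x\<close>, and it is a multiple of \<open>z\<close>.\<close>
lemma bracket_root_vectors_nonzero:
  assumes a: "\<alpha> \<in> roots" and b: "\<beta> \<in> roots" and ab: "\<alpha> + \<beta> \<in> roots"
    and x: "x \<in> root_space \<alpha>" "x \<noteq> 0" and z: "z \<in> root_space \<beta>" "z \<noteq> 0"
  shows "\<lbrakk>x, z\<rbrakk> \<noteq> 0"
proof
  assume xz: "\<lbrakk>x, z\<rbrakk> = 0"
  obtain y where y: "y \<in> root_space (- \<alpha>)" "\<lbrakk>x, y\<rbrakk> = coroot \<alpha>" using sl2_triple[OF a x] .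
  obtain m where m: "\<beta> (coroot \<alpha>) = of_nat m"
    using raising_nonzero[OF a x root_dual[OF b] z xz] by blast
  obtain w where w: "w \<in> root_space (\<alpha> + \<beta>)" "w \<noteq> 0" using root_vector[OF ab] by blast
  obtain q where q: "(lie_bracket x ^^ q) w \<noteq> 0" "\<lbrakk>x, (lie_bracket x ^^ q) w\<rbrakk> = 0"
  proof -
    obtain q where "\<forall>i\<le>q. (lie_bracket x ^^ i) w \<noteq> 0" "\<lbrakk>x, (lie_bracket x ^^ q) w\<rbrakk> = 0"
      by (rule chain_stops[OF a x(1) root_dual[OF ab] w])
    then show ?thesis using that[of q] by simp
  qed
  define v where "v = (lie_bracket x ^^ q) w"
  let ?\<delta> = "\<alpha> + \<beta> + fscale (of_nat q) \<alpha>"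
  have v: "v \<in> root_space ?\<delta>" unfolding v_def by (rule chain_in[OF x(1) w(1)])
  have \<delta>: "?\<delta> \<in> dual_space" by (intro dual_closed(2)[OF root_dual[OF ab]] dual_closed(3) root_dual a)
  have \<delta>h: "?\<delta> (coroot (- \<alpha>)) = - of_nat (m + 2 + 2 * q)"
    using eval_coroot_neg[OF a \<delta>] m root_coroot_self[OF a] by (simp add: fscale_def algebra_simps)
  note nx = root_neg[OF a]
  obtain n where n: "?\<delta> (coroot (- \<alpha>)) = - of_nat n" "\<forall>i\<le>n. (lie_bracket y ^^ i) v \<noteq> 0"
    by (rule lowest_weight[OF nx y(1) sl2_swap[OF a y(2)] \<delta> v q[folded v_def]])
  have nq: "n = m + 2 + 2 * q" using n(1) \<delta>h by (metis neg_equal_iff_equal of_nat_eq_iff)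
  let ?u = "(lie_bracket y ^^ Suc q) v"
  have "?\<delta> + fscale (of_nat (Suc q)) (- \<alpha>) = \<beta>"
    by (auto simp: fun_eq_iff fscale_def algebra_simps)
  then have "?u \<in> root_space \<beta>" using chain_in[OF y(1) v, of "Suc q"] by (simp only:)
  then obtain c where "?u = mscale c z" using root_space_one_dim[OF b z] by blast
  then have "\<lbrakk>x, ?u\<rbrakk> = 0" using xz by (simp add: lie_bracket_scale_right)
  moreover have "\<lbrakk>x, ?u\<rbrakk> = mscale (- ((of_nat q + 1) * (?\<delta> (coroot (- \<alpha>)) + of_nat q))) ((lie_bracket y ^^ q) v)"
    by (rule chain_lower[OF nx y(1) sl2_swap[OF a y(2)] \<delta> v q(2)[folded v_def]])
  \<comment> \<open>Since q \<le> n = m + 2 + 2 q, the q-th lowered vector is nonzero, so the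
    coefficient itself has to vanish; its second factor is -(m + 2 + q).\<close>
  ultimately have "(of_nat q + 1) * (?\<delta> (coroot (- \<alpha>)) + of_nat q) = (0::complex)"
    using n(2) nq by (auto simp: cmat.scale_eq_0_iff)
  moreover have "of_nat q + 1 \<noteq> (0::complex)" using of_nat_neq_0[of q] by (simp add: add.commute)
  moreover have "?\<delta> (coroot (- \<alpha>)) + of_nat q = - of_nat (m + 2 + q)"
    unfolding \<delta>h by simp
  ultimately have "of_nat (m + 2 + q) = (0::complex)" by (metis mult_eq_0_iff neg_equal_0_iff_equal)
  then show False unfolding of_nat_eq_0_iff by simp
qed

text \<open>The conclusion speaks of weights and not of roots because \<beta> = -\<alpha> is
  allowed.\<close>

lemma root_add_if_neg:
  assumes a: "\<alpha> \<in> roots" and b: "\<beta> \<in> roots" and neg: "cartan_int \<beta> \<alpha> < 0"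
  shows "\<alpha> + \<beta> \<in> weights"
proof -
  obtain x where x: "x \<in> root_space \<alpha>" "x \<noteq> 0" using root_vector[OF a] by blast
  obtain z where z: "z \<in> root_space \<beta>" "z \<noteq> 0" using root_vector[OF b] by blast
  have bw: "\<beta> \<in> weights" using b by (simp add: weights_def)
  have "\<lbrakk>x, z\<rbrakk> \<noteq> 0"
  proof
    assume "\<lbrakk>x, z\<rbrakk> = 0"
    then obtain n where "of_int (cartan_int \<beta> \<alpha>) = (of_nat n :: complex)"
      using raising_nonzero[OF a x root_dual[OF b] z] cartan_int[OF a bw] by auto
    then have "cartan_int \<beta> \<alpha> = int n" by (metis of_int_eq_iff of_int_of_nat_eq)
    then show False using neg by simp
  qed
  then show ?thesis
    using weightI[OF dual_closed(2)[OF root_dual[OF a] root_dual[OF b]] root_space_bracket[OF x(1) z(1)]] by simp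
qed

section \<open>The real inner product\<close>

text \<open>\<open>root_inner\<close> has complex values; they turn out to be real on roots, and
  signs can be discussed only after passing to the real part.\<close>

definition ip :: "'n functional \<Rightarrow> 'n functional \<Rightarrow> real" where
  "ip \<nu> \<mu> = Re (root_inner \<nu> \<mu>)"

lemma weight_represented: "\<gamma> \<in> weights \<Longrightarrow> represented \<gamma>"
  using root_represented represented_zero by (auto simp: weights_def)

text \<open>The source of positivity: once the factors are real, (\<nu>, \<nu>) is a sum of
  squares.\<close>

lemma \<kappa>_dual_vectors:
  assumes B: "finite B" "cmat.independent B" "cmat.span B = \<gg>"
    "\<And>b. b \<in> B \<Longrightarrow> wt b \<in> weights" "\<And>b. b \<in> B \<Longrightarrow> b \<in> root_space (wt b)"
    and r: "represented \<nu>" "represented \<mu>"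
  shows "root_inner \<nu> \<mu> = (\<Sum>b\<in>B. root_inner (wt b) \<nu> * root_inner (wt b) \<mu>)"
proof -
  have "root_inner \<nu> \<mu> = (\<Sum>b\<in>B. wt b (dual_vector \<nu>) * wt b (dual_vector \<mu>))"
    unfolding root_inner_def using r by (intro \<kappa>_cartan[OF B]) (auto simp: represented_def)
  also have "\<dots> = (\<Sum>b\<in>B. root_inner (wt b) \<nu> * root_inner (wt b) \<mu>)"
    using root_inner_eval[OF weight_represented[OF B(4)]] r by (intro sum.cong) auto
  finally show ?thesis .
qed

lemma inner_via_cartan_int:
  assumes "\<alpha> \<in> roots" "\<beta> \<in> weights"
  shows "root_inner \<beta> \<alpha> = of_int (cartan_int \<beta> \<alpha>) * root_inner \<alpha> \<alpha> / 2"
  using eval_coroot[OF assms(1) weight_represented[OF assms(2)]] cartan_int[OF assms]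
    root_self_inner_nonzero[OF assms(1)] by (simp add: field_simps)

text \<open>Put \<nu> = \<mu> = \<alpha> in \<open>\<kappa>_dual_vectors\<close>. Each factor is
  half a Cartan integer times q = (\<alpha>, \<alpha>), so q = s q^2 / 4 with s a sum of squares of
  integers; as q is nonzero, q = 4 / s.\<close>

lemma root_self_inner:
  assumes a: "\<alpha> \<in> roots"
  shows "root_inner \<alpha> \<alpha> = of_real (ip \<alpha> \<alpha>)" "ip \<alpha> \<alpha> > 0"
proof -
  obtain B wt where B: "finite B" "cmat.independent B" "cmat.span B = \<gg>"
    "\<And>b. b \<in> B \<Longrightarrow> wt b \<in> weights" "\<And>b. b \<in> B \<Longrightarrow> b \<in> root_space (wt b)"
    using weight_basis by metis
  let ?q = "root_inner \<alpha> \<alpha>"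
  define s where "s = (\<Sum>b\<in>B. (real_of_int (cartan_int (wt b) \<alpha>))\<^sup>2)"
  have "?q = (\<Sum>b\<in>B. root_inner (wt b) \<alpha> * root_inner (wt b) \<alpha>)"
    using \<kappa>_dual_vectors[OF B] root_represented[OF a] by blast
  also have "\<dots> = (\<Sum>b\<in>B. of_real ((real_of_int (cartan_int (wt b) \<alpha>))\<^sup>2) * (?q\<^sup>2 / 4))"
    by (intro sum.cong refl) (simp add: inner_via_cartan_int[OF a B(4)] power2_eq_square)
  also have "\<dots> = of_real s * (?q\<^sup>2 / 4)" by (simp add: s_def sum_distrib_right)
  finally have "?q = of_real s * (?q\<^sup>2 / 4)" .
  then have 1: "of_real s * ?q = 4"
    using root_self_inner_nonzero[OF a] by (simp add: power2_eq_square field_simps)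
  then have s: "s \<noteq> 0" by auto
  moreover have "s \<ge> 0" unfolding s_def by (intro sum_nonneg) auto
  ultimately have "s > 0" by simp
  have q: "?q = of_real (4 / s)" using 1 s by (simp add: field_simps)
  then show "?q = of_real (ip \<alpha> \<alpha>)" by (simp add: ip_def)
  show "ip \<alpha> \<alpha> > 0" using q \<open>s > 0\<close> by (simp add: ip_def)
qed

lemma root_inner_real:
  assumes "\<alpha> \<in> roots" "\<beta> \<in> weights" shows "root_inner \<beta> \<alpha> = of_real (ip \<beta> \<alpha>)"
proof -
  have "root_inner \<beta> \<alpha> = of_real (of_int (cartan_int \<beta> \<alpha>) * ip \<alpha> \<alpha> / 2)"
    using inner_via_cartan_int[OF assms] root_self_inner(1)[OF assms(1)] by simp
  then show ?thesis by (metis Re_complex_of_real ip_def)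
qed

lemma ip_cartan_int:
  assumes "\<alpha> \<in> roots" "\<beta> \<in> weights" shows "2 * ip \<beta> \<alpha> = of_int (cartan_int \<beta> \<alpha>) * ip \<alpha> \<alpha>"
proof -
  have "complex_of_real (2 * ip \<beta> \<alpha>) = of_real (of_int (cartan_int \<beta> \<alpha>) * ip \<alpha> \<alpha>)"
    using inner_via_cartan_int[OF assms] root_self_inner(1)[OF assms(1)] root_inner_real[OF assms]
    by (simp add: mult.commute)
  then show ?thesis unfolding of_real_eq_iff .
qed

lemma root_inner_zero_iff: "\<alpha> \<in> roots \<Longrightarrow> \<beta> \<in> weights \<Longrightarrow> root_inner \<beta> \<alpha> = 0 \<longleftrightarrow> ip \<beta> \<alpha> = 0"
  using root_inner_real by simp

lemma ip_sym: "represented \<nu> \<Longrightarrow> represented \<mu> \<Longrightarrow> ip \<nu> \<mu> = ip \<mu> \<nu>"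
  by (simp add: ip_def root_inner_sym)

lemma ip_add_left:
  "represented \<nu> \<Longrightarrow> represented \<nu>' \<Longrightarrow> represented \<mu> \<Longrightarrow> ip (\<nu> + \<nu>') \<mu> = ip \<nu> \<mu> + ip \<nu>' \<mu>"
  by (simp add: ip_def root_inner_add_left)

lemma ip_scale_left:
  "represented \<nu> \<Longrightarrow> represented \<mu> \<Longrightarrow> ip (fscale (of_real c) \<nu>) \<mu> = c * ip \<nu> \<mu>"
  by (simp add: ip_def root_inner_scale_left)

lemma ip_neg_left: "represented \<nu> \<Longrightarrow> represented \<mu> \<Longrightarrow> ip (- \<nu>) \<mu> = - ip \<nu> \<mu>"
  using ip_scale_left[of \<nu> \<mu> "-1"] by (simp add: fscale_minus_one)

lemma represented_sum: "(\<And>i. i \<in> I \<Longrightarrow> represented (f i)) \<Longrightarrow> represented (\<Sum>i\<in>I. f i)"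
proof (induction I rule: infinite_finite_induct)
  case (insert i I)
  then have "represented (f i)" "represented (sum f I)" by blast+
  then show ?case unfolding sum.insert[OF insert.hyps] by (rule represented_add(1))
next
  case (infinite I)
  show ?case unfolding sum.infinite[OF infinite(1)] by (rule represented_zero)
qed (unfold sum.empty, rule represented_zero)

lemma ip_zero: "represented \<mu> \<Longrightarrow> ip 0 \<mu> = 0"
  using ip_scale_left[OF represented_zero, of \<mu> 0] by simp

lemma ip_sum_left:
  assumes "\<And>i. i \<in> I \<Longrightarrow> represented (f i)" "represented \<mu>"
  shows "ip (\<Sum>i\<in>I. f i) \<mu> = (\<Sum>i\<in>I. ip (f i) \<mu>)"
  using assms(1)
proof (induction I rule: infinite_finite_induct)
  case (insert i I)
  have "represented (sum f I)" by (rule represented_sum) (use insert.prems in blast)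
  then have "ip (f i + sum f I) \<mu> = ip (f i) \<mu> + ip (sum f I) \<mu>"
    using insert.prems assms(2) by (intro ip_add_left) blast+
  then show ?case unfolding sum.insert[OF insert.hyps] using insert.IH insert.prems by (metis insertCI)
next
  case (infinite I)
  show ?case unfolding sum.infinite[OF infinite(1)] by (rule ip_zero[OF assms(2)])
qed (unfold sum.empty, rule ip_zero[OF assms(2)])

text \<open>For a real combination \<nu> of roots all (wt b, \<nu>) are real, so (\<nu>, \<nu>) is a
  sum of their squares. If it is zero, all weights vanish at the dual vector of \<nu>, which is then
  orthogonal to \<tt>.\<close>

lemma ip_definite:
  assumes f: "\<And>\<alpha>. \<alpha> \<in> A \<Longrightarrow> \<alpha> \<in> roots" and nu: "\<nu> = (\<Sum>\<alpha>\<in>A. fscale (of_real (c \<alpha>)) \<alpha>)"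
  shows "ip \<nu> \<nu> \<ge> 0" and "ip \<nu> \<nu> = 0 \<Longrightarrow> \<nu> = 0"
proof -
  obtain B wt where B: "finite B" "cmat.independent B" "cmat.span B = \<gg>"
    "\<And>b. b \<in> B \<Longrightarrow> wt b \<in> weights" "\<And>b. b \<in> B \<Longrightarrow> b \<in> root_space (wt b)"
    using weight_basis by metis
  have r: "represented \<nu>" unfolding nu
    using f represented_scale(1) root_represented by (intro represented_sum) blast
  have real: "root_inner (wt b) \<nu> = of_real (ip (wt b) \<nu>)" if b: "b \<in> B" for b
  proof -
    note wr = weight_represented[OF B(4)[OF b]]
    have "root_inner (wt b) \<nu> = wt b (dual_vector \<nu>)" by (rule root_inner_eval[OF wr r])
    \<comment> \<open>Reality is shown with the root as second argument, where
      \<open>root_inner_real\<close> applies term by term, and transferred by symmetry.\<close>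
    have "root_inner \<nu> (wt b) \<in> \<real>" if "wt b \<in> roots"
    proof -
      have "root_inner \<nu> (wt b) = \<nu> (dual_vector (wt b))" by (rule root_inner_eval[OF r wr])
      also have "\<dots> = (\<Sum>\<alpha>\<in>A. of_real (c \<alpha>) * \<alpha> (dual_vector (wt b)))"
        unfolding nu by (induction A rule: infinite_finite_induct) (auto simp: fscale_def)
      also have "\<dots> = (\<Sum>\<alpha>\<in>A. of_real (c \<alpha>) * of_real (ip \<alpha> (wt b)))"
        using root_inner_eval[OF root_represented[OF f] wr] root_inner_real[OF that] f
        by (intro sum.cong refl) (simp add: weights_def)
      finally show ?thesis by auto
    qed
    moreover have "root_inner \<nu> (wt b) \<in> \<real>" if "wt b = 0"
      using root_inner_scale_left[OF represented_zero r, of 0] root_inner_sym[OF r represented_zero] that by simp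
    ultimately have "root_inner \<nu> (wt b) \<in> \<real>" using B(4)[OF b] by (auto simp: weights_def)
    then show ?thesis using root_inner_sym[OF r wr] by (auto simp: ip_def elim!: Reals_cases)
  qed
  have "root_inner \<nu> \<nu> = (\<Sum>b\<in>B. root_inner (wt b) \<nu> * root_inner (wt b) \<nu>)"
    by (rule \<kappa>_dual_vectors[OF B(1-5) r r])
  also have "\<dots> = of_real (\<Sum>b\<in>B. (ip (wt b) \<nu>)\<^sup>2)"
    using real by (simp add: power2_eq_square)
  finally have sq: "ip \<nu> \<nu> = (\<Sum>b\<in>B. (ip (wt b) \<nu>)\<^sup>2)" unfolding ip_def[of \<nu> \<nu>] by (metis Re_complex_of_real)
  then show "ip \<nu> \<nu> \<ge> 0" by (simp add: sum_nonneg)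
  assume "ip \<nu> \<nu> = 0"
  with sq have "(\<Sum>b\<in>B. (ip (wt b) \<nu>)\<^sup>2) = 0" by simp
  then have zero: "root_inner (wt b) \<nu> = 0" if "b \<in> B" for b
    using B(1) that real[OF that] by (subst (asm) sum_nonneg_eq_0_iff) auto
  have "\<kappa> (dual_vector \<nu>) h = 0" if h: "h \<in> \<tt>" for h
  proof -
    have "wt b (dual_vector \<nu>) = 0" if "b \<in> B" for b
      using zero[OF that] root_inner_eval[OF weight_represented[OF B(4)[OF that]] r] by simp
    then show ?thesis using \<kappa>_cartan[OF B(1-5) _ h] r by (simp add: represented_def)
  qed
  then show "\<nu> = 0" using r dual_closed(1) by (intro dual_eqI) (auto simp: represented_def)
qed

section \<open>Positive roots and highest roots\<close>

text \<open>These rules make the simplifier expand sums of functionals into abstractions, which then no longer match.\<close>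
declare plus_fun_apply [simp del] zero_fun_apply [simp del] minus_apply [simp del] uminus_apply [simp del]

definition rc :: "'n functional \<Rightarrow> 'n functional \<Rightarrow> real" where
  "rc \<gamma> \<alpha> = Re (root_coeff \<gamma> \<alpha>)"

definition ht :: "'n functional \<Rightarrow> real" where
  "ht \<gamma> = (\<Sum>\<alpha>\<in>\<Psi>. rc \<gamma> \<alpha>)"

lemma rc_add: "\<gamma> \<in> cfun.span \<Psi> \<Longrightarrow> \<delta> \<in> cfun.span \<Psi> \<Longrightarrow> rc (\<gamma> + \<delta>) \<alpha> = rc \<gamma> \<alpha> + rc \<delta> \<alpha>"
  and rc_diff: "\<gamma> \<in> cfun.span \<Psi> \<Longrightarrow> \<delta> \<in> cfun.span \<Psi> \<Longrightarrow> rc (\<gamma> - \<delta>) \<alpha> = rc \<gamma> \<alpha> - rc \<delta> \<alpha>"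
  and rc_neg: "\<gamma> \<in> cfun.span \<Psi> \<Longrightarrow> rc (- \<gamma>) \<alpha> = - rc \<gamma> \<alpha>"
  and rc_zero: "rc 0 \<alpha> = 0"
  and rc_simple: "\<delta> \<in> \<Psi> \<Longrightarrow> rc \<delta> \<alpha> = (if \<alpha> = \<delta> then 1 else 0)"
  and rc_scale: "\<gamma> \<in> cfun.span \<Psi> \<Longrightarrow> rc (fscale (of_real c) \<gamma>) \<alpha> = c * rc \<gamma> \<alpha>"
  by (simp_all add: rc_def root_coeff_add root_coeff_diff root_coeff_neg root_coeff_zero
      root_coeff_simple root_coeff_scale)

lemma rc_scale_int: "\<gamma> \<in> cfun.span \<Psi> \<Longrightarrow> rc (fscale (of_int c) \<gamma>) \<alpha> = of_int c * rc \<gamma> \<alpha>"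
  using rc_scale[of \<gamma> "of_int c"] by simp

lemma ht_add: "\<gamma> \<in> cfun.span \<Psi> \<Longrightarrow> \<delta> \<in> cfun.span \<Psi> \<Longrightarrow> ht (\<gamma> + \<delta>) = ht \<gamma> + ht \<delta>"
  by (simp add: ht_def rc_add sum.distrib)

lemma ht_neg: "\<gamma> \<in> cfun.span \<Psi> \<Longrightarrow> ht (- \<gamma>) = - ht \<gamma>"
  by (simp add: ht_def rc_neg sum_negf)

lemma ht_zero: "ht 0 = 0"
  by (simp add: ht_def rc_zero)

lemma root_coeff_real: "\<gamma> \<in> roots \<Longrightarrow> \<alpha> \<in> \<Psi> \<Longrightarrow> root_coeff \<gamma> \<alpha> = of_real (rc \<gamma> \<alpha>)"
  using base_sign[of \<gamma>] by (auto simp: rc_def Nats_def complex_eq_iff minus_equation_iff[of "root_coeff _ _"])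

text \<open>By \<open>base_sign\<close> the coefficients of a root are all natural numbers or all
  negatives of such, so a sign test on real parts suffices.\<close>

lemma pos_roots_iff: "\<gamma> \<in> pos_roots \<longleftrightarrow> \<gamma> \<in> roots \<and> (\<forall>\<alpha>\<in>\<Psi>. rc \<gamma> \<alpha> \<ge> 0)"
proof
  assume g: "\<gamma> \<in> roots \<and> (\<forall>\<alpha>\<in>\<Psi>. rc \<gamma> \<alpha> \<ge> 0)"
  have "root_coeff \<gamma> \<alpha> \<in> \<nat>" if a: "\<alpha> \<in> \<Psi>" and n: "- root_coeff \<gamma> \<alpha> \<in> \<nat>" for \<alpha>
  proof -
    obtain k where k: "- root_coeff \<gamma> \<alpha> = of_nat k" using n by (auto simp: Nats_def)
    then have "root_coeff \<gamma> \<alpha> = - of_nat k" by (metis minus_minus)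
    then have "rc \<gamma> \<alpha> = - real k" by (simp add: rc_def)
    then have "k = 0" using g a by (metis neg_0_le_iff_le of_nat_0_le_iff of_nat_eq_0_iff order_antisym)
    then show ?thesis using k by simp
  qed
  then show "\<gamma> \<in> pos_roots" using g base_sign[of \<gamma>] by (auto simp: pos_roots_def)
next
  assume "\<gamma> \<in> pos_roots"
  then show "\<gamma> \<in> roots \<and> (\<forall>\<alpha>\<in>\<Psi>. rc \<gamma> \<alpha> \<ge> 0)"
    by (auto simp: pos_roots_def rc_def Nats_def)
qed

lemma pos_root: "\<gamma> \<in> pos_roots \<Longrightarrow> \<gamma> \<in> roots"
  and pos_rc: "\<gamma> \<in> pos_roots \<Longrightarrow> \<alpha> \<in> \<Psi> \<Longrightarrow> rc \<gamma> \<alpha> \<ge> 0"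
  by (auto simp: pos_roots_iff)

lemma pos_or_neg: "\<gamma> \<in> roots \<Longrightarrow> \<gamma> \<in> pos_roots \<or> - \<gamma> \<in> pos_roots"
  using base_sign[of \<gamma>] roots_span_base[of \<gamma>] root_neg[of \<gamma>]
  by (auto simp: pos_roots_def root_coeff_neg)

lemma mixed_signs:
  assumes "\<gamma> \<in> roots" "\<alpha> \<in> \<Psi>" "\<beta> \<in> \<Psi>" "rc \<gamma> \<alpha> > 0" "rc \<gamma> \<beta> < 0"
  shows False
  using pos_or_neg[OF assms(1)] assms(2-) rc_neg[OF roots_span_base[OF assms(1)]]
  by (metis neg_0_le_iff_le not_less pos_rc)

lemma rc_nonzero: "\<gamma> \<in> roots \<Longrightarrow> \<exists>\<alpha>\<in>\<Psi>. rc \<gamma> \<alpha> \<noteq> 0"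
proof (rule ccontr)
  assume g: "\<gamma> \<in> roots" and no: "\<not> (\<exists>\<alpha>\<in>\<Psi>. rc \<gamma> \<alpha> \<noteq> 0)"
  then have "\<gamma> = 0" using roots_span_base root_coeff_real
    by (intro root_coeff_eqI) (auto simp: root_coeff_zero cfun.span_zero)
  then show False using g zero_not_root by simp
qed

lemma rc_eqI:
  assumes "\<gamma> \<in> roots" "\<delta> \<in> roots" "\<And>\<alpha>. \<alpha> \<in> \<Psi> \<Longrightarrow> rc \<gamma> \<alpha> = rc \<delta> \<alpha>" shows "\<gamma> = \<delta>"
  using assms roots_span_base root_coeff_real by (intro root_coeff_eqI) auto

lemma pos_not_neg: "\<gamma> \<in> pos_roots \<Longrightarrow> - \<gamma> \<notin> pos_roots"
  using rc_nonzero[of \<gamma>] rc_neg[OF roots_span_base, of \<gamma>] pos_roots_iff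
  by (metis neg_0_le_iff_le order_antisym)

lemma ht_pos: "\<gamma> \<in> pos_roots \<Longrightarrow> ht \<gamma> \<ge> 1"
proof -
  assume g: "\<gamma> \<in> pos_roots"
  obtain \<alpha> where a: "\<alpha> \<in> \<Psi>" "rc \<gamma> \<alpha> \<noteq> 0" using rc_nonzero[OF pos_root[OF g]] by blast
  obtain k where "root_coeff \<gamma> \<alpha> = of_nat k" using g a by (auto simp: pos_roots_def Nats_def)
  then have k: "rc \<gamma> \<alpha> = real k" by (simp add: rc_def)
  have "1 \<le> rc \<gamma> \<alpha>" using k a by (cases k) auto
  also have "\<dots> \<le> ht \<gamma>"
    unfolding ht_def using base_finite a pos_rc[OF g] by (intro member_le_sum) auto
  finally show ?thesis .
qed

lemma supp_iff: "\<gamma> \<in> roots \<Longrightarrow> \<alpha> \<in> supp \<gamma> \<longleftrightarrow> \<alpha> \<in> \<Psi> \<and> rc \<gamma> \<alpha> \<noteq> 0"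
  using root_coeff_real by (auto simp: supp_def)

lemma supp_simple: "\<alpha> \<in> \<Psi> \<Longrightarrow> supp \<alpha> = {\<alpha>}"
  using supp_iff[of \<alpha>] base_roots rc_simple by (auto split: if_splits)

lemma simple_pos: "\<alpha> \<in> \<Psi> \<Longrightarrow> \<alpha> \<in> pos_roots"
  using base_roots by (auto simp: pos_roots_iff rc_simple)

lemma root_weight: "\<gamma> \<in> roots \<Longrightarrow> \<gamma> \<in> weights"
  by (simp add: weights_def)

lemma pos_add_root: "\<gamma> \<in> pos_roots \<Longrightarrow> \<delta> \<in> pos_roots \<Longrightarrow> \<gamma> + \<delta> \<in> weights \<Longrightarrow> \<gamma> + \<delta> \<in> pos_roots"
proof -
  assume g: "\<gamma> \<in> pos_roots" and d: "\<delta> \<in> pos_roots" and s: "\<gamma> + \<delta> \<in> weights"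
  note sp = roots_span_base[OF pos_root[OF g]] roots_span_base[OF pos_root[OF d]]
  have "ht (\<gamma> + \<delta>) > 0" using ht_add[OF sp] ht_pos[OF g] ht_pos[OF d] by simp
  then have "\<gamma> + \<delta> \<noteq> 0" using ht_zero by force
  then have "\<gamma> + \<delta> \<in> roots" using s by (simp add: weights_def)
  then show ?thesis using rc_add[OF sp] pos_rc[OF g] pos_rc[OF d] by (simp add: pos_roots_iff)
qed

lemma ip_expand:
  assumes "\<gamma> \<in> roots" "represented \<mu>"
  shows "ip \<gamma> \<mu> = (\<Sum>\<alpha>\<in>\<Psi>. rc \<gamma> \<alpha> * ip \<alpha> \<mu>)"
proof -
  have r: "represented \<alpha>" if "\<alpha> \<in> \<Psi>" for \<alpha> using that base_roots root_represented by blast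
  have e: "\<gamma> = (\<Sum>\<alpha>\<in>\<Psi>. fscale (of_real (rc \<gamma> \<alpha>)) \<alpha>)"
    using root_coeff_expand[OF roots_span_base[OF assms(1)]] root_coeff_real[OF assms(1)] by simp
  have "ip \<gamma> \<mu> = ip (\<Sum>\<alpha>\<in>\<Psi>. fscale (of_real (rc \<gamma> \<alpha>)) \<alpha>) \<mu>" by (rule arg_cong[OF e])
  also have "\<dots> = (\<Sum>\<alpha>\<in>\<Psi>. ip (fscale (of_real (rc \<gamma> \<alpha>)) \<alpha>) \<mu>)"
    by (rule ip_sum_left[OF _ assms(2)]) (rule represented_scale(1)[OF r])
  also have "\<dots> = (\<Sum>\<alpha>\<in>\<Psi>. rc \<gamma> \<alpha> * ip \<alpha> \<mu>)"
    by (intro sum.cong refl ip_scale_left r assms(2))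
  finally show ?thesis .
qed

lemma ip_root_sym: "\<gamma> \<in> roots \<Longrightarrow> \<delta> \<in> roots \<Longrightarrow> ip \<gamma> \<delta> = ip \<delta> \<gamma>"
  using ip_sym root_represented by blast

lemma root_sum_if_ip_neg:
  assumes "\<alpha> \<in> roots" "\<beta> \<in> roots" "ip \<beta> \<alpha> < 0" shows "\<alpha> + \<beta> \<in> weights"
proof (rule root_add_if_neg[OF assms(1,2)])
  have "of_int (cartan_int \<beta> \<alpha>) * ip \<alpha> \<alpha> < 0"
    using ip_cartan_int[OF assms(1) root_weight[OF assms(2)]] assms(3) by simp
  then show "cartan_int \<beta> \<alpha> < 0"
    using root_self_inner(2)[OF assms(1)] by (simp add: mult_less_0_iff)
qed

lemma root_diff_if_ip_pos:
  assumes "\<alpha> \<in> roots" "\<beta> \<in> roots" "ip \<beta> \<alpha> > 0" shows "\<beta> - \<alpha> \<in> weights"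
proof -
  have "ip \<beta> (- \<alpha>) < 0"
    using assms ip_neg_left[of \<alpha> \<beta>] ip_sym[of \<beta> \<alpha>] ip_sym[of \<beta> "- \<alpha>"] root_represented represented_neg(1)
    by simp
  then have "- \<alpha> + \<beta> \<in> weights" using root_sum_if_ip_neg root_neg assms by blast
  then show ?thesis by (metis add.commute diff_conv_add_uminus)
qed

lemma cartan_int_sign:
  assumes "\<alpha> \<in> roots" "\<beta> \<in> weights"
  shows "cartan_int \<beta> \<alpha> \<ge> 0 \<longleftrightarrow> ip \<beta> \<alpha> \<ge> 0" "cartan_int \<beta> \<alpha> = 0 \<longleftrightarrow> ip \<beta> \<alpha> = 0"
proof -
  note e = ip_cartan_int[OF assms] and p = root_self_inner(2)[OF assms(1)]
  have "ip \<beta> \<alpha> \<ge> 0 \<longleftrightarrow> of_int (cartan_int \<beta> \<alpha>) * ip \<alpha> \<alpha> \<ge> 0" using e by linarith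
  also have "\<dots> \<longleftrightarrow> cartan_int \<beta> \<alpha> \<ge> 0" using p by (simp add: zero_le_mult_iff)
  finally show "cartan_int \<beta> \<alpha> \<ge> 0 \<longleftrightarrow> ip \<beta> \<alpha> \<ge> 0" by simp
  have "ip \<beta> \<alpha> = 0 \<longleftrightarrow> of_int (cartan_int \<beta> \<alpha>) * ip \<alpha> \<alpha> = 0" using e by linarith
  then show "cartan_int \<beta> \<alpha> = 0 \<longleftrightarrow> ip \<beta> \<alpha> = 0" using p by simp
qed

section \<open>Subsystems generated by simple roots and their highest roots\<close>

text \<open>The root systems of standard Levi subalgebras, written as a fixed-point condition:
  supports consist of simple roots, so the generating set is \<Psi> \<inter> S and need not be
  carried along.\<close>

definition standard :: "'n functional set \<Rightarrow> bool" where
  "standard S \<longleftrightarrow> S = {\<gamma> \<in> roots. supp \<gamma> \<subseteq> S}"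

context
  fixes S assumes S: "standard S"
begin

lemma standard_iff: "\<gamma> \<in> S \<longleftrightarrow> \<gamma> \<in> roots \<and> supp \<gamma> \<subseteq> S"
  using S unfolding standard_def by blast

lemma standard_root: "\<gamma> \<in> S \<Longrightarrow> \<gamma> \<in> roots"
  using standard_iff by blast

lemma standard_rc_outside: "\<gamma> \<in> S \<Longrightarrow> \<alpha> \<in> \<Psi> \<Longrightarrow> \<alpha> \<notin> S \<Longrightarrow> rc \<gamma> \<alpha> = 0"
  using standard_iff supp_iff by blast

lemma standardI: "\<gamma> \<in> roots \<Longrightarrow> (\<And>\<alpha>. \<alpha> \<in> \<Psi> \<Longrightarrow> \<alpha> \<notin> S \<Longrightarrow> rc \<gamma> \<alpha> = 0) \<Longrightarrow> \<gamma> \<in> S"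
  using standard_iff supp_iff by blast

lemma standard_neg: "\<gamma> \<in> S \<Longrightarrow> - \<gamma> \<in> S"
  using standard_root standard_rc_outside root_neg rc_neg[OF roots_span_base]
  by (intro standardI) auto

lemma standard_add: "\<gamma> \<in> S \<Longrightarrow> \<delta> \<in> S \<Longrightarrow> \<gamma> + \<delta> \<in> roots \<Longrightarrow> \<gamma> + \<delta> \<in> S"
  using standard_root standard_rc_outside rc_add[OF roots_span_base roots_span_base]
  by (intro standardI) auto

lemma standard_below:
  assumes "\<beta> \<in> S" "\<gamma> \<in> pos_roots" "\<And>\<alpha>. \<alpha> \<in> \<Psi> \<Longrightarrow> rc \<gamma> \<alpha> \<le> rc \<beta> \<alpha>"
  shows "\<gamma> \<in> S"
proof (rule standardI[OF pos_root[OF assms(2)]])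
  fix \<alpha> assume "\<alpha> \<in> \<Psi>" "\<alpha> \<notin> S"
  then show "rc \<gamma> \<alpha> = 0"
    using assms(3)[of \<alpha>] standard_rc_outside[OF assms(1), of \<alpha>] pos_rc[OF assms(2), of \<alpha>] by simp
qed

lemma standard_finite: "finite S"
  by (rule finite_subset[OF subsetI roots_finite]) (rule standard_root)

lemma ip_expand_standard:
  assumes "\<gamma> \<in> S" "represented \<mu>"
  shows "ip \<gamma> \<mu> = (\<Sum>\<alpha>\<in>\<Psi> \<inter> S. rc \<gamma> \<alpha> * ip \<alpha> \<mu>)"
  unfolding ip_expand[OF standard_root[OF assms(1)] assms(2)]
  using base_finite standard_rc_outside[OF assms(1)] by (intro sum.mono_neutral_right) auto

context
  fixes \<beta> assumes hr: "is_highest_root S \<beta>"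
begin

lemma highest_in: "\<beta> \<in> S" using hr by (simp add: is_highest_root_def)
lemma highest_root: "\<beta> \<in> roots" using highest_in standard_root by blast

lemma highest_rc:
  assumes "\<gamma> \<in> S" "\<alpha> \<in> \<Psi>" shows "rc \<gamma> \<alpha> \<le> rc \<beta> \<alpha>"
proof -
  obtain \<delta>s where d: "set \<delta>s \<subseteq> S \<inter> pos_roots" "\<beta> = \<gamma> + sum_list \<delta>s"
    using hr assms by (auto simp: is_highest_root_def)
  have "sum_list \<delta>s \<in> cfun.span \<Psi> \<and> rc (sum_list \<delta>s) \<alpha> \<ge> 0"
    using d(1)
  proof (induction \<delta>s)
    case Nil
    show ?case unfolding sum_list.Nil rc_zero using cfun.span_zero by blast
  next
    case (Cons \<delta> \<delta>s)
    then have "\<delta> \<in> cfun.span \<Psi>" "rc \<delta> \<alpha> \<ge> 0"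
      using roots_span_base pos_root pos_rc assms(2) by auto
    then show ?case unfolding sum_list.Cons
      using Cons rc_add[of \<delta> "sum_list \<delta>s" \<alpha>] cfun.span_add[of \<delta> \<Psi> "sum_list \<delta>s"] by auto
  qed
  then show ?thesis unfolding d(2)
    using rc_add[OF roots_span_base[OF standard_root[OF assms(1)]]] by simp
qed

text \<open>The root -\<beta> also lies in S, so -\<beta> is bounded by \<beta>
  coefficientwise.\<close>

lemma highest_pos: "\<beta> \<in> pos_roots"
proof -
  have "rc \<beta> \<alpha> \<ge> 0" if "\<alpha> \<in> \<Psi>" for \<alpha>
    using highest_rc[OF standard_neg[OF highest_in] that] rc_neg[OF roots_span_base[OF highest_root]]
    by simp
  then show ?thesis using highest_root by (simp add: pos_roots_iff)
qed

lemma highest_add: "\<delta> \<in> S \<Longrightarrow> \<delta> \<in> pos_roots \<Longrightarrow> \<beta> + \<delta> \<notin> weights"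
proof
  assume d: "\<delta> \<in> S" "\<delta> \<in> pos_roots" and s: "\<beta> + \<delta> \<in> weights"
  have "\<beta> + \<delta> \<in> S" using standard_add highest_in d pos_add_root[OF highest_pos d(2) s] pos_root by blast
  then have "rc \<delta> \<alpha> \<le> 0" if "\<alpha> \<in> \<Psi>" for \<alpha>
    using highest_rc that rc_add[OF roots_span_base[OF highest_root] roots_span_base[OF pos_root[OF d(2)]]] by force
  then have "- \<delta> \<in> pos_roots"
    using pos_root[OF d(2)] root_neg rc_neg[OF roots_span_base] by (simp add: pos_roots_iff)
  then show False using pos_not_neg d by blast
qed

lemma highest_dominant: "\<delta> \<in> S \<Longrightarrow> \<delta> \<in> pos_roots \<Longrightarrow> ip \<delta> \<beta> \<ge> 0"
  using highest_add root_sum_if_ip_neg[OF highest_root] standard_root by (meson not_less)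

lemma highest_supp: "supp \<beta> = \<Psi> \<inter> S"
proof
  show "supp \<beta> \<subseteq> \<Psi> \<inter> S" using highest_in standard_iff supp_iff by blast
  show "\<Psi> \<inter> S \<subseteq> supp \<beta>"
    using highest_rc rc_simple supp_iff[OF highest_root] by fastforce
qed

text \<open>Identifies the system defined by the support of \<beta> with the one in which \<beta>
  was found as highest root.\<close>

lemma highest_supp_system: "supp_system \<beta> = S"
proof -
  have "supp \<gamma> \<subseteq> supp \<beta> \<longleftrightarrow> supp \<gamma> \<subseteq> S" for \<gamma> using highest_supp unfolding supp_def by blast
  then show ?thesis using standard_iff by (auto simp: supp_system_def)
qed

lemma highest_heis_roots: "heis_roots \<beta> = {\<gamma> \<in> S \<inter> pos_roots. ip \<gamma> \<beta> \<noteq> 0}"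
  using root_inner_zero_iff[OF highest_root root_weight] pos_root
  by (auto simp: heis_roots_def highest_supp_system)

lemma highest_self_heis: "\<beta> \<in> heis_roots \<beta>"
  using highest_in highest_pos root_self_inner(2)[OF highest_root] by (auto simp: highest_heis_roots)

text \<open>Let c \<ge> 2 be the Cartan integer. The negative c \<beta> - \<gamma> of the reflected
  weight is zero or in S, hence at most \<beta> coefficientwise. So \<gamma> \<ge> (c - 1) \<beta>
  \<ge> \<beta>, and \<gamma> = \<beta>.\<close>

lemma highest_cartan_int_le_one:
  assumes g: "\<gamma> \<in> S" "\<gamma> \<in> pos_roots" "\<gamma> \<noteq> \<beta>" shows "cartan_int \<gamma> \<beta> \<le> 1"
proof (rule ccontr)
  let ?c = "cartan_int \<gamma> \<beta>"
  assume "\<not> ?c \<le> 1"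
  then have c: "real_of_int ?c \<ge> 2" by linarith
  note gr = pos_root[OF g(2)]
  note sp = roots_span_base[OF gr] roots_span_base[OF highest_root]
  let ?r = "\<gamma> - fscale (of_int ?c) \<beta>"
  have rw: "?r \<in> weights"
    using reflection_weight[OF highest_root root_weight[OF gr]] cartan_int[OF highest_root root_weight[OF gr]]
    by metis
  have rr: "rc ?r \<alpha> = rc \<gamma> \<alpha> - of_int ?c * rc \<beta> \<alpha>" for \<alpha>
    using rc_diff[OF sp(1) cfun.span_scale[OF sp(2)]] rc_scale_int[OF sp(2)] by metis
  have b0: "rc \<beta> \<alpha> \<ge> 0" if "\<alpha> \<in> \<Psi>" for \<alpha> using pos_rc[OF highest_pos that] .
  have ge: "rc \<gamma> \<alpha> \<ge> (of_int ?c - 1) * rc \<beta> \<alpha>" if a: "\<alpha> \<in> \<Psi>" for \<alpha>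
  proof (cases "?r = 0")
    case True
    have "rc ?r \<alpha> = 0" by (simp only: True rc_zero)
    then have "rc \<gamma> \<alpha> = of_int ?c * rc \<beta> \<alpha>" using rr[of \<alpha>] by linarith
    then show ?thesis using b0[OF a] by (simp add: algebra_simps)
  next
    case False
    then have "?r \<in> roots" using rw by (simp add: weights_def)
    then have "?r \<in> S"
      using standard_rc_outside[OF g(1)] standard_rc_outside[OF highest_in] rr by (intro standardI) auto
    then have "rc (- ?r) \<alpha> \<le> rc \<beta> \<alpha>" using highest_rc standard_neg a by blast
    then show ?thesis using rr[of \<alpha>] rc_neg[OF roots_span_base[OF \<open>?r \<in> roots\<close>]]
      by (simp add: algebra_simps)
  qed
  have "rc \<gamma> \<alpha> = rc \<beta> \<alpha>" if a: "\<alpha> \<in> \<Psi>" for \<alpha>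
  proof -
    have "1 * rc \<beta> \<alpha> \<le> (of_int ?c - 1) * rc \<beta> \<alpha>" using c b0[OF a] by (intro mult_right_mono) auto
    then show ?thesis using ge[OF a] highest_rc[OF g(1) a] by simp
  qed
  then show False using rc_eqI[OF gr highest_root] g(3) by blast
qed

text \<open>Dominance and the bound make the Cartan integer of \<gamma> equal to 1. Then \<beta> -
  \<gamma> is a root, and it also has Cartan integer 1 because \<beta> has 2. These pairs are the
  ones bracketing to the centre of the Heisenberg algebra.\<close>

lemma heis_complement:
  assumes g: "\<gamma> \<in> heis_roots \<beta>" "\<gamma> \<noteq> \<beta>"
  shows "\<beta> - \<gamma> \<in> heis_roots \<beta>"
proof -
  have g': "\<gamma> \<in> S" "\<gamma> \<in> pos_roots" "ip \<gamma> \<beta> \<noteq> 0" using g highest_heis_roots by auto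
  note gr = pos_root[OF g'(2)]
  have "ip \<gamma> \<beta> > 0" using highest_dominant[OF g'(1,2)] g'(3) by simp
  then have c: "cartan_int \<gamma> \<beta> = 1"
    using cartan_int_sign[OF highest_root root_weight[OF gr]] highest_cartan_int_le_one[OF g'(1,2) g(2)]
    by linarith
  have "ip \<beta> \<gamma> > 0" using \<open>ip \<gamma> \<beta> > 0\<close> ip_root_sym[OF gr highest_root] by simp
  then have "\<beta> - \<gamma> \<in> weights" using root_diff_if_ip_pos[OF gr highest_root] by blast
  then have dr: "\<beta> - \<gamma> \<in> roots" using g(2) by (simp add: weights_def)
  have rcd: "rc (\<beta> - \<gamma>) \<alpha> = rc \<beta> \<alpha> - rc \<gamma> \<alpha>" for \<alpha>
    using rc_diff[OF roots_span_base[OF highest_root] roots_span_base[OF gr]] .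
  have dp: "\<beta> - \<gamma> \<in> pos_roots" using dr rcd highest_rc[OF g'(1)] by (simp add: pos_roots_iff)
  have ds: "\<beta> - \<gamma> \<in> S" using standard_below[OF highest_in dp] rcd pos_rc[OF g'(2)] by simp
  have "ip \<gamma> \<beta> + ip (\<beta> - \<gamma>) \<beta> = ip (\<gamma> + (\<beta> - \<gamma>)) \<beta>"
    using ip_add_left[OF root_represented[OF gr] root_represented[OF dr] root_represented[OF highest_root]] by simp
  also have "\<gamma> + (\<beta> - \<gamma>) = \<beta>" by simp
  finally have "2 * ip (\<beta> - \<gamma>) \<beta> = ip \<beta> \<beta>"
    using ip_cartan_int[OF highest_root root_weight[OF gr]] unfolding c of_int_1 by linarith
  then have "ip (\<beta> - \<gamma>) \<beta> \<noteq> 0" using root_self_inner(2)[OF highest_root] by simp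
  then show ?thesis using dp ds by (simp add: highest_heis_roots)
qed

text \<open>Both summands are bounded by \<beta> coefficientwise and so lie in S. The Cartan
  integers of \<gamma> and \<delta> add up to 2, and that of \<delta> \<noteq> \<beta> is at most 1,
  so \<gamma> is not orthogonal to \<beta>.\<close>

lemma sum_highest_heis:
  assumes g: "\<gamma> \<in> pos_roots" and d: "\<delta> \<in> pos_roots" and s: "\<gamma> + \<delta> = \<beta>"
  shows "\<gamma> \<in> heis_roots \<beta>"
proof -
  note sp = roots_span_base[OF pos_root[OF g]] roots_span_base[OF pos_root[OF d]]
  have le: "rc \<gamma> \<alpha> \<le> rc \<beta> \<alpha>" "rc \<delta> \<alpha> \<le> rc \<beta> \<alpha>" if "\<alpha> \<in> \<Psi>" for \<alpha>
    using rc_add[OF sp] s pos_rc[OF g that] pos_rc[OF d that] by auto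
  have gS: "\<gamma> \<in> S" and dS: "\<delta> \<in> S" using standard_below[OF highest_in] g d le by auto
  have dne: "\<delta> \<noteq> \<beta>" using s root_nonzero[OF pos_root[OF g]] by auto
  have "cartan_int \<delta> \<beta> \<le> 1" using highest_cartan_int_le_one[OF dS d dne] .
  then have "2 * ip \<delta> \<beta> \<le> ip \<beta> \<beta>"
    using ip_cartan_int[OF highest_root root_weight[OF pos_root[OF d]]] root_self_inner(2)[OF highest_root]
    by simp
  moreover have "ip \<gamma> \<beta> + ip \<delta> \<beta> = ip \<beta> \<beta>"
    using ip_add_left[OF root_represented[OF pos_root[OF g]] root_represented[OF pos_root[OF d]] root_represented[OF highest_root]] s
    by simp
  ultimately have "ip \<gamma> \<beta> \<noteq> 0" using root_self_inner(2)[OF highest_root] by simp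
  then show ?thesis using gS g by (simp add: highest_heis_roots)
qed

text \<open>For positive \<gamma> the product with \<beta> is a sum of nonnegative terms over simple
  roots, as \<beta> is dominant on S. If it vanishes, every simple root in the support of \<gamma>
  is orthogonal to \<beta>.\<close>

lemma orthogonal_standard: "standard {\<gamma> \<in> S. root_inner \<gamma> \<beta> = 0}" (is "standard ?X")
proof -
  have X: "?X = {\<gamma> \<in> S. ip \<gamma> \<beta> = 0}"
    using root_inner_zero_iff[OF highest_root root_weight] standard_root by blast
  have simple: "\<alpha> \<in> ?X" if g: "\<gamma> \<in> ?X" "\<gamma> \<in> pos_roots" and a: "\<alpha> \<in> supp \<gamma>" for \<gamma> \<alpha>
  proof -
    have gS: "\<gamma> \<in> S" "ip \<gamma> \<beta> = 0" using g X by auto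
    have aS: "\<alpha> \<in> S" "\<alpha> \<in> \<Psi>" using a gS standard_iff by (auto simp: supp_def)
    have "(\<Sum>\<alpha>\<in>\<Psi> \<inter> S. rc \<gamma> \<alpha> * ip \<alpha> \<beta>) = 0"
      using ip_expand_standard[OF gS(1) root_represented[OF highest_root]] gS(2) by simp
    then have "rc \<gamma> \<alpha> * ip \<alpha> \<beta> = 0"
      using aS base_finite pos_rc[OF g(2)] highest_dominant simple_pos
      by (subst (asm) sum_nonneg_eq_0_iff) auto
    then show ?thesis using a supp_iff[OF pos_root[OF g(2)]] aS X by auto
  qed
  have neg: "- \<gamma> \<in> ?X" if "\<gamma> \<in> ?X" for \<gamma>
    using that standard_neg ip_neg_left[OF root_represented[OF standard_root] root_represented[OF highest_root]] X by auto
  have suppneg: "supp (- \<gamma>) = supp \<gamma>" if "\<gamma> \<in> roots" for \<gamma>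
    using supp_iff[OF that] supp_iff[OF root_neg[OF that]] rc_neg[OF roots_span_base[OF that]] by auto
  have "supp \<gamma> \<subseteq> ?X" if "\<gamma> \<in> ?X" for \<gamma>
  proof (cases "\<gamma> \<in> pos_roots")
    case True then show ?thesis using simple that by blast
  next
    case False
    have "\<gamma> \<in> roots" using that standard_root by blast
    then show ?thesis using simple[OF neg[OF that]] pos_or_neg suppneg False by blast
  qed
  moreover have "\<gamma> \<in> ?X" if g: "\<gamma> \<in> roots" "supp \<gamma> \<subseteq> ?X" for \<gamma>
  proof -
    have gS: "\<gamma> \<in> S" using g standard_iff by blast
    have "ip \<gamma> \<beta> = (\<Sum>\<alpha>\<in>\<Psi>. rc \<gamma> \<alpha> * ip \<alpha> \<beta>)" by (rule ip_expand[OF g(1) root_represented[OF highest_root]])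
    also have "\<dots> = 0" using g(2) supp_iff[OF g(1)] X by (intro sum.neutral) auto
    finally show ?thesis using gS X by simp
  qed
  ultimately show ?thesis unfolding standard_def using standard_root by blast
qed

end

lemma highest_unique: "is_highest_root S \<beta> \<Longrightarrow> is_highest_root S \<beta>' \<Longrightarrow> \<beta> = \<beta>'"
  using highest_rc highest_in highest_root by (intro rc_eqI) (auto intro: order_antisym)

end

section \<open>Irreducibility, existence of highest roots, and orthogonal components\<close>

lemma represented_combination:
  assumes "\<And>\<alpha>. \<alpha> \<in> A \<Longrightarrow> represented \<alpha>"
  shows "represented (\<Sum>\<alpha>\<in>A. fscale (c \<alpha>) \<alpha>)"
  using assms by (intro represented_sum) (rule represented_scale(1))

lemma ip_combination:
  assumes "\<And>\<alpha>. \<alpha> \<in> A \<Longrightarrow> represented \<alpha>" "represented \<mu>"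
  shows "ip (\<Sum>\<alpha>\<in>A. fscale (of_real (c \<alpha>)) \<alpha>) \<mu> = (\<Sum>\<alpha>\<in>A. c \<alpha> * ip \<alpha> \<mu>)"
proof -
  have "ip (\<Sum>\<alpha>\<in>A. fscale (of_real (c \<alpha>)) \<alpha>) \<mu> = (\<Sum>\<alpha>\<in>A. ip (fscale (of_real (c \<alpha>)) \<alpha>) \<mu>)"
    by (rule ip_sum_left[OF _ assms(2)]) (rule represented_scale(1)[OF assms(1)])
  also have "\<dots> = (\<Sum>\<alpha>\<in>A. c \<alpha> * ip \<alpha> \<mu>)"
    by (intro sum.cong refl ip_scale_left assms)
  finally show ?thesis .
qed

lemma rc_combination:
  assumes "A \<subseteq> \<Psi>"
  shows "rc (\<Sum>\<alpha>\<in>A. fscale (of_real (c \<alpha>)) \<alpha>) \<delta> = (if \<delta> \<in> A then c \<delta> else 0)"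
proof -
  have sp: "\<alpha> \<in> cfun.span \<Psi>" if "\<alpha> \<in> A" for \<alpha> using assms that cfun.span_base by blast
  have "rc (\<Sum>\<alpha>\<in>A. fscale (of_real (c \<alpha>)) \<alpha>) \<delta> = (\<Sum>\<alpha>\<in>A. rc (fscale (of_real (c \<alpha>)) \<alpha>) \<delta>)"
    unfolding rc_def by (subst root_coeff_sum) (rule cfun.span_scale[OF sp], simp_all)
  also have "\<dots> = (\<Sum>\<alpha>\<in>A. if \<delta> = \<alpha> then c \<alpha> else 0)"
    using assms by (intro sum.cong refl) (auto simp: rc_scale[OF sp] rc_simple)
  also have "\<dots> = (if \<delta> \<in> A then c \<delta> else 0)"
    using finite_subset[OF assms base_finite] by (rule sum.delta')
  finally show ?thesis .
qed

lemma simple_ip_nonpos: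
  assumes "\<alpha> \<in> \<Psi>" "\<beta> \<in> \<Psi>" "\<alpha> \<noteq> \<beta>" shows "ip \<alpha> \<beta> \<le> 0"
proof (rule ccontr)
  assume "\<not> ip \<alpha> \<beta> \<le> 0"
  then have "\<alpha> - \<beta> \<in> weights" using assms base_roots by (intro root_diff_if_ip_pos) auto
  then have r: "\<alpha> - \<beta> \<in> roots" using assms by (simp add: weights_def)
  have "rc (\<alpha> - \<beta>) \<delta> = rc \<alpha> \<delta> - rc \<beta> \<delta>" for \<delta>
    using assms cfun.span_base by (intro rc_diff) auto
  then show False using mixed_signs[OF r assms(1,2)] assms by (simp add: rc_simple)
qed

text \<open>If some root had support meeting both parts, then a positive one of minimal height would, by a
  reflection in \<open>A\<close> that lowers it, be of the form \<open>c\<alpha> + \<gamma>\<^sub>B\<close>; its reflection \<open>\<gamma>\<^sub>B - c\<alpha>\<close> has mixed signs.\<close>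
lemma orthogonal_simple_split:
  assumes A: "A \<subseteq> \<Psi>" and B: "B \<subseteq> \<Psi>" and disj: "A \<inter> B = {}"
    and orth: "\<And>\<alpha> \<beta>. \<alpha> \<in> A \<Longrightarrow> \<beta> \<in> B \<Longrightarrow> ip \<alpha> \<beta> = 0"
    and g: "\<gamma> \<in> roots" "supp \<gamma> \<subseteq> A \<union> B"
  shows "supp \<gamma> \<subseteq> A \<or> supp \<gamma> \<subseteq> B"
proof -
  define M where "M = {\<gamma> \<in> pos_roots. supp \<gamma> \<subseteq> A \<union> B \<and> supp \<gamma> \<inter> A \<noteq> {} \<and> supp \<gamma> \<inter> B \<noteq> {}}"
  have "M = {}"
  proof (rule ccontr)
    assume ne: "M \<noteq> {}"
    have fin: "finite M" using roots_finite pos_root by (intro finite_subset[of M roots]) (auto simp: M_def)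
    define \<gamma> where "\<gamma> = arg_min_on ht M"
    have gM: "\<gamma> \<in> M" and min: "\<And>\<delta>. \<delta> \<in> M \<Longrightarrow> ht \<gamma> \<le> ht \<delta>"
      using arg_min_if_finite[OF fin ne, of ht] unfolding \<gamma>_def by (auto simp: not_less)
    have gp: "\<gamma> \<in> pos_roots" and gs: "supp \<gamma> \<subseteq> A \<union> B" using gM by (auto simp: M_def)
    note gr = pos_root[OF gp]
    obtain b where b: "b \<in> B" "b \<in> \<Psi>" "rc \<gamma> b > 0"
      using gM supp_iff[OF gr] pos_rc[OF gp] by (force simp: M_def)
    obtain a0 where a0: "a0 \<in> A" "a0 \<in> \<Psi>" "rc \<gamma> a0 > 0"
      using gM supp_iff[OF gr] pos_rc[OF gp] by (force simp: M_def)
    have ipA: "ip \<gamma> \<alpha> = (\<Sum>\<delta>\<in>A. rc \<gamma> \<delta> * ip \<delta> \<alpha>)" if "\<alpha> \<in> A" for \<alpha>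
    proof -
      have "\<alpha> \<in> roots" using that A base_roots by blast
      have "ip \<gamma> \<alpha> = (\<Sum>\<delta>\<in>\<Psi>. rc \<gamma> \<delta> * ip \<delta> \<alpha>)"
        by (rule ip_expand[OF gr root_represented[OF \<open>\<alpha> \<in> roots\<close>]])
      also have "\<dots> = (\<Sum>\<delta>\<in>A. rc \<gamma> \<delta> * ip \<delta> \<alpha>)"
      proof (rule sum.mono_neutral_right[OF base_finite A], intro ballI)
        fix \<delta> assume d: "\<delta> \<in> \<Psi> - A"
        show "rc \<gamma> \<delta> * ip \<delta> \<alpha> = 0"
        proof (cases "\<delta> \<in> B")
          case True
          then have "ip \<alpha> \<delta> = 0" using orth that by blast
          moreover have "ip \<delta> \<alpha> = ip \<alpha> \<delta>"
            using ip_root_sym d \<open>\<alpha> \<in> roots\<close> base_roots by blast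
          ultimately show ?thesis by simp
        next
          case False then show ?thesis using gs d supp_iff[OF gr] by auto
        qed
      qed
      finally show ?thesis .
    qed
    \<comment> \<open>Otherwise the A-part \<mu> of \<gamma> satisfies (\<mu>, \<mu>) \<le> 0: since
      B is orthogonal to A, \<mu> and \<gamma> have the same products with A. So \<mu> = 0, although
      a0 occurs in \<gamma>.\<close>
    obtain a where a: "a \<in> A" "ip \<gamma> a > 0"
    proof (rule ccontr)
      assume no: "\<not> thesis"
      note ob = that
      have ipn: "ip \<gamma> \<alpha> \<le> 0" if "\<alpha> \<in> A" for \<alpha>
        using no ob[OF that] by (meson not_less)
      define \<mu> where "\<mu> = (\<Sum>\<alpha>\<in>A. fscale (of_real (rc \<gamma> \<alpha>)) \<alpha>)"
      have Ar: "\<alpha> \<in> roots" "represented \<alpha>" if "\<alpha> \<in> A" for \<alpha> using that A base_roots root_represented by blast+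
      have mr: "represented \<mu>" unfolding \<mu>_def by (rule represented_combination) (rule Ar(2))
      have mip: "ip \<mu> \<delta> = (\<Sum>\<alpha>\<in>A. rc \<gamma> \<alpha> * ip \<alpha> \<delta>)" if "represented \<delta>" for \<delta>
        unfolding \<mu>_def by (rule ip_combination[OF _ that]) (rule Ar(2))
      have muip: "ip \<mu> \<alpha> = ip \<gamma> \<alpha>" if "\<alpha> \<in> A" for \<alpha>
        using mip[OF Ar(2)[OF that]] ipA[OF that] by simp
      have "ip \<mu> \<mu> = (\<Sum>\<alpha>\<in>A. rc \<gamma> \<alpha> * ip \<alpha> \<mu>)" by (rule mip[OF mr])
      also have "\<dots> = (\<Sum>\<alpha>\<in>A. rc \<gamma> \<alpha> * ip \<gamma> \<alpha>)"
        using muip ip_sym[OF mr Ar(2)] by (intro sum.cong refl) simp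
      also have "\<dots> \<le> 0"
        using ipn pos_rc[OF gp] A by (intro sum_nonpos mult_nonneg_nonpos) auto
      finally have "ip \<mu> \<mu> \<le> 0" .
      moreover have "ip \<mu> \<mu> \<ge> 0" using ip_definite(1)[OF Ar(1) \<mu>_def] by blast
      ultimately have "\<mu> = 0" using ip_definite(2)[OF Ar(1) \<mu>_def] by simp
      then have "rc \<mu> a0 = 0" using rc_zero by simp
      moreover have "rc \<mu> a0 = rc \<gamma> a0" unfolding \<mu>_def using rc_combination[OF A] a0 by simp
      ultimately show False using a0 by simp
    qed
    have aP: "a \<in> \<Psi>" "a \<in> roots" using a A base_roots by auto
    let ?c = "cartan_int \<gamma> a"
    have c: "?c > 0"
      using cartan_int_sign[OF aP(2) root_weight[OF gr]] a(2) by linarith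
    let ?s = "\<gamma> - fscale (of_int ?c) a"
    note sp = roots_span_base[OF gr] cfun.span_base[OF aP(1)]
    have sw: "?s \<in> weights"
      using reflection_weight[OF aP(2) root_weight[OF gr]] cartan_int[OF aP(2) root_weight[OF gr]] by metis
    have rcs: "rc ?s \<delta> = rc \<gamma> \<delta> - (if \<delta> = a then of_int ?c else 0)" for \<delta>
      using rc_diff[OF sp(1) cfun.span_scale[OF sp(2)]] rc_scale_int[OF sp(2)] rc_simple[OF aP(1)] by auto
    have ab: "a \<noteq> b" using a b disj by auto
    have sb: "rc ?s b > 0" using rcs[of b] b ab by simp
    then have "?s \<noteq> 0" using rc_zero by force
    then have sr: "?s \<in> roots" using sw by (simp add: weights_def)
    have sp': "?s \<in> pos_roots"
      using pos_or_neg[OF sr] sb pos_rc[of "- ?s" b] rc_neg[OF roots_span_base[OF sr], of b] b by auto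
    have "ht ?s = ht \<gamma> - of_int ?c"
      unfolding ht_def rcs using base_finite aP by (simp add: sum_subtractf)
    then have "?s \<notin> M" using min[of ?s] c by auto
    moreover have "supp ?s \<subseteq> A \<union> B"
      using gs supp_iff[OF gr] supp_iff[OF sr] rcs a by (auto split: if_splits)
    moreover have "b \<in> supp ?s" using supp_iff[OF sr] b sb by simp
    then have "supp ?s \<inter> B \<noteq> {}" using b by blast
    \<comment> \<open>The reflected root is lower than \<gamma>, so minimality keeps it out of M. As
      it still involves b, it can involve no simple root of A.\<close>
    ultimately have "supp ?s \<inter> A = {}" using sp' by (auto simp: M_def)
    have zero: "rc ?s \<delta> = 0" if "\<delta> \<in> A" for \<delta>
      using that A supp_iff[OF sr, of \<delta>] \<open>supp ?s \<inter> A = {}\<close> by blast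
    have ga: "rc \<gamma> \<delta> = (if \<delta> = a then of_int ?c else 0)" if "\<delta> \<in> A" for \<delta>
      using zero[OF that] unfolding rcs by simp
    have "ip \<gamma> a = (\<Sum>\<delta>\<in>A. if \<delta> = a then of_int ?c * ip a a else 0)"
      unfolding ipA[OF a(1)] by (intro sum.cong refl) (simp add: ga)
    also have "\<dots> = of_int ?c * ip a a"
      using a A base_finite finite_subset by (subst sum.delta) auto
    \<comment> \<open>The A-part of \<gamma> is c a and the rest is orthogonal to a, so the Cartan
      integer of \<gamma> would be 2 c, while it is c by definition.\<close>
    finally have "2 * ip \<gamma> a = 2 * of_int ?c * ip a a" by simp
    then have "of_int ?c * ip a a = 2 * of_int ?c * ip a a"
      using ip_cartan_int[OF aP(2) root_weight[OF gr]] by simp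
    then show False using c root_self_inner(2)[OF aP(2)] by simp
  qed
  then have pos: "supp \<delta> \<subseteq> A \<or> supp \<delta> \<subseteq> B" if "\<delta> \<in> pos_roots" "supp \<delta> \<subseteq> A \<union> B" for \<delta>
    using that by (auto simp: M_def)
  have "supp (- \<gamma>) = supp \<gamma>"
    using supp_iff[OF g(1)] supp_iff[OF root_neg[OF g(1)]] rc_neg[OF roots_span_base[OF g(1)]] by auto
  then show ?thesis using pos[of \<gamma>] pos[of "- \<gamma>"] pos_or_neg[OF g(1)] g(2) by auto
qed

text \<open>If \<gamma> cannot be raised, it has nonnegative products with positive roots. A simple
  root \<beta> of S outside the support of \<gamma> has nonpositive products with each simple root
  in the support, so all of these are zero; the two sets of simple roots are orthogonal and split S
  unless the second one is empty.\<close>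

lemma maximal_root:
  assumes S: "standard S" and irr: "irreducible_roots S" and g: "\<gamma> \<in> S" "\<gamma> \<in> pos_roots"
    and max: "\<And>\<delta>. \<delta> \<in> S \<Longrightarrow> \<delta> \<in> pos_roots \<Longrightarrow> \<gamma> + \<delta> \<notin> weights"
  shows "\<And>\<delta>. \<delta> \<in> S \<Longrightarrow> \<delta> \<in> pos_roots \<Longrightarrow> ip \<delta> \<gamma> \<ge> 0" and "supp \<gamma> = \<Psi> \<inter> S"
proof -
  note gr = pos_root[OF g(2)]
  show dom: "ip \<delta> \<gamma> \<ge> 0" if d: "\<delta> \<in> S" "\<delta> \<in> pos_roots" for \<delta>
    using max[OF d] root_sum_if_ip_neg[OF gr pos_root[OF d(2)]] by (meson not_less)
  let ?A = "supp \<gamma>" and ?B = "\<Psi> \<inter> S - supp \<gamma>"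
  have As: "?A \<subseteq> \<Psi> \<inter> S" using standard_iff[OF S] g(1) by (auto simp: supp_def)
  have orth: "ip \<alpha> \<beta> = 0" if a: "\<alpha> \<in> ?A" and b: "\<beta> \<in> ?B" for \<alpha> \<beta>
  proof -
    have br: "\<beta> \<in> roots" "\<beta> \<in> \<Psi>" using b base_roots by auto
    have "ip \<gamma> \<beta> = (\<Sum>\<alpha>\<in>\<Psi>. rc \<gamma> \<alpha> * ip \<alpha> \<beta>)" by (rule ip_expand[OF gr root_represented[OF br(1)]])
    also have "\<dots> = (\<Sum>\<alpha>\<in>?A. rc \<gamma> \<alpha> * ip \<alpha> \<beta>)"
      using base_finite supp_iff[OF gr] by (intro sum.mono_neutral_right) auto
    finally have e: "ip \<gamma> \<beta> = (\<Sum>\<alpha>\<in>?A. rc \<gamma> \<alpha> * ip \<alpha> \<beta>)" .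
    have le: "rc \<gamma> \<alpha> * ip \<alpha> \<beta> \<le> 0" if "\<alpha> \<in> ?A" for \<alpha>
      using that b As pos_rc[OF g(2)] simple_ip_nonpos by (intro mult_nonneg_nonpos) auto
    have "ip \<gamma> \<beta> \<ge> 0" using dom[of \<beta>] b simple_pos ip_root_sym[OF gr br(1)] by auto
    then have "(\<Sum>\<alpha>\<in>?A. - (rc \<gamma> \<alpha> * ip \<alpha> \<beta>)) = 0"
      using e sum_nonpos[of ?A "\<lambda>\<alpha>. rc \<gamma> \<alpha> * ip \<alpha> \<beta>"] le by (simp add: sum_negf)
    moreover have "finite ?A" using As base_finite finite_subset by blast
    ultimately have "rc \<gamma> \<alpha> * ip \<alpha> \<beta> = 0"
      using a le by (subst (asm) sum_nonneg_eq_0_iff) auto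
    then show ?thesis using a supp_iff[OF gr] by simp
  qed
  have split: "supp \<delta> \<subseteq> ?A \<or> supp \<delta> \<subseteq> ?B" if "\<delta> \<in> S" for \<delta>
    by (rule orthogonal_simple_split[OF _ _ _ orth])
       (use As that standard_iff[OF S] in \<open>auto simp: supp_def\<close>)
  show "?A = \<Psi> \<inter> S"
  proof (rule ccontr)
    assume "?A \<noteq> \<Psi> \<inter> S"
    then obtain b where b: "b \<in> ?B" using As by auto
    let ?P = "{\<delta> \<in> S. supp \<delta> \<subseteq> ?A}"
    let ?Q = "S - ?P"
    have "\<gamma> \<in> ?P" using g by simp
    moreover have "b \<in> ?Q" using b supp_simple by auto
    moreover have "root_inner \<delta> \<epsilon> = 0" if d: "\<delta> \<in> ?P" and e: "\<epsilon> \<in> ?Q" for \<delta> \<epsilon>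
    proof -
      have dr: "\<delta> \<in> roots" and er: "\<epsilon> \<in> roots" using d e standard_root[OF S] by auto
      have es: "supp \<epsilon> \<subseteq> ?B" using e split by blast
      have z: "ip \<alpha> \<epsilon> = 0" if "\<alpha> \<in> supp \<delta>" for \<alpha>
      proof -
        have ar: "\<alpha> \<in> roots" using that base_roots by (auto simp: supp_def)
        have "ip \<epsilon> \<alpha> = (\<Sum>\<beta>\<in>\<Psi>. rc \<epsilon> \<beta> * ip \<beta> \<alpha>)" by (rule ip_expand[OF er root_represented[OF ar]])
        also have "\<dots> = 0"
        proof (rule sum.neutral, intro ballI)
          fix \<beta> assume b: "\<beta> \<in> \<Psi>"
          have "ip \<beta> \<alpha> = 0" if "\<beta> \<in> supp \<epsilon>"
          proof -
            have "\<alpha> \<in> ?A" "\<beta> \<in> ?B" "\<beta> \<in> roots" using \<open>\<alpha> \<in> supp \<delta>\<close> d that es b base_roots by blast+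
            then show ?thesis using orth[of \<alpha> \<beta>] ip_root_sym[OF ar, of \<beta>] by simp
          qed
          then show "rc \<epsilon> \<beta> * ip \<beta> \<alpha> = 0" using b supp_iff[OF er] by auto
        qed
        finally show ?thesis using ip_root_sym[OF ar er] by simp
      qed
      have "ip \<delta> \<epsilon> = (\<Sum>\<beta>\<in>\<Psi>. rc \<delta> \<beta> * ip \<beta> \<epsilon>)" by (rule ip_expand[OF dr root_represented[OF er]])
      also have "\<dots> = 0" using z supp_iff[OF dr] by (intro sum.neutral) auto
      finally show ?thesis using root_inner_zero_iff[OF er root_weight[OF dr]] by simp
    qed
    moreover have "?P \<union> ?Q = S" "?P \<inter> ?Q = {}" by auto
    ultimately have "\<exists>A B. A \<noteq> {} \<and> B \<noteq> {} \<and> A \<union> B = S \<and> A \<inter> B = {} \<and>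
        (\<forall>\<gamma>\<in>A. \<forall>\<delta>\<in>B. root_inner \<gamma> \<delta> = 0)"
      by (intro exI[of _ ?P] exI[of _ ?Q]) (simp only: empty_iff not_False_eq_True, blast)
    then show False using irr unfolding irreducible_roots_def by simp
  qed
qed

text \<open>Some simple root of S has positive product with the dominant \<beta>, and \<gamma> has
  full support, so (\<gamma>, \<beta>) > 0. If \<gamma> \<noteq> \<beta>, then \<gamma> - \<beta> is
  a root, and it or its negative raises one of the two.\<close>

lemma maximal_root_unique:
  assumes S: "standard S" and irr: "irreducible_roots S"
    and g: "\<gamma> \<in> S" "\<gamma> \<in> pos_roots" "\<And>\<delta>. \<delta> \<in> S \<Longrightarrow> \<delta> \<in> pos_roots \<Longrightarrow> \<gamma> + \<delta> \<notin> weights"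
    and b: "\<beta> \<in> S" "\<beta> \<in> pos_roots" "\<And>\<delta>. \<delta> \<in> S \<Longrightarrow> \<delta> \<in> pos_roots \<Longrightarrow> \<beta> + \<delta> \<notin> weights"
  shows "\<gamma> = \<beta>"
proof (rule ccontr)
  assume ne: "\<gamma> \<noteq> \<beta>"
  note gr = pos_root[OF g(2)] and br = pos_root[OF b(2)]
  note gmr = maximal_root[OF S irr g] and bmr = maximal_root[OF S irr b]
  have bpos: "ip \<alpha> \<beta> \<ge> 0" if "\<alpha> \<in> \<Psi> \<inter> S" for \<alpha> using bmr(1) simple_pos that by blast
  have "ip \<beta> \<beta> = (\<Sum>\<alpha>\<in>\<Psi> \<inter> S. rc \<beta> \<alpha> * ip \<alpha> \<beta>)"
    by (rule ip_expand_standard[OF S b(1) root_represented[OF br]])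
  then obtain \<alpha> where a: "\<alpha> \<in> \<Psi> \<inter> S" "rc \<beta> \<alpha> * ip \<alpha> \<beta> \<noteq> 0"
    using root_self_inner(2)[OF br] sum.neutral[of "\<Psi> \<inter> S" "\<lambda>\<alpha>. rc \<beta> \<alpha> * ip \<alpha> \<beta>"]
    by (metis (no_types, lifting) less_irrefl)
  have "rc \<gamma> \<alpha> \<noteq> 0" "rc \<gamma> \<alpha> \<ge> 0"
    using a(1) gmr(2) supp_iff[OF gr, of \<alpha>] pos_rc[OF g(2), of \<alpha>] by blast+
  then have "rc \<gamma> \<alpha> > 0" by simp
  then have "0 < rc \<gamma> \<alpha> * ip \<alpha> \<beta>" using a bpos[of \<alpha>] by (simp add: less_eq_real_def)
  also have "\<dots> \<le> (\<Sum>\<alpha>\<in>\<Psi> \<inter> S. rc \<gamma> \<alpha> * ip \<alpha> \<beta>)"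
    by (rule member_le_sum[OF a(1)]) (use base_finite pos_rc[OF g(2)] bpos in auto)
  also have "\<dots> = ip \<gamma> \<beta>"
    by (rule ip_expand_standard[OF S g(1) root_represented[OF br], symmetric])
  finally have "\<gamma> - \<beta> \<in> weights" by (rule root_diff_if_ip_pos[OF br gr])
  then have dr: "\<gamma> - \<beta> \<in> roots" using ne by (simp add: weights_def)
  then have dS: "\<gamma> - \<beta> \<in> S"
    using standard_add[OF S g(1) standard_neg[OF S b(1)]] by simp
  from pos_or_neg[OF dr] show False
  proof
    assume "\<gamma> - \<beta> \<in> pos_roots"
    then show False using b(3)[OF dS] root_weight[OF gr] by simp
  next
    assume "- (\<gamma> - \<beta>) \<in> pos_roots"
    then show False using g(3)[OF standard_neg[OF S dS]] root_weight[OF br] by simp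
  qed
qed

text \<open>A root of greatest height cannot be raised. Any positive root can be raised until it is
  maximal, and by uniqueness it then is this root.\<close>

lemma highest_root_exists:
  assumes S: "standard S" and irr: "irreducible_roots S"
  shows "\<exists>\<beta>. is_highest_root S \<beta>"
proof -
  have ne: "S \<noteq> {}" using irr by (simp add: irreducible_roots_def)
  define \<beta> where "\<beta> = arg_min_on (\<lambda>\<gamma>. - ht \<gamma>) S"
  have bS: "\<beta> \<in> S" and bmax: "\<And>\<delta>. \<delta> \<in> S \<Longrightarrow> ht \<delta> \<le> ht \<beta>"
    using arg_min_if_finite[OF standard_finite[OF S] ne, of "\<lambda>\<gamma>. - ht \<gamma>"] unfolding \<beta>_def by (auto simp: not_less)
  note br = standard_root[OF S bS]
  have bp: "\<beta> \<in> pos_roots"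
  proof (rule ccontr)
    assume "\<beta> \<notin> pos_roots"
    then have "- \<beta> \<in> pos_roots" using pos_or_neg br by blast
    then have "ht (- \<beta>) \<ge> 1" by (rule ht_pos)
    then show False using bmax[OF standard_neg[OF S bS]] ht_neg[OF roots_span_base[OF br]] by simp
  qed
  have add: "\<gamma> + \<delta> \<in> S" "ht \<gamma> + 1 \<le> ht (\<gamma> + \<delta>)" "\<gamma> + \<delta> \<in> pos_roots"
    if "\<gamma> \<in> S" "\<gamma> \<in> pos_roots" "\<delta> \<in> S" "\<delta> \<in> pos_roots" "\<gamma> + \<delta> \<in> weights" for \<gamma> \<delta>
  proof -
    show p: "\<gamma> + \<delta> \<in> pos_roots" using pos_add_root that by blast
    then show "\<gamma> + \<delta> \<in> S" using standard_add[OF S] that pos_root by blast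
    show "ht \<gamma> + 1 \<le> ht (\<gamma> + \<delta>)"
      using ht_pos[OF that(4)] ht_add[OF roots_span_base roots_span_base] that pos_root by simp
  qed
  have bm: "\<beta> + \<delta> \<notin> weights" if "\<delta> \<in> S" "\<delta> \<in> pos_roots" for \<delta>
    using add[OF bS bp that] bmax by force
  have up: "\<exists>\<delta>s. set \<delta>s \<subseteq> S \<inter> pos_roots \<and> \<beta> = \<gamma> + sum_list \<delta>s"
    if "\<gamma> \<in> S" "\<gamma> \<in> pos_roots" for \<gamma>
    using that
  \<comment> \<open>Heights are real numbers; each raising increases them by at least 1, so the
    rounded-up distance to the top decreases.\<close>
  proof (induction "nat \<lceil>ht \<beta> - ht \<gamma>\<rceil>" arbitrary: \<gamma> rule: less_induct)
    case less
    show ?case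
    proof (cases "\<exists>\<delta>\<in>S. \<delta> \<in> pos_roots \<and> \<gamma> + \<delta> \<in> weights")
      case True
      then obtain \<delta> where d: "\<delta> \<in> S" "\<delta> \<in> pos_roots" "\<gamma> + \<delta> \<in> weights" by blast
      note a = add[OF less.prems d]
      have "ht (\<gamma> + \<delta>) \<le> ht \<beta>" using bmax a(1) by blast
      then have "nat \<lceil>ht \<beta> - ht (\<gamma> + \<delta>)\<rceil> < nat \<lceil>ht \<beta> - ht \<gamma>\<rceil>" using a(2) by linarith
      from less.hyps[OF this a(1,3)] obtain \<delta>s where
        "set \<delta>s \<subseteq> S \<inter> pos_roots" "\<beta> = \<gamma> + \<delta> + sum_list \<delta>s" by blast
      then show ?thesis using d by (intro exI[of _ "\<delta> # \<delta>s"]) (auto simp: add.assoc)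
    next
      case False
      then have "\<gamma> = \<beta>" using maximal_root_unique[OF S irr less.prems _ bS bp bm] by blast
      then show ?thesis by (intro exI[of _ "[]"]) simp
    qed
  qed
  have "\<exists>\<delta>s. set \<delta>s \<subseteq> S \<inter> pos_roots \<and> \<beta> = \<gamma> + sum_list \<delta>s" if g: "\<gamma> \<in> S" for \<gamma>
  proof (cases "\<gamma> \<in> pos_roots")
    case True then show ?thesis using up g by blast
  next
    case False
    then have "- \<gamma> \<in> pos_roots" using pos_or_neg standard_root[OF S g] by blast
    \<comment> \<open>For negative \<gamma> one climbs through zero: \<beta> = \<gamma> +
      (-\<gamma>) + \<beta>.\<close>
    then show ?thesis using bS bp standard_neg[OF S g] by (intro exI[of _ "[- \<gamma>, \<beta>]"]) auto
  qed
  then show ?thesis using bS unfolding is_highest_root_def by blast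
qed

text \<open>Let \<mu> be the part of \<gamma> in C over the simple roots of its support outside C.
  Those roots are orthogonal to \<gamma> and to the remaining part of \<gamma>, hence to \<mu>; so
  (\<mu>, \<mu>) = 0 and \<mu> = 0. Conversely, a root of X outside C with support in C would be
  orthogonal to itself.\<close>

lemma component_standard:
  assumes X: "standard X" and C: "irreducible_component X C"
  shows "standard C"
proof -
  have CX: "C \<subseteq> X" and orth: "\<And>\<gamma> \<delta>. \<gamma> \<in> C \<Longrightarrow> \<delta> \<in> X - C \<Longrightarrow> root_inner \<gamma> \<delta> = 0"
    using C by (auto simp: irreducible_component_def)
  have Cr: "\<gamma> \<in> roots" if "\<gamma> \<in> C" for \<gamma> using that CX standard_root[OF X] by blast
  have orth': "ip \<gamma> \<delta> = 0" if "\<gamma> \<in> C" "\<delta> \<in> X" "\<delta> \<notin> C" for \<gamma> \<delta>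
    using orth[of \<gamma> \<delta>] that root_inner_zero_iff[OF standard_root[OF X that(2)] root_weight[OF Cr[OF that(1)]]] by simp
  have "supp \<gamma> \<subseteq> C" if g: "\<gamma> \<in> C" for \<gamma>
  proof -
    let ?D = "supp \<gamma> - C"
    note gr = Cr[OF g]
    define \<mu> where "\<mu> = (\<Sum>\<alpha>\<in>?D. fscale (of_real (rc \<gamma> \<alpha>)) \<alpha>)"
    have sX: "supp \<gamma> \<subseteq> X" using g CX standard_iff[OF X] by blast
    have Dr: "\<alpha> \<in> roots" "\<alpha> \<in> \<Psi>" "represented \<alpha>" if "\<alpha> \<in> ?D" for \<alpha>
      using that base_roots root_represented by (auto simp: supp_def)
    have mr: "represented \<mu>" unfolding \<mu>_def by (rule represented_combination) (rule Dr(3))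
    have mip: "ip \<mu> \<delta> = (\<Sum>\<alpha>\<in>?D. rc \<gamma> \<alpha> * ip \<alpha> \<delta>)" if "represented \<delta>" for \<delta>
      unfolding \<mu>_def by (rule ip_combination[OF _ that]) (rule Dr(3))
    have gD: "ip \<gamma> \<alpha> = 0" if "\<alpha> \<in> ?D" for \<alpha> using orth'[OF g, of \<alpha>] that sX by blast
    have muD: "ip \<mu> \<alpha> = 0" if a: "\<alpha> \<in> ?D" for \<alpha>
    proof -
      have "0 = (\<Sum>\<delta>\<in>\<Psi>. rc \<gamma> \<delta> * ip \<delta> \<alpha>)" using ip_expand[OF gr Dr(3)[OF a]] gD[OF a] by simp
      also have "\<dots> = (\<Sum>\<delta>\<in>?D. rc \<gamma> \<delta> * ip \<delta> \<alpha>)"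
      proof (rule sum.mono_neutral_right[OF base_finite])
        show "\<forall>\<delta>\<in>\<Psi> - ?D. rc \<gamma> \<delta> * ip \<delta> \<alpha> = 0"
          using supp_iff[OF gr] orth'[of _ \<alpha>] a sX by auto
      qed (auto simp: supp_def)
      also have "\<dots> = ip \<mu> \<alpha>"
        by (rule mip[OF Dr(3)[OF a], symmetric])
      finally show ?thesis by simp
    qed
    have "ip \<mu> \<mu> = (\<Sum>\<alpha>\<in>?D. rc \<gamma> \<alpha> * ip \<alpha> \<mu>)" by (rule mip[OF mr])
    also have "\<dots> = (\<Sum>\<alpha>\<in>?D. 0)"
      using muD ip_sym[OF mr Dr(3)] by (intro sum.cong refl) simp
    finally have "\<mu> = 0" using ip_definite(2)[OF Dr(1) \<mu>_def] by simp
    have "rc \<gamma> \<alpha> = 0" if a: "\<alpha> \<in> ?D" for \<alpha>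
    proof -
      have "rc \<mu> \<alpha> = rc \<gamma> \<alpha>"
        unfolding \<mu>_def using Dr(2) a by (subst rc_combination) auto
      then show ?thesis using \<open>\<mu> = 0\<close> rc_zero by simp
    qed
    then show ?thesis using supp_iff[OF gr] by blast
  qed
  moreover have "\<gamma> \<in> C" if g: "\<gamma> \<in> roots" "supp \<gamma> \<subseteq> C" for \<gamma>
  proof (rule ccontr)
    assume no: "\<gamma> \<notin> C"
    have gX: "\<gamma> \<in> X" using standard_iff[OF X] g CX by blast
    have "ip \<gamma> \<gamma> = (\<Sum>\<alpha>\<in>\<Psi>. rc \<gamma> \<alpha> * ip \<alpha> \<gamma>)" by (rule ip_expand[OF g(1) root_represented[OF g(1)]])
    also have "\<dots> = 0" using supp_iff[OF g(1)] orth'[OF _ gX no] g(2) by (intro sum.neutral) auto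
    finally show False using root_self_inner(2)[OF g(1)] by simp
  qed
  ultimately show ?thesis unfolding standard_def using Cr by blast
qed

text \<open>Take the smallest set containing \<gamma> and orthogonal to its complement in X. If it
  split into orthogonal halves, the half containing \<gamma> would be a smaller such set.\<close>

lemma component_exists:
  assumes X: "X \<subseteq> roots" and g: "\<gamma> \<in> X"
  shows "\<exists>C. irreducible_component X C \<and> \<gamma> \<in> C"
proof -
  let ?P = "\<lambda>C. C \<subseteq> X \<and> \<gamma> \<in> C \<and> (\<forall>\<delta>\<in>C. \<forall>\<epsilon>\<in>X - C. root_inner \<delta> \<epsilon> = 0)"
  have "?P X" using g by auto
  define C where "C = arg_min card ?P"
  have C: "?P C" and min: "\<And>D. ?P D \<Longrightarrow> card C \<le> card D"
    using arg_min_nat_lemma[of ?P X card] \<open>?P X\<close> unfolding C_def by blast+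
  have fin: "finite C" using C X roots_finite finite_subset by (metis order_trans)
  have no: False if AB: "A \<noteq> {}" "B \<noteq> {}" "A \<union> B = C" "A \<inter> B = {}"
    and orth: "\<forall>\<gamma>\<in>A. \<forall>\<delta>\<in>B. root_inner \<gamma> \<delta> = 0" and gA: "\<gamma> \<in> A" for A B
  proof -
    have "?P A" using C orth gA AB by blast
    then have "card C \<le> card A" by (rule min)
    moreover have "A \<subset> C" using AB by blast
    then have "card A < card C" by (rule psubset_card_mono[OF fin])
    ultimately show False by simp
  qed
  have "irreducible_roots C"
    unfolding irreducible_roots_def
  proof (intro conjI notI)
    assume "\<exists>A B. A \<noteq> {} \<and> B \<noteq> {} \<and> A \<union> B = C \<and> A \<inter> B = {} \<and> (\<forall>\<gamma>\<in>A. \<forall>\<delta>\<in>B. root_inner \<gamma> \<delta> = 0)"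
    then obtain A B where AB: "A \<noteq> {}" "B \<noteq> {}" "A \<union> B = C" "A \<inter> B = {}"
      and orth: "\<forall>\<gamma>\<in>A. \<forall>\<delta>\<in>B. root_inner \<gamma> \<delta> = 0" by blast
    have "C \<subseteq> roots" using C X by blast
    then have orth': "\<forall>\<gamma>\<in>B. \<forall>\<delta>\<in>A. root_inner \<gamma> \<delta> = 0"
      using orth root_inner_sym root_represented AB by (metis UnI1 UnI2 subsetD)
    show False
    proof (cases "\<gamma> \<in> A")
      case True then show False using no[OF AB orth] by blast
    next
      case False then show False using no[of B A] AB orth' C by blast
    qed
  qed (use C in auto)
  then show ?thesis using C by (auto simp: irreducible_component_def)
qed

section \<open>Irreducibility of the root system\<close>

lemma roots_standard: "standard roots"
  unfolding standard_def using base_roots by (auto simp: supp_def)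

text \<open>The root spaces of an orthogonal summand of the root system generate a proper ideal.\<close>
lemma roots_irreducible: "irreducible_roots roots"
  unfolding irreducible_roots_def
proof (intro conjI notI)
  assume "\<exists>A B. A \<noteq> {} \<and> B \<noteq> {} \<and> A \<union> B = roots \<and> A \<inter> B = {} \<and> (\<forall>\<gamma>\<in>A. \<forall>\<delta>\<in>B. root_inner \<gamma> \<delta> = 0)"
  then obtain A B where AB: "A \<noteq> {}" "B \<noteq> {}" "A \<union> B = roots"
    and orth': "\<forall>\<gamma>\<in>A. \<forall>\<delta>\<in>B. root_inner \<gamma> \<delta> = 0" by blast
  note orth = orth'[rule_format]
  have Ar: "\<alpha> \<in> roots" "represented \<alpha>" if "\<alpha> \<in> A" for \<alpha> using that AB root_represented by auto
  have Br: "\<beta> \<in> roots" "represented \<beta>" if "\<beta> \<in> B" for \<beta> using that AB root_represented by auto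
  have tin: "dual_vector \<alpha> \<in> \<tt>" if "represented \<alpha>" for \<alpha> using that by (simp add: represented_def)
  \<comment> \<open>The dual vectors are included because they arise as brackets of opposite root
    vectors.\<close>
  define I where "I = cmat.span ((\<Union>\<alpha>\<in>A. root_space \<alpha>) \<union> dual_vector ` A)"
  have Ibase: "x \<in> I" if "\<alpha> \<in> A" "x \<in> root_space \<alpha> \<or> x = dual_vector \<alpha>" for x \<alpha>
    unfolding I_def using that by (intro cmat.span_base) auto
  have Isub: "cmat.subspace I" by (simp add: I_def)
  have Igg: "I \<subseteq> \<gg>" unfolding I_def
    by (rule cmat.span_minimal[OF _ \<gg>_subspace]) (use root_space_in_\<gg> tin Ar \<tt>_in_\<gg> in blast)
  \<comment> \<open>The sum of \<alpha> and \<beta> would be orthogonal to neither of them, so as a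
    root it could lie in neither A nor B.\<close>
  have ab: "\<lbrakk>x, y\<rbrakk> = 0" if a: "\<alpha> \<in> A" "y \<in> root_space \<alpha>" and b: "\<beta> \<in> B" "x \<in> root_space \<beta>" for \<alpha> \<beta> x y
  proof -
    have z: "root_inner \<alpha> \<beta> = 0" "root_inner \<beta> \<alpha> = 0"
      using orth[OF a(1) b(1)] root_inner_sym[OF Ar(2)[OF a(1)] Br(2)[OF b(1)]] by auto
    have sa: "root_inner (\<beta> + \<alpha>) \<alpha> \<noteq> 0" and sb: "root_inner (\<beta> + \<alpha>) \<beta> \<noteq> 0"
      using z root_inner_add_left Ar[OF a(1)] Br[OF b(1)] root_self_inner_nonzero by auto
    have "\<beta> + \<alpha> \<notin> weights"
    proof
      assume w: "\<beta> + \<alpha> \<in> weights"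
      have "\<beta> + \<alpha> \<noteq> 0"
        using sa root_inner_scale_left[OF represented_zero Ar(2)[OF a(1)], of 0] by auto
      then have "\<beta> + \<alpha> \<in> A \<or> \<beta> + \<alpha> \<in> B" using w AB by (auto simp: weights_def)
      then show False
      proof
        assume "\<beta> + \<alpha> \<in> A" then show False using orth[OF _ b(1)] sb by blast
      next
        assume B: "\<beta> + \<alpha> \<in> B"
        then show False using orth[OF a(1) B] sa root_inner_sym[OF Ar(2)[OF a(1)] Br(2)[OF B]] by simp
      qed
    qed
    then show ?thesis
      using root_space_eq_zero[OF dual_closed(2)[OF root_dual[OF Br(1)[OF b(1)]] root_dual[OF Ar(1)[OF a(1)]]]]
        root_space_bracket[OF b(2) a(2)] by blast
  qed
  have tb: "\<lbrakk>dual_vector \<alpha>, x\<rbrakk> = mscale (root_inner \<beta> \<alpha>) x"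
    if "represented \<alpha>" "represented \<beta>" "x \<in> root_space \<beta>" for \<alpha> \<beta> x
    using root_space_eigen[OF that(3) tin[OF that(1)]] root_inner_eval[OF that(2,1)] by simp
  have ad: "\<lbrakk>x, y\<rbrakk> \<in> I" if x: "\<gamma> \<in> weights" "x \<in> root_space \<gamma>"
    and y: "y \<in> (\<Union>\<alpha>\<in>A. root_space \<alpha>) \<union> dual_vector ` A" for \<gamma> x y
  proof -
    obtain \<alpha> where a: "\<alpha> \<in> A" "y \<in> root_space \<alpha> \<or> y = dual_vector \<alpha>" using y by auto
    show ?thesis
    proof (cases "y \<in> root_space \<alpha>")
      case False
      then have yt: "y = dual_vector \<alpha>" using a by auto
      consider "\<gamma> = 0" | "\<gamma> \<in> A" | "\<gamma> \<in> B" using x AB by (auto simp: weights_def)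
      then show ?thesis
      proof cases
        case 1
        then have "\<lbrakk>x, y\<rbrakk> = 0" using \<tt>_abelian x tin Ar a yt root_space_zero by simp
        then show ?thesis using Isub cmat.subspace_0 by simp
      next
        case 2
        have "\<lbrakk>x, y\<rbrakk> = mscale (- root_inner \<gamma> \<alpha>) x"
          using tb[OF Ar(2)[OF a(1)] Ar(2)[OF 2] x(2)] yt lie_bracket_antisym[of x y] by simp
        then show ?thesis using Ibase[OF 2] x(2) cmat.subspace_scale[OF Isub] cmat.subspace_neg[OF Isub] by simp
      next
        case 3
        have "\<lbrakk>x, y\<rbrakk> = mscale (- root_inner \<gamma> \<alpha>) x"
          using tb[OF Ar(2)[OF a(1)] Br(2)[OF 3] x(2)] yt lie_bracket_antisym[of x y] by simp
        also have "root_inner \<gamma> \<alpha> = 0"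
          using orth[OF a(1) 3] root_inner_sym[OF Ar(2)[OF a(1)] Br(2)[OF 3]] by simp
        finally show ?thesis using Isub cmat.subspace_0 by simp
      qed
    next
      case True
      consider "\<gamma> = 0" | "\<gamma> \<in> A" | "\<gamma> \<in> B" using x AB by (auto simp: weights_def)
      then show ?thesis
      proof cases
        case 1
        then have "\<lbrakk>x, y\<rbrakk> = mscale (\<alpha> x) y" using root_space_eigen[OF True] x root_space_zero by simp
        then show ?thesis using Ibase[OF a(1)] True cmat.subspace_scale[OF Isub] by simp
      next
        case 3
        then have "\<lbrakk>x, y\<rbrakk> = 0" using ab[OF a(1) True 3 x(2)] by simp
        then show ?thesis using Isub cmat.subspace_0 by simp
      next
        case 2
        note br = root_space_bracket[OF x(2) True]
        show ?thesis
        proof (cases "\<gamma> + \<alpha> = 0")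
          case t: True
          then have "\<alpha> = - \<gamma>" by (simp add: eq_neg_iff_add_eq_0 add.commute)
          then have "\<lbrakk>x, y\<rbrakk> = mscale (\<kappa> x y) (dual_vector \<gamma>)"
            using bracket_eq_dual_vector[OF Ar(1)[OF 2] x(2)] True by simp
          then show ?thesis using Ibase[OF 2] cmat.subspace_scale[OF Isub] by simp
        next
          case ne: False
          show ?thesis
          proof (cases "\<gamma> + \<alpha> \<in> weights")
            case False
            then have "\<lbrakk>x, y\<rbrakk> = 0"
              using root_space_eq_zero[OF dual_closed(2)[OF root_dual[OF Ar(1)[OF 2]] root_dual[OF Ar(1)[OF a(1)]]]] br by blast
            then show ?thesis using Isub cmat.subspace_0 by simp
          next
            case True
            then have "\<gamma> + \<alpha> \<in> A \<or> \<gamma> + \<alpha> \<in> B" using ne AB by (auto simp: weights_def)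
            moreover have False if B: "\<gamma> + \<alpha> \<in> B"
            proof -
              have "root_inner (\<gamma> + \<alpha>) (\<gamma> + \<alpha>) = root_inner \<gamma> (\<gamma> + \<alpha>) + root_inner \<alpha> (\<gamma> + \<alpha>)"
                using root_inner_add_left Ar 2 a(1) Br(2)[OF B] by simp
              then show False using orth[OF 2 B] orth[OF a(1) B] root_self_inner_nonzero[OF Br(1)[OF B]] by simp
            qed
            ultimately show ?thesis using Ibase br by blast
          qed
        qed
      qed
    qed
  qed
  have "lie_ideal \<gg> I"
    unfolding lie_ideal_def
  proof (intro conjI ballI Isub Igg)
    fix x y assume "x \<in> \<gg>" "y \<in> I"
    then have "x \<in> cmat.span (\<Union>\<gamma>\<in>weights. root_space \<gamma>)"
      "y \<in> cmat.span ((\<Union>\<alpha>\<in>A. root_space \<alpha>) \<union> dual_vector ` A)"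
      using weight_root_vectors_span I_def by blast+
    then show "\<lbrakk>x, y\<rbrakk> \<in> I"
      by (rule bracket_in_span[OF _ _ Isub]) (use ad in blast)
  qed
  then have "I = {0} \<or> I = \<gg>" by (rule ideal_cases)
  moreover have "I \<noteq> {0}"
  proof -
    obtain \<alpha> where a: "\<alpha> \<in> A" using AB(1) by blast
    obtain x where "x \<in> root_space \<alpha>" "x \<noteq> 0" using root_vector[OF Ar(1)[OF a]] by blast
    then show ?thesis using Ibase[OF a, of x] by blast
  qed
  ultimately have Ig: "I = \<gg>" by blast
  obtain \<beta> where b: "\<beta> \<in> B" using AB by auto
  obtain x where x: "x \<in> root_space \<beta>" "x \<noteq> 0" using root_vector Br b by blast
  \<comment> \<open>The dual vector of \<beta> in B commutes with all generators of I. If I is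
    everything, it also kills its own root vector, on which it acts as (\<beta>, \<beta>).\<close>
  have "\<lbrakk>dual_vector \<beta>, x\<rbrakk> = 0"
  proof (rule bracket_in_span[of "dual_vector \<beta>" "{dual_vector \<beta>}" x _ "{0}", simplified])
    show "x \<in> cmat.span ((\<Union>\<alpha>\<in>A. root_space \<alpha>) \<union> dual_vector ` A)"
      using Ig root_space_in_\<gg>[OF x(1)] I_def by simp
    show "\<lbrakk>dual_vector \<beta>, y\<rbrakk> = 0" if y: "y \<in> (\<Union>\<alpha>\<in>A. root_space \<alpha>) \<union> dual_vector ` A" for y
    proof -
      obtain \<alpha> where a: "\<alpha> \<in> A" "y \<in> root_space \<alpha> \<or> y = dual_vector \<alpha>" using y by auto
      then show ?thesis
        using tb[OF Br(2)[OF b] Ar(2)[OF a(1)]] orth[OF a(1) b] \<tt>_abelian tin Br(2)[OF b] Ar(2)[OF a(1)] by auto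
    qed
  qed (auto simp: cmat.span_base)
  then have "mscale (root_inner \<beta> \<beta>) x = 0" using tb[OF Br(2)[OF b] Br(2)[OF b] x(1)] by simp
  then show False using x root_self_inner_nonzero[OF Br(1)[OF b]] by simp
qed (use roots_nonempty in blast)

section \<open>The Kostant cascade\<close>

lemma cascade_system_irreducible: "S \<in> cascade_systems \<Longrightarrow> irreducible_roots S"
  by (induction rule: cascade_systems.induct) (auto simp: roots_irreducible irreducible_component_def)

lemma cascade_system_standard: "S \<in> cascade_systems \<Longrightarrow> standard S"
proof (induction rule: cascade_systems.induct)
  case whole show ?case by (rule roots_standard)
next
  case (descend S \<beta> C)
  show ?case by (rule component_standard[OF orthogonal_standard[OF descend.IH descend.hyps(2)] descend.hyps(3)])
qed

lemma cascade_system_highest: "S \<in> cascade_systems \<Longrightarrow> \<exists>\<beta>. is_highest_root S \<beta>"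
  using highest_root_exists cascade_system_irreducible cascade_system_standard by blast

text \<open>Quantifying over \<beta> makes this a function of S alone; a standard S has at most one
  highest root.\<close>

definition orth_part :: "'n functional set \<Rightarrow> 'n functional set" where
  "orth_part S = {\<gamma> \<in> S. \<forall>\<beta>. is_highest_root S \<beta> \<longrightarrow> root_inner \<gamma> \<beta> = 0}"

lemma orth_part_eq: "standard S \<Longrightarrow> is_highest_root S \<beta> \<Longrightarrow> orth_part S = {\<gamma> \<in> S. root_inner \<gamma> \<beta> = 0}"
  using highest_unique by (auto simp: orth_part_def)

text \<open>Otherwise the parts of D inside and outside C would be an orthogonal splitting of
  D.\<close>

lemma irreducible_in_component:
  assumes X: "X \<subseteq> roots" and C: "irreducible_component X C" and D: "irreducible_roots D" "D \<subseteq> X" "D \<inter> C \<noteq> {}"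
  shows "D \<subseteq> C"
proof (rule ccontr)
  assume "\<not> D \<subseteq> C"
  then have "D - C \<noteq> {}" by auto
  moreover have "\<forall>\<gamma>\<in>D \<inter> C. \<forall>\<delta>\<in>D - C. root_inner \<gamma> \<delta> = 0"
    using C D by (auto simp: irreducible_component_def)
  moreover have "(D \<inter> C) \<union> (D - C) = D" "(D \<inter> C) \<inter> (D - C) = {}" by auto
  ultimately show False using D unfolding irreducible_roots_def by metis
qed

text \<open>The cascade systems form a tree under inclusion. The statement is symmetric but the
  generation is not, so two inductions are nested: the outer one over the first system, the inner
  one over the second with the first fixed.\<close>

lemma cascade_systems_nested:
  assumes "S \<in> cascade_systems" "S' \<in> cascade_systems" "S \<inter> S' \<noteq> {}"
  shows "S = S' \<or> S \<subseteq> orth_part S' \<or> S' \<subseteq> orth_part S"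
  using assms
proof (induction arbitrary: S' rule: cascade_systems.induct)
  case whole
  from whole(1) show ?case
  proof (induction rule: cascade_systems.induct)
    case (descend S' \<beta> C)
    have e: "orth_part S' = {\<gamma> \<in> S'. root_inner \<gamma> \<beta> = 0}"
      by (rule orth_part_eq[OF cascade_system_standard[OF descend.hyps(1)] descend.hyps(2)])
    have "C \<subseteq> orth_part S'" using descend.hyps(3) by (auto simp: e irreducible_component_def)
    moreover have "\<not> roots \<subseteq> orth_part S'"
      using highest_root[OF cascade_system_standard[OF descend.hyps(1)] descend.hyps(2)] root_self_inner_nonzero
      by (auto simp: e)
    moreover have "orth_part T \<subseteq> T" for T by (auto simp: orth_part_def)
    ultimately show ?case using descend.IH by blast
  qed simp
next
  case (descend S \<beta> C)
  have e: "orth_part S = {\<gamma> \<in> S. root_inner \<gamma> \<beta> = 0}"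
    by (rule orth_part_eq[OF cascade_system_standard[OF descend.hyps(1)] descend.hyps(2)])
  have CS: "C \<subseteq> orth_part S" using descend.hyps(3) by (auto simp: e irreducible_component_def)
  have oS: "orth_part T \<subseteq> T" for T by (auto simp: orth_part_def)
  have oR: "orth_part T \<subseteq> roots" if "T \<in> cascade_systems" for T
    using standard_root[OF cascade_system_standard[OF that]] oS by blast
  have compC: "irreducible_component (orth_part S) C" using descend.hyps(3) by (simp add: e)
  have Ccas: "C \<in> cascade_systems" using cascade_systems.descend descend.hyps by blast
  note IH0 = descend.IH and hyps0 = descend.hyps
  \<comment> \<open>The outer induction yields only S' \<subseteq> C in the last case; the inner
    induction sharpens this to \<open>S' \<subseteq> orth_part C\<close>.\<close>
  have three: "C = S' \<or> C \<subseteq> orth_part S' \<or> S' \<subseteq> C" if S': "S' \<in> cascade_systems" "C \<inter> S' \<noteq> {}" for S'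
  proof -
    have "S \<inter> S' \<noteq> {}" using CS oS S' by blast
    from IH0[OF S'(1) this] consider "S = S'" | "S \<subseteq> orth_part S'" | "S' \<subseteq> orth_part S" by blast
    then show ?thesis
    proof cases
      case 1 then show ?thesis using CS by blast
    next
      case 2 then show ?thesis using CS oS by blast
    next
      case 3
      then show ?thesis
        using irreducible_in_component[OF oR[OF hyps0(1)] compC cascade_system_irreducible[OF S'(1)] 3] S'(2)
        by blast
    qed
  qed
  from descend.prems show ?case
  proof (induction rule: cascade_systems.induct)
    case whole
    then show ?case using three[OF cascade_systems.whole] standard_root[OF cascade_system_standard[OF Ccas]] by blast
  next
    case (descend T \<delta> D)
    note T = descend
    have eT: "orth_part T = {\<gamma> \<in> T. root_inner \<gamma> \<delta> = 0}"
      by (rule orth_part_eq[OF cascade_system_standard[OF T(1)] T(2)])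
    have compD: "irreducible_component (orth_part T) D" using T(3) by (simp add: eT)
    have DT: "D \<subseteq> orth_part T" using compD by (auto simp: irreducible_component_def)
    have Dcas: "D \<in> cascade_systems" using cascade_systems.descend T by blast
    have ne: "C \<inter> T \<noteq> {}" using T(5) DT oS by blast
    from T(4)[OF ne] consider "C = T" | "C \<subseteq> orth_part T" | "T \<subseteq> orth_part C" by blast
    then show ?case
    proof cases
      case 1 then show ?thesis using DT by blast
    next
      case 2
      then have "C \<subseteq> D"
        using irreducible_in_component[OF oR[OF T(1)] compD cascade_system_irreducible[OF Ccas] 2] T(5) by blast
      then show ?thesis using three[OF Dcas T(5)] by blast
    next
      case 3 then show ?thesis using DT oS by blast
    qed
  qed
qed

lemma cascade_root:
  assumes "\<beta> \<in> cascade"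
  shows "supp_system \<beta> \<in> cascade_systems" "is_highest_root (supp_system \<beta>) \<beta>" "\<beta> \<in> pos_roots"
proof -
  obtain S where S: "S \<in> cascade_systems" "is_highest_root S \<beta>" using assms by (auto simp: cascade_def)
  note std = cascade_system_standard[OF S(1)]
  show "supp_system \<beta> \<in> cascade_systems" "is_highest_root (supp_system \<beta>) \<beta>"
    using S highest_supp_system[OF std S(2)] by auto
  show "\<beta> \<in> pos_roots" by (rule highest_pos[OF std S(2)])
qed

lemmas cascade_standard = cascade_system_standard[OF cascade_root(1)]

lemma heis_roots_pos: "\<gamma> \<in> heis_roots \<beta> \<Longrightarrow> \<gamma> \<in> pos_roots"
  and heis_roots_supp: "\<gamma> \<in> heis_roots \<beta> \<Longrightarrow> \<gamma> \<in> supp_system \<beta>"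
  by (auto simp: heis_roots_def)

text \<open>The root \<gamma> lies in both support systems but in neither orthogonal part, so
  nestedness leaves only equality of the systems, hence of their highest roots.\<close>

lemma heis_roots_unique:
  assumes b: "\<beta> \<in> cascade" "\<beta>' \<in> cascade" and g: "\<gamma> \<in> heis_roots \<beta>" "\<gamma> \<in> heis_roots \<beta>'"
  shows "\<beta> = \<beta>'"
proof -
  have no: "\<gamma> \<notin> orth_part (supp_system \<delta>)" if "\<delta> \<in> cascade" "\<gamma> \<in> heis_roots \<delta>" for \<delta>
    using that orth_part_eq[OF cascade_standard cascade_root(2), of \<delta>] by (auto simp: heis_roots_def)
  have "supp_system \<beta> \<inter> supp_system \<beta>' \<noteq> {}" using g heis_roots_supp by blast
  from cascade_systems_nested[OF cascade_root(1)[OF b(1)] cascade_root(1)[OF b(2)] this]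
  have "supp_system \<beta> = supp_system \<beta>'"
    using no[OF b(1) g(1)] no[OF b(2) g(2)] g heis_roots_supp by blast
  then show ?thesis
    using highest_unique[OF cascade_standard[OF b(1)] cascade_root(2)[OF b(1)]] cascade_root(2)[OF b(2)] by simp
qed

lemma cascade_self_heis: "\<beta> \<in> cascade \<Longrightarrow> \<beta> \<in> heis_roots \<beta>"
  using highest_self_heis[OF cascade_standard cascade_root(2)] by blast

text \<open>Take the smallest cascade system containing \<gamma>. If \<gamma> were orthogonal to its
  highest root, the component of the orthogonal part that contains \<gamma> would be a smaller
  one.\<close>

lemma pos_roots_covered:
  assumes g: "\<gamma> \<in> pos_roots" shows "\<exists>\<beta>\<in>cascade. \<gamma> \<in> heis_roots \<beta>"
proof -
  let ?P = "\<lambda>S. S \<in> cascade_systems \<and> \<gamma> \<in> S"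
  have "?P roots" using g pos_root cascade_systems.whole by blast
  define S where "S = arg_min card ?P"
  have S: "S \<in> cascade_systems" "\<gamma> \<in> S" and min: "\<And>D. D \<in> cascade_systems \<Longrightarrow> \<gamma> \<in> D \<Longrightarrow> card S \<le> card D"
    using arg_min_nat_lemma[of ?P roots card] \<open>?P roots\<close> unfolding S_def by blast+
  note std = cascade_system_standard[OF S(1)]
  obtain \<beta> where b: "is_highest_root S \<beta>" using cascade_system_highest[OF S(1)] by blast
  let ?X = "{\<delta> \<in> S. root_inner \<delta> \<beta> = 0}"
  have "\<gamma> \<notin> ?X"
  proof
    assume gX: "\<gamma> \<in> ?X"
    have "?X \<subseteq> roots" using standard_root[OF std] by blast
    from component_exists[OF this gX] obtain C where C: "irreducible_component ?X C" "\<gamma> \<in> C" by blast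
    have CX: "C \<subseteq> ?X" using C(1) by (simp add: irreducible_component_def)
    have "card S \<le> card C" using min[OF cascade_systems.descend[OF S(1) b C(1)] C(2)] .
    moreover have "\<beta> \<notin> C" using CX root_self_inner_nonzero[OF highest_root[OF std b]] by blast
    then have "C \<subset> S" using CX highest_in[OF std b] by blast
    then have "card C < card S" by (rule psubset_card_mono[OF standard_finite[OF std]])
    ultimately show False by simp
  qed
  then have "\<gamma> \<in> heis_roots \<beta>" using S g highest_supp_system[OF std b] by (auto simp: heis_roots_def)
  then show ?thesis using b S(1) by (auto simp: cascade_def)
qed

section \<open>Nilradicals\<close>

lemma root_span_subspace: "cmat.subspace (root_span S)"
  by (simp add: root_span_def)

lemma root_span_base: "\<gamma> \<in> S \<Longrightarrow> x \<in> root_space \<gamma> \<Longrightarrow> x \<in> root_span S"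
  unfolding root_span_def by (intro cmat.span_base) auto

lemma root_span_mono: "S \<subseteq> S' \<Longrightarrow> root_span S \<subseteq> root_span S'"
  unfolding root_span_def by (intro cmat.span_mono) auto

lemma root_span_in_\<gg>: "root_span S \<subseteq> \<gg>"
  unfolding root_span_def using root_space_in_\<gg> by (intro cmat.span_minimal[OF _ \<gg>_subspace]) auto

lemma root_span_least: "cmat.subspace V \<Longrightarrow> (\<And>\<gamma> x. \<gamma> \<in> S \<Longrightarrow> x \<in> root_space \<gamma> \<Longrightarrow> x \<in> V) \<Longrightarrow> root_span S \<subseteq> V"
  unfolding root_span_def by (intro cmat.span_minimal) auto

lemma root_span_components:
  assumes S: "S \<subseteq> weights" and x: "x \<in> root_span S"
    and w: "\<And>\<gamma>. w \<gamma> \<in> root_space \<gamma>" "x = (\<Sum>\<gamma>\<in>weights. w \<gamma>)" and g: "\<gamma> \<in> weights" "\<gamma> \<notin> S"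
  shows "w \<gamma> = 0"
proof -
  obtain v where v: "\<And>\<gamma>. v \<gamma> \<in> root_space \<gamma>" "\<And>\<gamma>. \<gamma> \<notin> S \<Longrightarrow> v \<gamma> = 0" "x = (\<Sum>\<gamma>\<in>weights. v \<gamma>)"
    using span_root_spaces_decomp[OF S x[unfolded root_span_def]] by blast
  have "(\<Sum>\<gamma>\<in>weights. w \<gamma>) = (\<Sum>\<gamma>\<in>weights. v \<gamma>)" using v(3) w(2) by simp
  then have "w \<gamma> = v \<gamma>" by (rule decomp_unique[of w v, OF w(1) v(1) _ g(1)])
  then show ?thesis using v(2) g by simp
qed

lemma root_spanI:
  assumes "x = (\<Sum>\<gamma>\<in>weights. w \<gamma>)" "\<And>\<gamma>. w \<gamma> \<in> root_space \<gamma>" "\<And>\<gamma>. \<gamma> \<in> weights \<Longrightarrow> \<gamma> \<notin> S \<Longrightarrow> w \<gamma> = 0"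
  shows "x \<in> root_span S"
  unfolding assms(1)
proof (rule cmat.subspace_sum[OF root_span_subspace])
  fix \<gamma> assume "\<gamma> \<in> weights"
  then show "w \<gamma> \<in> root_span S"
    using assms(2,3) root_span_base cmat.subspace_0[OF root_span_subspace] by (cases "\<gamma> \<in> S") auto
qed

lemma root_space_in_root_span:
  assumes S: "S \<subseteq> weights" and g: "\<gamma> \<in> weights" and x: "x \<in> root_space \<gamma>" "x \<noteq> 0" "x \<in> root_span S"
  shows "\<gamma> \<in> S"
proof (rule ccontr)
  assume no: "\<gamma> \<notin> S"
  have "(\<lambda>\<delta>. if \<delta> = \<gamma> then x else 0) \<gamma> = 0"
    by (rule root_span_components[OF S x(3) _ _ g no])
       (use x g weights_finite root_space_closed(1) in auto)
  then show False using x by simp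
qed

lemma roots_of_root_span: "S \<subseteq> roots \<Longrightarrow> roots_of (root_span S) = S"
  using root_space_in_root_span[of S] root_vector root_span_base
  by (fastforce simp: roots_of_def weights_def)

lemma stable_subspace_component:
  assumes V: "cmat.subspace V" "\<And>h x. h \<in> \<tt> \<Longrightarrow> x \<in> V \<Longrightarrow> \<lbrakk>h, x\<rbrakk> \<in> V"
    and w: "\<And>\<gamma>. w \<gamma> \<in> root_space \<gamma>" "(\<Sum>\<gamma>\<in>weights. w \<gamma>) \<in> V" and g: "\<gamma> \<in> weights"
  shows "w \<gamma> \<in> V"
proof (rule weight_components_in_subspace[of V \<tt> weights w \<gamma>])
  show "\<exists>h\<in>\<tt>. \<gamma> h \<noteq> \<delta> h" if "\<gamma> \<in> weights" "\<delta> \<in> weights" "\<gamma> \<noteq> \<delta>" for \<gamma> \<delta>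
    using that weight_dual dual_eqI by blast
qed (use assms weights_finite root_space_eigen in auto)

lemma root_space_subset_if_meets:
  assumes "\<gamma> \<in> roots" "cmat.subspace V" "x \<in> root_space \<gamma>" "x \<noteq> 0" "x \<in> V"
  shows "root_space \<gamma> \<subseteq> V"
  using root_space_one_dim[OF assms(1,3,4)] assms(2,5) cmat.subspace_scale by blast

lemma cartan_faithful:
  assumes "h \<in> \<tt>" "\<And>\<gamma>. \<gamma> \<in> roots \<Longrightarrow> \<gamma> h = 0" shows "h = 0"
proof (rule \<kappa>_nondegenerate_cartan[OF assms(1)])
  fix h' assume h': "h' \<in> \<tt>"
  obtain B wt where B: "finite B" "cmat.independent B" "cmat.span B = \<gg>"
    "\<And>b. b \<in> B \<Longrightarrow> wt b \<in> weights" "\<And>b. b \<in> B \<Longrightarrow> b \<in> root_space (wt b)"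
    using weight_basis by metis
  have "wt b h = 0" if "b \<in> B" for b
    using B(4)[OF that] assms(2) by (auto simp: weights_def zero_fun_apply)
  then show "\<kappa> h h' = 0" using \<kappa>_cartan[OF B assms(1) h'] by simp
qed

lemma bracket_root_spans:
  assumes x: "x \<in> root_span A" and y: "y \<in> root_span B" and A: "A \<subseteq> weights" and B: "B \<subseteq> weights"
    and c: "\<And>\<gamma> \<delta>. \<gamma> \<in> A \<Longrightarrow> \<delta> \<in> B \<Longrightarrow> \<gamma> + \<delta> \<in> weights \<Longrightarrow> \<gamma> + \<delta> \<in> C"
  shows "\<lbrakk>x, y\<rbrakk> \<in> root_span C"
proof (rule bracket_in_span[OF x[unfolded root_span_def] y[unfolded root_span_def] root_span_subspace])
  fix a b assume "a \<in> (\<Union>\<gamma>\<in>A. root_space \<gamma>)" "b \<in> (\<Union>\<gamma>\<in>B. root_space \<gamma>)"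
  then obtain \<gamma> \<delta> where g: "\<gamma> \<in> A" "a \<in> root_space \<gamma>" "\<delta> \<in> B" "b \<in> root_space \<delta>" by auto
  have d: "\<gamma> + \<delta> \<in> dual_space" using g A B weight_dual dual_closed(2) by blast
  show "\<lbrakk>a, b\<rbrakk> \<in> root_span C"
  proof (cases "\<gamma> + \<delta> \<in> weights")
    case True then show ?thesis using c g root_span_base root_space_bracket by blast
  next
    case False
    then have "\<lbrakk>a, b\<rbrakk> = 0" using root_space_eq_zero[OF d] root_space_bracket g by blast
    then show ?thesis using cmat.subspace_0[OF root_span_subspace] by simp
  qed
qed

text \<open>The sets \<open>\<Delta>(\<nn>)\<close>, \<open>\<nn>\<close> the nilradical of a standard parabolic subalgebra; the roots of the latter are
  \<open>parabolic_roots (\<Delta>(\<nn>))\<close>.\<close>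
definition parabolic_type :: "'n functional set \<Rightarrow> bool" where
  "parabolic_type N \<longleftrightarrow> N \<subseteq> pos_roots \<and> (\<forall>\<gamma>\<in>roots. \<forall>\<delta>\<in>roots. \<gamma> + \<delta> \<in> N \<longrightarrow> \<gamma> \<in> N \<or> \<delta> \<in> N)"

definition parabolic_roots :: "'n functional set \<Rightarrow> 'n functional set" where
  "parabolic_roots N = {\<gamma> \<in> roots. - \<gamma> \<notin> N}"

lemma parabolic_weights: "insert 0 (parabolic_roots N) \<subseteq> weights"
  by (auto simp: parabolic_roots_def weights_def)

context
  fixes N assumes N: "parabolic_type N"
begin

lemma type_pos: "\<gamma> \<in> N \<Longrightarrow> \<gamma> \<in> pos_roots"
  using N by (auto simp: parabolic_type_def)

lemma type_root: "\<gamma> \<in> N \<Longrightarrow> \<gamma> \<in> roots"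
  using type_pos pos_root by blast

lemma type_split: "\<gamma> \<in> roots \<Longrightarrow> \<delta> \<in> roots \<Longrightarrow> \<gamma> + \<delta> \<in> N \<Longrightarrow> \<gamma> \<in> N \<or> \<delta> \<in> N"
  using N by (auto simp: parabolic_type_def)

lemma parabolic_roots_closed:
  assumes "\<gamma> \<in> parabolic_roots N" "\<delta> \<in> parabolic_roots N" "\<gamma> + \<delta> \<in> roots"
  shows "\<gamma> + \<delta> \<in> parabolic_roots N"
  using assms type_split[of "- \<gamma>" "- \<delta>"] root_neg by (auto simp: parabolic_roots_def add.commute)

text \<open>Split \<delta> as (\<gamma> + \<delta>) + (-\<gamma>): the second summand is not in N,
  so the first one is.\<close>

lemma type_ideal:
  assumes g: "\<gamma> \<in> parabolic_roots N" and d: "\<delta> \<in> N" and s: "\<gamma> + \<delta> \<in> weights"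
  shows "\<gamma> + \<delta> \<in> N"
proof -
  have "\<gamma> + \<delta> \<noteq> 0"
  proof
    assume "\<gamma> + \<delta> = 0"
    then have "- \<gamma> = \<delta>" by (simp add: neg_eq_iff_add_eq_0)
    then show False using g d by (simp add: parabolic_roots_def)
  qed
  then have r: "\<gamma> + \<delta> \<in> roots" using s by (simp add: weights_def)
  have "(\<gamma> + \<delta>) + - \<gamma> \<in> N" using d by simp
  then show ?thesis using type_split[OF r root_neg, of \<gamma>] g by (auto simp: parabolic_roots_def)
qed

lemma pos_parabolic: "\<gamma> \<in> pos_roots \<Longrightarrow> \<gamma> \<in> parabolic_roots N"
  using type_pos pos_not_neg pos_root by (auto simp: parabolic_roots_def)

lemma type_up: "\<delta> \<in> N \<Longrightarrow> \<gamma> \<in> pos_roots \<Longrightarrow> \<gamma> + \<delta> \<in> weights \<Longrightarrow> \<gamma> + \<delta> \<in> N"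
  using type_ideal pos_parabolic by blast

lemma type_weights: "N \<subseteq> weights"
  using type_root root_weight by blast

abbreviation parabolic where "parabolic \<equiv> root_span (insert 0 (parabolic_roots N))"

lemma parabolic_subalgebra: "lie_subalgebra parabolic"
  unfolding lie_subalgebra_def
proof (intro conjI ballI root_span_subspace)
  fix x y assume "x \<in> parabolic" "y \<in> parabolic"
  then show "\<lbrakk>x, y\<rbrakk> \<in> parabolic"
    by (rule bracket_root_spans[OF _ _ parabolic_weights parabolic_weights])
       (use parabolic_roots_closed in \<open>auto simp: weights_def\<close>)
qed

lemma parabolic_standard: "standard_parabolic parabolic"
  unfolding standard_parabolic_def
proof (intro conjI parabolic_subalgebra root_span_in_\<gg>)
  have "root_span pos_roots \<subseteq> parabolic" using pos_parabolic by (intro root_span_mono) auto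
  moreover have "\<tt> \<subseteq> parabolic" using root_span_base[of 0] root_space_zero by blast
  ultimately show "borel \<subseteq> parabolic" unfolding borel_def by (intro cmat.span_minimal[OF _ root_span_subspace]) auto
qed

lemma nilradical_ideal: "lie_ideal parabolic (root_span N)"
  unfolding lie_ideal_def
proof (intro conjI ballI root_span_subspace)
  show "root_span N \<subseteq> parabolic" using type_pos pos_parabolic by (intro root_span_mono) auto
  fix x y assume "x \<in> parabolic" "y \<in> root_span N"
  then show "\<lbrakk>x, y\<rbrakk> \<in> root_span N"
    by (rule bracket_root_spans[OF _ _ parabolic_weights type_weights]) (use type_ideal in auto)
qed

text \<open>Roots in N have height at least 1, so each further bracket raises the height by at least
  1.\<close>

lemma nilradical_lower_central:
  "lower_central (root_span N) i \<subseteq> root_span {\<gamma> \<in> N. ht \<gamma> \<ge> 1 + real i}"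
proof (induction i)
  case 0
  have "{\<gamma> \<in> N. ht \<gamma> \<ge> 1 + real 0} = N" using type_pos ht_pos by auto
  then show ?case by simp
next
  case (Suc i)
  show ?case unfolding lower_central.simps
  proof (rule cmat.span_minimal[OF _ root_span_subspace], safe)
    fix x y assume x: "x \<in> root_span N" and y: "y \<in> lower_central (root_span N) i"
    show "\<lbrakk>x, y\<rbrakk> \<in> root_span {\<gamma> \<in> N. ht \<gamma> \<ge> 1 + real (Suc i)}"
    proof (rule bracket_root_spans[OF x subsetD[OF Suc y] type_weights])
      fix \<gamma> \<delta> assume *: "\<gamma> \<in> N" "\<delta> \<in> {\<gamma> \<in> N. ht \<gamma> \<ge> 1 + real i}" "\<gamma> + \<delta> \<in> weights"
      have "\<gamma> + \<delta> \<in> N" using type_up[of \<delta> \<gamma>] * type_pos by blast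
      moreover have "ht (\<gamma> + \<delta>) = ht \<gamma> + ht \<delta>" using * type_root roots_span_base by (intro ht_add) auto
      ultimately show "\<gamma> + \<delta> \<in> {\<gamma> \<in> N. ht \<gamma> \<ge> 1 + real (Suc i)}"
        using * ht_pos[OF type_pos[of \<gamma>]] by auto
    qed (use type_weights in auto)
  qed
qed

lemma nilradical_nilpotent: "nilpotent_lie (root_span N)"
  unfolding nilpotent_lie_def
proof
  show "lie_subalgebra (root_span N)"
    using nilradical_ideal unfolding lie_ideal_def lie_subalgebra_def by blast
  obtain k :: nat where k: "(\<Sum>\<gamma>\<in>roots. \<bar>ht \<gamma>\<bar>) < real k" using reals_Archimedean2 by blast
  have "ht \<gamma> < real k" if "\<gamma> \<in> N" for \<gamma>
    using member_le_sum[of \<gamma> roots "\<lambda>\<gamma>. \<bar>ht \<gamma>\<bar>"] roots_finite type_root[OF that] k by auto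
  then have "{\<gamma> \<in> N. ht \<gamma> \<ge> 1 + real (Suc k)} = {}" by fastforce
  moreover have "root_span {} = {0}" by (simp add: root_span_def)
  ultimately have "lower_central (root_span N) (Suc k) \<subseteq> {0}"
    using nilradical_lower_central[of "Suc k"] by metis
  moreover have "0 \<in> lower_central (root_span N) (Suc k)" using cmat.span_zero by simp
  ultimately show "\<exists>i. lower_central (root_span N) i = {0}" by blast
qed

text \<open>The ideal is stable under \<tt>, hence contains the weight components of its elements. A
  component of weight 0, or of a root outside N, would produce h and u in I with [h, u] a nonzero
  multiple of u, and such a u survives in every term of the lower central series.\<close>

lemma nilradical_largest:
  assumes I: "lie_ideal parabolic I" and nil: "nilpotent_lie I"
  shows "I \<subseteq> root_span N"
proof
  fix x assume x: "x \<in> I"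
  have Isub: "cmat.subspace I" and Ip: "I \<subseteq> parabolic" and Iad: "\<And>x y. x \<in> parabolic \<Longrightarrow> y \<in> I \<Longrightarrow> \<lbrakk>x, y\<rbrakk> \<in> I"
    using I by (auto simp: lie_ideal_def)
  have tp: "\<tt> \<subseteq> parabolic" using root_span_base[of 0] root_space_zero by blast
  have noeig: False if "h \<in> I" "u \<in> I" "\<lbrakk>h, u\<rbrakk> = mscale c u" "c \<noteq> 0" "u \<noteq> 0" for h u c
  proof -
    have "u \<in> lower_central I i" for i
    proof (induction i)
      case 0 show ?case using that by simp
    next
      case (Suc i)
      have "\<lbrakk>h, u\<rbrakk> \<in> lower_central I (Suc i)"
        unfolding lower_central.simps by (rule cmat.span_base) (use that Suc in blast)
      then have "mscale (1 / c) \<lbrakk>h, u\<rbrakk> \<in> lower_central I (Suc i)"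
        unfolding lower_central.simps by (rule cmat.span_scale)
      then show ?case using that by simp
    qed
    then show False using nil that by (auto simp: nilpotent_lie_def)
  qed
  obtain w where w: "\<And>\<gamma>. w \<gamma> \<in> root_space \<gamma>" "x = (\<Sum>\<gamma>\<in>weights. w \<gamma>)"
    using \<gg>_decomp[of x] x Ip root_span_in_\<gg> by blast
  have wI: "w \<gamma> \<in> I" if "\<gamma> \<in> weights" for \<gamma>
    by (rule stable_subspace_component[OF Isub _ w(1) _ that]) (use tp Iad x w(2) in auto)
  have "w 0 = 0"
  proof (rule ccontr)
    assume ne: "w 0 \<noteq> 0"
    have w0: "w 0 \<in> \<tt>" "w 0 \<in> I" using w(1)[of 0] root_space_zero wI[of 0] by (auto simp: weights_def)
    obtain \<gamma> where g: "\<gamma> \<in> roots" "\<gamma> (w 0) \<noteq> 0" using cartan_faithful[OF w0(1)] ne by blast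
    \<comment> \<open>The sign is adjusted because root vectors of positive roots lie in the
      parabolic, so their brackets with \<open>w 0\<close> stay in I.\<close>
    obtain \<delta> where d: "\<delta> \<in> pos_roots" "\<delta> (w 0) \<noteq> 0"
      using pos_or_neg[OF g(1)] g(2) by (auto simp: uminus_apply)
    obtain u where u: "u \<in> root_space \<delta>" "u \<noteq> 0" using root_vector[OF pos_root[OF d(1)]] by blast
    have e: "\<lbrakk>w 0, u\<rbrakk> = mscale (\<delta> (w 0)) u" using root_space_eigen[OF u(1) w0(1)] .
    have "u \<in> parabolic" using root_span_base[OF _ u(1)] pos_parabolic[OF d(1)] by blast
    then have "- \<lbrakk>u, w 0\<rbrakk> \<in> I" using Iad w0(2) cmat.subspace_neg[OF Isub] by blast
    then have "mscale (\<delta> (w 0)) u \<in> I" using e lie_bracket_antisym[of "w 0" u] by simp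
    then have "mscale (1 / \<delta> (w 0)) (mscale (\<delta> (w 0)) u) \<in> I" by (rule cmat.subspace_scale[OF Isub])
    then have "u \<in> I" using d by simp
    then show False using noeig[OF w0(2) _ e d(2) u(2)] by blast
  qed
  moreover have "w \<gamma> = 0" if g: "\<gamma> \<in> roots" "\<gamma> \<notin> N" for \<gamma>
  proof (rule ccontr)
    assume ne: "w \<gamma> \<noteq> 0"
    have gI: "w \<gamma> \<in> I" using wI root_weight g by blast
    obtain y where y: "y \<in> root_space (- \<gamma>)" "\<lbrakk>w \<gamma>, y\<rbrakk> = coroot \<gamma>" using sl2_triple[OF g(1) w(1) ne] .
    \<comment> \<open>That \<gamma> is not in N puts y into the parabolic, so the ideal contains the
      coroot [w \<gamma>, y].\<close>
    have "- \<gamma> \<in> parabolic_roots N" using g root_neg by (simp add: parabolic_roots_def)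
    then have "y \<in> parabolic" using root_span_base[OF _ y(1)] by blast
    then have "- \<lbrakk>y, w \<gamma>\<rbrakk> \<in> I" using Iad gI cmat.subspace_neg[OF Isub] by blast
    then have hI: "coroot \<gamma> \<in> I" using y(2) lie_bracket_antisym[of "w \<gamma>" y] by simp
    have "\<lbrakk>coroot \<gamma>, w \<gamma>\<rbrakk> = mscale 2 (w \<gamma>)"
      using root_space_eigen[OF w(1) coroot_in[OF g(1)]] root_coroot_self[OF g(1)] by simp
    then show False by (rule noeig[OF hI gI _ _ ne]) simp
  qed
  ultimately show "x \<in> root_span N" using w by (intro root_spanI[of x w]) (auto simp: weights_def)
qed

lemma nilradical_of_parabolic: "is_nilradical_of parabolic (root_span N)"
  unfolding is_nilradical_of_def using nilradical_ideal nilradical_nilpotent nilradical_largest by blast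

end

section \<open>Standard parabolics in terms of roots, and the projection to the opposite
  nilradical\<close>

text \<open>Brackets of root vectors are nonzero whenever the sum is a root, so the set P of roots
  of \<pp> is closed under addition within the roots. It contains the positive roots, so each root
  or its negative is in P; therefore the roots of P whose negatives are not in P determine
  P.\<close>

lemma parabolic_from_roots:
  assumes p: "standard_parabolic \<pp>"
  obtains N where "parabolic_type N" "\<pp> = root_span (insert 0 (parabolic_roots N))"
proof -
  have sub: "lie_subalgebra \<pp>" and bp: "borel \<subseteq> \<pp>" and pg: "\<pp> \<subseteq> \<gg>" using p by (auto simp: standard_parabolic_def)
  have psub: "cmat.subspace \<pp>" and pbr: "\<And>x y. x \<in> \<pp> \<Longrightarrow> y \<in> \<pp> \<Longrightarrow> \<lbrakk>x, y\<rbrakk> \<in> \<pp>"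
    using sub by (auto simp: lie_subalgebra_def)
  have tp: "\<tt> \<subseteq> \<pp>" using bp cmat.span_base unfolding borel_def by blast
  define P where "P = {\<gamma> \<in> roots. root_space \<gamma> \<subseteq> \<pp>}"
  have posP: "pos_roots \<subseteq> P"
  proof
    fix \<gamma> assume g: "\<gamma> \<in> pos_roots"
    have "root_space \<gamma> \<subseteq> borel" unfolding borel_def using root_span_base[OF g] cmat.span_base by blast
    then show "\<gamma> \<in> P" using bp pos_root[OF g] by (auto simp: P_def)
  qed
  have closed: "\<gamma> + \<delta> \<in> P" if "\<gamma> \<in> P" "\<delta> \<in> P" "\<gamma> + \<delta> \<in> roots" for \<gamma> \<delta>
  proof -
    have r: "\<gamma> \<in> roots" "\<delta> \<in> roots" using that by (auto simp: P_def)
    obtain x y where x: "x \<in> root_space \<gamma>" "x \<noteq> 0" and y: "y \<in> root_space \<delta>" "y \<noteq> 0"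
      using root_vector r by blast
    have "\<lbrakk>x, y\<rbrakk> \<in> \<pp>" using pbr x y that by (auto simp: P_def)
    then show ?thesis
      using root_space_subset_if_meets[OF that(3) psub root_space_bracket[OF x(1) y(1)]]
        bracket_root_vectors_nonzero[OF r that(3) x y] that(3) by (simp add: P_def)
  qed
  define N where "N = {\<gamma> \<in> P. - \<gamma> \<notin> P}"
  have PR: "P \<subseteq> roots" by (auto simp: P_def)
  have pn: "\<gamma> \<in> P \<or> - \<gamma> \<in> P" if "\<gamma> \<in> roots" for \<gamma> using pos_or_neg[OF that] posP by blast
  have PN: "parabolic_roots N = P"
    using PR pn by (auto simp: parabolic_roots_def N_def)
  have "parabolic_type N"
    unfolding parabolic_type_def
  proof (intro conjI ballI impI)
    show "N \<subseteq> pos_roots" using pos_or_neg posP by (auto simp: N_def P_def)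
    fix \<gamma> \<delta> assume g: "\<gamma> \<in> roots" and d: "\<delta> \<in> roots" and s: "\<gamma> + \<delta> \<in> N"
    show "\<gamma> \<in> N \<or> \<delta> \<in> N"
    proof (rule ccontr)
      assume no: "\<not> ?thesis"
      have "- \<gamma> \<in> P" "- \<delta> \<in> P" using no g d root_neg PN[symmetric] by (auto simp: parabolic_roots_def)
      moreover have e: "- \<gamma> + - \<delta> = - (\<gamma> + \<delta>)" by simp
      moreover have "\<gamma> + \<delta> \<in> roots" using s PR by (auto simp: N_def)
      then have "- (\<gamma> + \<delta>) \<in> roots" by (rule root_neg)
      ultimately have "- (\<gamma> + \<delta>) \<in> P" using closed[of "- \<gamma>" "- \<delta>"] by metis
      then show False using s by (simp add: N_def)
    qed
  qed
  moreover have "\<pp> = root_span (insert 0 P)"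
  proof
    show "root_span (insert 0 P) \<subseteq> \<pp>"
      using tp root_space_zero by (intro root_span_least[OF psub]) (auto simp: P_def)
    show "\<pp> \<subseteq> root_span (insert 0 P)"
    proof
      fix x assume x: "x \<in> \<pp>"
      obtain w where w: "\<And>\<gamma>. w \<gamma> \<in> root_space \<gamma>" "x = (\<Sum>\<gamma>\<in>weights. w \<gamma>)" using \<gg>_decomp[of x] x pg by blast
      have "w \<gamma> = 0" if "\<gamma> \<in> weights" "\<gamma> \<notin> insert 0 P" for \<gamma>
      proof (rule ccontr)
        assume ne: "w \<gamma> \<noteq> 0"
        have "w \<gamma> \<in> \<pp>"
          by (rule stable_subspace_component[OF psub _ w(1) _ that(1)]) (use tp pbr x w(2) in auto)
        then have "root_space \<gamma> \<subseteq> \<pp>"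
          using root_space_subset_if_meets[OF _ psub w(1) ne] that by (auto simp: weights_def)
        then show False using that by (auto simp: weights_def P_def)
      qed
      then show "x \<in> root_span (insert 0 P)" using w by (intro root_spanI[of x w]) auto
    qed
  qed
  ultimately show ?thesis using that PN by simp
qed

lemma nilradical_unique: "is_nilradical_of P N \<Longrightarrow> is_nilradical_of P N' \<Longrightarrow> N = N'"
  unfolding is_nilradical_of_def by blast

lemma nilradical_roots:
  assumes "nilradical \<nn>"
  obtains N where "parabolic_type N" "\<nn> = root_span N"
proof -
  obtain \<pp> where p: "standard_parabolic \<pp>" "is_nilradical_of \<pp> \<nn>" using assms by (auto simp: nilradical_def)
  obtain N where N: "parabolic_type N" "\<pp> = root_span (insert 0 (parabolic_roots N))"
    using parabolic_from_roots[OF p(1)] .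
  then show ?thesis using that nilradical_unique[OF p(2)] nilradical_of_parabolic[OF N(1)] by blast
qed

text \<open>This evaluates the definite description: N can be read off from its root span, and N
  determines the parabolic.\<close>

lemma parabolic_of_root_span:
  assumes N: "parabolic_type N"
  shows "parabolic_of (root_span N) = root_span (insert 0 (parabolic_roots N))"
  unfolding parabolic_of_def
proof (rule the_equality)
  show "standard_parabolic (root_span (insert 0 (parabolic_roots N))) \<and>
      is_nilradical_of (root_span (insert 0 (parabolic_roots N))) (root_span N)"
    using parabolic_standard[OF N] nilradical_of_parabolic[OF N] by blast
  fix \<pp> assume p: "standard_parabolic \<pp> \<and> is_nilradical_of \<pp> (root_span N)"
  then obtain N' where N': "parabolic_type N'" "\<pp> = root_span (insert 0 (parabolic_roots N'))"
    using parabolic_from_roots by blast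
  then have "root_span N = root_span N'"
    using nilradical_unique[of \<pp>] p nilradical_of_parabolic[OF N'(1)] by blast
  moreover have "N \<subseteq> roots" "N' \<subseteq> roots" using type_root[OF N] type_root[OF N'(1)] by auto
  ultimately have "N = N'" using roots_of_root_span by metis
  then show "\<pp> = root_span (insert 0 (parabolic_roots N))" using N' by simp
qed

text \<open>The weights are the disjoint union of -N and the weights of the parabolic. Hence the
  definite description in the projection denotes a unique vector, and its kernel is the
  parabolic.\<close>

lemma proj_opposite_zero_iff:
  assumes N: "parabolic_type N" and x: "x \<in> \<gg>"
  shows "proj_opposite (root_span N) x = 0 \<longleftrightarrow> x \<in> root_span (insert 0 (parabolic_roots N))"
proof -
  let ?p = "root_span (insert 0 (parabolic_roots N))" and ?M = "{- \<gamma> | \<gamma>. \<gamma> \<in> N}"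
  have NR: "N \<subseteq> roots" using type_root[OF N] by blast
  have opp: "opposite (root_span N) = root_span ?M" by (simp add: opposite_def roots_of_root_span[OF NR])
  have MW: "?M \<subseteq> weights" using NR root_neg root_weight by blast
  have PW: "insert 0 (parabolic_roots N) \<subseteq> weights" by (rule parabolic_weights)
  have MR: "?M \<subseteq> roots" using NR root_neg by blast
  have disj: "\<gamma> \<notin> ?M" if "\<gamma> \<in> insert 0 (parabolic_roots N)" for \<gamma>
    using that zero_not_root MR by (auto simp: parabolic_roots_def)
  have cover: "\<gamma> \<in> ?M \<or> \<gamma> \<in> insert 0 (parabolic_roots N)" if "\<gamma> \<in> weights" for \<gamma>
  proof (cases "- \<gamma> \<in> N")
    case True then have "- (- \<gamma>) \<in> ?M" by blast
    then show ?thesis by simp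
  next
    case False then show ?thesis using that by (auto simp: parabolic_roots_def weights_def)
  qed
  have inter: "y = 0" if y: "y \<in> root_span ?M" "y \<in> ?p" for y
  proof -
    obtain w where w: "\<And>\<gamma>. w \<gamma> \<in> root_space \<gamma>" "y = (\<Sum>\<gamma>\<in>weights. w \<gamma>)"
      using \<gg>_decomp[of y] y root_span_in_\<gg> by blast
    have "w \<gamma> = 0" if "\<gamma> \<in> weights" for \<gamma>
      using root_span_components[OF MW y(1) w that] root_span_components[OF PW y(2) w that] disj by blast
    then show ?thesis using w(2) by simp
  qed
  obtain w where w: "\<And>\<gamma>. w \<gamma> \<in> root_space \<gamma>" "x = (\<Sum>\<gamma>\<in>weights. w \<gamma>)" using \<gg>_decomp[OF x] by blast
  define y where "y = (\<Sum>\<gamma>\<in>weights. if \<gamma> \<in> ?M then w \<gamma> else 0)"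
  have "y \<in> root_span ?M"
    by (rule root_spanI[OF y_def]) (use w(1) root_space_closed(1) in auto)
  moreover have "x - y = (\<Sum>\<gamma>\<in>weights. if \<gamma> \<in> ?M then 0 else w \<gamma>)"
    unfolding w(2) y_def sum_subtractf[symmetric] by (intro sum.cong) auto
  then have "x - y \<in> ?p"
    by (rule root_spanI) (use w(1) root_space_closed(1) cover in auto)
  ultimately have y: "y \<in> root_span ?M \<and> x - y \<in> ?p" by blast
  have uniq: "z = z'" if z: "z \<in> root_span ?M \<and> x - z \<in> ?p" and z': "z' \<in> root_span ?M \<and> x - z' \<in> ?p" for z z'
  proof -
    have 1: "z - z' \<in> root_span ?M"
      by (rule cmat.subspace_diff[OF root_span_subspace conjunct1[OF z] conjunct1[OF z']])
    have "(x - z') - (x - z) \<in> ?p"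
      by (rule cmat.subspace_diff[OF root_span_subspace conjunct2[OF z'] conjunct2[OF z]])
    then have "z - z' \<in> ?p" by (simp add: algebra_simps)
    then have "z - z' = 0" by (rule inter[OF 1])
    then show ?thesis by simp
  qed
  have pr: "proj_opposite (root_span N) x = (THE y. y \<in> root_span ?M \<and> x - y \<in> ?p)"
    by (simp add: proj_opposite_def opp parabolic_of_root_span[OF N])
  have the: "proj_opposite (root_span N) x \<in> root_span ?M \<and> x - proj_opposite (root_span N) x \<in> ?p"
    unfolding pr by (rule theI[of "\<lambda>y. y \<in> root_span ?M \<and> x - y \<in> ?p", OF y]) (rule uniq[OF _ y])
  show ?thesis
  proof
    assume "proj_opposite (root_span N) x = 0"
    then show "x \<in> ?p" using the by simp
  next
    assume "x \<in> ?p"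
    then have "0 \<in> root_span ?M \<and> x - 0 \<in> ?p" using cmat.subspace_0[OF root_span_subspace] by simp
    then show "proj_opposite (root_span N) x = 0" using uniq the by blast
  qed
qed

section \<open>The optimisation\<close>

lemma heis_root_subset: "heis_roots \<beta> \<subseteq> roots"
  using heis_roots_pos pos_root by blast

context
  fixes N assumes N: "parabolic_type N"
begin

text \<open>With \<gamma> in \<open>heis_roots \<beta>\<close>, the difference \<beta> - \<gamma> is
  zero or a positive root, and N is closed under adding positive roots; so \<beta> is in N.\<close>

lemma type_in_heis:
  assumes g: "\<gamma> \<in> N" shows "\<exists>\<beta>\<in>cascade \<inter> N. \<gamma> \<in> heis_roots \<beta>"
proof -
  obtain \<beta> where b: "\<beta> \<in> cascade" "\<gamma> \<in> heis_roots \<beta>" using pos_roots_covered type_pos[OF N g] by blast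
  note std = cascade_standard[OF b(1)] and hr = cascade_root(2)[OF b(1)]
  have "\<beta> \<in> N"
  proof (cases "\<gamma> = \<beta>")
    case False
    have "\<beta> - \<gamma> \<in> pos_roots" using heis_complement[OF std hr b(2) False] heis_roots_pos by blast
    then show ?thesis
      using type_up[OF N g, of "\<beta> - \<gamma>"] root_weight[OF pos_root[OF cascade_root(3)[OF b(1)]]] by simp
  qed (use g in simp)
  then show ?thesis using b by blast
qed

text \<open>An element of greatest height in S \<inter> N cannot be raised inside S, because N is
  closed upwards; so it is the highest root.\<close>

lemma type_highest:
  assumes S: "standard S" and irr: "irreducible_roots S" and hr: "is_highest_root S \<beta>"
    and g: "\<gamma> \<in> S" "\<gamma> \<in> N"
  shows "\<beta> \<in> N"
proof -
  let ?A = "S \<inter> N"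
  have fin: "finite ?A" using standard_finite[OF S] by simp
  define \<mu> where "\<mu> = arg_min_on (\<lambda>\<gamma>. - ht \<gamma>) ?A"
  have m: "\<mu> \<in> S" "\<mu> \<in> N" and max: "\<And>\<delta>. \<delta> \<in> S \<Longrightarrow> \<delta> \<in> N \<Longrightarrow> ht \<delta> \<le> ht \<mu>"
    using arg_min_if_finite[OF fin, of "\<lambda>\<gamma>. - ht \<gamma>"] g unfolding \<mu>_def by (auto simp: not_less)
  have mp: "\<mu> \<in> pos_roots" using type_pos[OF N m(2)] .
  have no: "\<mu> + \<delta> \<notin> weights" if d: "\<delta> \<in> S" "\<delta> \<in> pos_roots" for \<delta>
  proof
    assume w: "\<mu> + \<delta> \<in> weights"
    then have "\<mu> + \<delta> \<in> N" using type_up[OF N m(2) d(2)] by (simp add: add.commute)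
    moreover have "\<mu> + \<delta> \<in> S" using standard_add[OF S m(1) d(1)] pos_root[OF pos_add_root[OF mp d(2) w]] .
    ultimately have "ht (\<mu> + \<delta>) \<le> ht \<mu>" using max by blast
    then show False
      using ht_add[OF roots_span_base[OF pos_root[OF mp]] roots_span_base[OF pos_root[OF d(2)]]] ht_pos[OF d(2)] by simp
  qed
  have "\<mu> = \<beta>"
    by (rule maximal_root_unique[OF S irr m(1) mp no highest_in[OF S hr] highest_pos[OF S hr] highest_add[OF S hr]])
  then show ?thesis using m by simp
qed

definition opt_roots :: "'n functional set" where
  "opt_roots = (\<Union>\<beta>\<in>cascade \<inter> N. heis_roots \<beta>)"

lemma heis_in_opt: "\<beta> \<in> cascade \<Longrightarrow> \<beta> \<in> N \<Longrightarrow> \<gamma> \<in> heis_roots \<beta> \<Longrightarrow> \<gamma> \<in> opt_roots"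
  by (auto simp: opt_roots_def)

lemma opt_pos: "\<gamma> \<in> opt_roots \<Longrightarrow> \<gamma> \<in> pos_roots"
  using heis_roots_pos by (auto simp: opt_roots_def)

lemma opt_split_pos:
  assumes b: "\<beta> \<in> cascade" "\<beta> \<in> N" and e: "\<gamma> + \<delta> \<in> heis_roots \<beta>" and g: "\<gamma> \<in> pos_roots" and d: "\<delta> \<in> pos_roots"
  shows "\<gamma> \<in> opt_roots \<or> \<delta> \<in> opt_roots"
proof -
  note std = cascade_standard[OF b(1)] and hr = cascade_root(2)[OF b(1)]
  note sp = roots_span_base[OF pos_root[OF g]] roots_span_base[OF pos_root[OF d]]
  have eS: "\<gamma> + \<delta> \<in> supp_system \<beta>" using heis_roots_supp[OF e] .
  have "\<gamma> \<in> supp_system \<beta>" "\<delta> \<in> supp_system \<beta>"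
    using standard_below[OF std eS g] standard_below[OF std eS d] rc_add[OF sp] pos_rc[OF g] pos_rc[OF d] by simp_all
  moreover have "ip (\<gamma> + \<delta>) \<beta> \<noteq> 0" using e highest_heis_roots[OF std hr] by simp
  then have "ip \<gamma> \<beta> \<noteq> 0 \<or> ip \<delta> \<beta> \<noteq> 0"
    using ip_add_left[OF root_represented[OF pos_root[OF g]] root_represented[OF pos_root[OF d]]
        root_represented[OF highest_root[OF std hr]]] by auto
  ultimately have "\<gamma> \<in> heis_roots \<beta> \<or> \<delta> \<in> heis_roots \<beta>"
    using g d highest_heis_roots[OF std hr] by auto
  then show ?thesis using heis_in_opt[OF b] by blast
qed

text \<open>\<open>\<gamma>\<close> is larger than \<open>\<eta>\<close>, so its cascade system contains or is contained in that of \<open>\<beta>\<close>.\<close>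
lemma opt_up:
  assumes b: "\<beta> \<in> cascade" "\<beta> \<in> N" and e: "\<eta> \<in> heis_roots \<beta>" and g: "\<gamma> \<in> pos_roots" and d: "\<gamma> - \<eta> \<in> pos_roots"
  shows "\<gamma> \<in> opt_roots"
proof -
  note std = cascade_standard[OF b(1)] and hr = cascade_root(2)[OF b(1)]
  note ep = heis_roots_pos[OF e]
  obtain \<beta>' where b': "\<beta>' \<in> cascade" "\<gamma> \<in> heis_roots \<beta>'" using pos_roots_covered g by blast
  note std' = cascade_standard[OF b'(1)] and hr' = cascade_root(2)[OF b'(1)]
  have gS': "\<gamma> \<in> supp_system \<beta>'" using heis_roots_supp[OF b'(2)] .
  have le: "rc \<eta> \<alpha> \<le> rc \<gamma> \<alpha>" if "\<alpha> \<in> \<Psi>" for \<alpha>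
    using pos_rc[OF d that] rc_diff[OF roots_span_base[OF pos_root[OF g]] roots_span_base[OF pos_root[OF ep]]] by simp
  have "\<eta> \<in> supp_system \<beta>'" by (rule standard_below[OF std' gS' ep le])
  then have "supp_system \<beta> \<inter> supp_system \<beta>' \<noteq> {}" using heis_roots_supp[OF e] by blast
  from cascade_systems_nested[OF cascade_root(1)[OF b(1)] cascade_root(1)[OF b'(1)] this]
  consider "supp_system \<beta> \<subseteq> supp_system \<beta>'" | "supp_system \<beta>' \<subseteq> orth_part (supp_system \<beta>)"
    by (auto simp: orth_part_def)
  then show ?thesis
  proof cases
    case 1
    have "\<beta>' \<in> N"
      using type_highest[OF std' cascade_system_irreducible[OF cascade_root(1)[OF b'(1)]] hr' _ b(2)]
        highest_in[OF std hr] 1 by blast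
    then show ?thesis using heis_in_opt b' by blast
  next
    case 2
    \<comment> \<open>This case is contradictory: \<gamma> is orthogonal to \<beta>, yet it is the
      sum of \<eta>, which has positive product with \<beta>, and of a positive root of the same
      system, whose product is nonnegative.\<close>
    then have gX: "\<gamma> \<in> orth_part (supp_system \<beta>)" using gS' by blast
    then have gS: "\<gamma> \<in> supp_system \<beta>" and gb: "root_inner \<gamma> \<beta> = 0"
      using orth_part_eq[OF std hr] by auto
    note gr = pos_root[OF g] and er = pos_root[OF ep] and br = highest_root[OF std hr] and dr = pos_root[OF d]
    have g0: "ip \<gamma> \<beta> = 0" using gb root_inner_zero_iff[OF br root_weight[OF gr]] by simp
    have eS: "\<eta> \<in> supp_system \<beta>" using heis_roots_supp[OF e] .
    have "\<gamma> + - \<eta> \<in> supp_system \<beta>" using standard_add[OF std gS standard_neg[OF std eS]] dr by simp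
    then have "ip (\<gamma> - \<eta>) \<beta> \<ge> 0" using highest_dominant[OF std hr _ d] by simp
    moreover have "ip \<eta> \<beta> > 0"
      using highest_dominant[OF std hr eS ep] e highest_heis_roots[OF std hr] by auto
    moreover have "ip (\<eta> + (\<gamma> - \<eta>)) \<beta> = ip \<eta> \<beta> + ip (\<gamma> - \<eta>) \<beta>"
      by (rule ip_add_left[OF root_represented[OF er] root_represented[OF dr] root_represented[OF br]])
    ultimately show ?thesis using g0 by simp
  qed
qed

text \<open>If one summand is negative, the other exceeds the sum by a positive root and
  \<open>opt_up\<close> applies. If both are positive, additivity of the product with \<beta> keeps
  one of them in \<open>heis_roots \<beta>\<close>.\<close>

lemma opt_type: "parabolic_type opt_roots"
  unfolding parabolic_type_def
proof (intro conjI ballI impI)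
  show "opt_roots \<subseteq> pos_roots" using opt_pos by blast
  fix \<gamma> \<delta> assume g: "\<gamma> \<in> roots" and d: "\<delta> \<in> roots" and s: "\<gamma> + \<delta> \<in> opt_roots"
  obtain \<beta> where b: "\<beta> \<in> cascade" "\<beta> \<in> N" "\<gamma> + \<delta> \<in> heis_roots \<beta>" using s by (auto simp: opt_roots_def)
  note sp = opt_pos[OF s]
  have up: "\<gamma>' \<in> opt_roots" if g': "\<gamma>' \<in> roots" and d': "- \<delta>' \<in> pos_roots" and e: "\<gamma>' + \<delta>' = \<gamma> + \<delta>" for \<gamma>' \<delta>'
  proof -
    have e2: "(\<gamma> + \<delta>) + - \<delta>' = \<gamma>'" and e3: "\<gamma>' - (\<gamma> + \<delta>) = - \<delta>'" using e[symmetric] by simp_all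
    have "\<gamma>' \<in> pos_roots" using pos_add_root[OF sp d'] root_weight[OF g'] unfolding e2 .
    then show ?thesis using opt_up[OF b(1,2,3)] d' unfolding e3[symmetric] by blast
  qed
  show "\<gamma> \<in> opt_roots \<or> \<delta> \<in> opt_roots"
  proof (cases "\<delta> \<in> pos_roots")
    case False
    then show ?thesis using up[OF g] pos_or_neg[OF d] by blast
  next
    case dp: True
    show ?thesis
    proof (cases "\<gamma> \<in> pos_roots")
      case False
      then show ?thesis using up[OF d] pos_or_neg[OF g] by (metis add.commute)
    next
      case True
      then show ?thesis using opt_split_pos[OF b True dp] by blast
    qed
  qed
qed

text \<open>A cascade root lies in \<open>heis_roots\<close> of itself and of no other cascade root,
  so the enlargement adds none.\<close>

lemma opt_cascade: "cascade \<inter> opt_roots = cascade \<inter> N"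
  using heis_roots_unique cascade_self_heis unfolding opt_roots_def by blast

lemma cascade_of_root_span: "cascade_of (root_span N) = cascade \<inter> N"
  using roots_of_root_span[of N] type_root[OF N] by (auto simp: cascade_of_def)

lemma missing_roots_root_span: "missing_roots (root_span N) \<beta> = heis_roots \<beta> - N"
proof -
  have "N \<subseteq> roots" using type_root[OF N] by blast
  then show ?thesis using roots_of_root_span heis_root_subset by (simp add: missing_roots_def heis_def)
qed

lemma optimisation_root_span: "optimisation (root_span N) = root_span opt_roots"
  unfolding optimisation_def cascade_of_root_span
proof
  show "cmat.span (\<Union>\<beta>\<in>cascade \<inter> N. heis \<beta>) \<subseteq> root_span opt_roots"
  proof (rule cmat.span_minimal[OF _ root_span_subspace], safe)
    fix x \<beta> assume "\<beta> \<in> cascade" "\<beta> \<in> N" "x \<in> heis \<beta>"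
    then show "x \<in> root_span opt_roots"
      using root_span_mono[of "heis_roots \<beta>" opt_roots] heis_in_opt unfolding heis_def by blast
  qed
  show "root_span opt_roots \<subseteq> cmat.span (\<Union>\<beta>\<in>cascade \<inter> N. heis \<beta>)"
  proof (rule root_span_least[OF cmat.subspace_span])
    fix \<gamma> x assume "\<gamma> \<in> opt_roots" "x \<in> root_space \<gamma>"
    then obtain \<beta> where "\<beta> \<in> cascade \<inter> N" "x \<in> heis \<beta>"
      using root_span_base unfolding opt_roots_def heis_def by blast
    then show "x \<in> cmat.span (\<Union>\<beta>\<in>cascade \<inter> N. heis \<beta>)" by (intro cmat.span_base) auto
  qed
qed

section \<open>The stabiliser of a cascade point\<close>

definition stab_roots :: "'n functional set" where
  "stab_roots = {\<gamma> \<in> N. \<forall>\<beta>\<in>cascade \<inter> N. \<beta> - \<gamma> \<notin> N}"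

lemma cascade_difference:
  assumes b: "\<beta> \<in> cascade" and g: "\<gamma> \<in> N" and d: "\<beta> - \<gamma> \<in> N"
  shows "\<gamma> \<in> heis_roots \<beta>" "\<beta> - \<gamma> \<in> heis_roots \<beta>"
proof -
  note std = cascade_standard[OF b] and hr = cascade_root(2)[OF b]
  show "\<gamma> \<in> heis_roots \<beta>"
    by (rule sum_highest_heis[OF std hr type_pos[OF N g] type_pos[OF N d]]) simp
  show "\<beta> - \<gamma> \<in> heis_roots \<beta>"
    by (rule sum_highest_heis[OF std hr type_pos[OF N d] type_pos[OF N g]]) simp
qed

text \<open>Only the \<beta> with \<gamma> in \<open>heis_roots \<beta>\<close> can satisfy \<beta>
  - \<gamma> \<in> N, by \<open>cascade_difference\<close> and uniqueness. For this \<beta>, either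
  \<gamma> = \<beta>, or the complement \<beta> - \<gamma> lies in \<open>heis_roots \<beta>\<close>
  and the condition says that it is missing from N.\<close>

lemma stab_roots_eq: "stab_roots = {\<beta> - \<gamma> | \<beta> \<gamma>. \<beta> \<in> cascade \<inter> N \<and> \<gamma> \<in> heis_roots \<beta> - N} \<union> (cascade \<inter> N)"
proof (intro equalityI subsetI)
  fix \<gamma> assume g: "\<gamma> \<in> stab_roots"
  then have gN: "\<gamma> \<in> N" by (simp add: stab_roots_def)
  obtain \<beta> where b: "\<beta> \<in> cascade \<inter> N" "\<gamma> \<in> heis_roots \<beta>" using type_in_heis[OF gN] by blast
  have bc: "\<beta> \<in> cascade" using b by simp
  show "\<gamma> \<in> {\<beta> - \<gamma> | \<beta> \<gamma>. \<beta> \<in> cascade \<inter> N \<and> \<gamma> \<in> heis_roots \<beta> - N} \<union> (cascade \<inter> N)"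
  proof (cases "\<gamma> = \<beta>")
    case True then show ?thesis using b by simp
  next
    case False
    have "\<beta> - \<gamma> \<in> heis_roots \<beta>"
      by (rule heis_complement[OF cascade_standard[OF bc] cascade_root(2)[OF bc] b(2) False])
    moreover have "\<beta> - \<gamma> \<notin> N" using g b(1) by (auto simp: stab_roots_def)
    moreover have "\<gamma> = \<beta> - (\<beta> - \<gamma>)" by simp
    ultimately show ?thesis using b(1) by blast
  qed
next
  fix \<gamma> assume "\<gamma> \<in> {\<beta> - \<gamma> | \<beta> \<gamma>. \<beta> \<in> cascade \<inter> N \<and> \<gamma> \<in> heis_roots \<beta> - N} \<union> (cascade \<inter> N)"
  then consider (missing) \<beta> \<delta> where "\<gamma> = \<beta> - \<delta>" "\<beta> \<in> cascade" "\<beta> \<in> N" "\<delta> \<in> heis_roots \<beta>" "\<delta> \<notin> N"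
    | (top) "\<gamma> \<in> cascade" "\<gamma> \<in> N" by blast
  then show "\<gamma> \<in> stab_roots"
  proof cases
    case missing
    have ne: "\<delta> \<noteq> \<beta>" using missing by blast
    have gh: "\<gamma> \<in> heis_roots \<beta>" unfolding missing(1)
      by (rule heis_complement[OF cascade_standard[OF missing(2)] cascade_root(2)[OF missing(2)] missing(4) ne])
    have "\<gamma> + \<delta> \<in> N" using missing by simp
    \<comment> \<open>The root \<beta> = \<gamma> + \<delta> is in N and \<delta> is not, so the
      splitting property of N gives \<gamma>.\<close>
    then have gN: "\<gamma> \<in> N"
      using type_split[OF N pos_root[OF heis_roots_pos[OF gh]] pos_root[OF heis_roots_pos[OF missing(4)]]] missing(5)
      by blast
    have "\<beta>' - \<gamma> \<notin> N" if "\<beta>' \<in> cascade" "\<beta>' \<in> N" for \<beta>'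
    proof
      assume d: "\<beta>' - \<gamma> \<in> N"
      have "\<beta>' = \<beta>"
        by (rule heis_roots_unique[OF that(1) missing(2) cascade_difference(1)[OF that(1) gN d] gh])
      then show False using d missing by simp
    qed
    then show ?thesis using gN by (auto simp: stab_roots_def)
  next
    case top
    have "\<beta>' - \<gamma> \<notin> N" if "\<beta>' \<in> cascade" "\<beta>' \<in> N" for \<beta>'
    proof
      assume d: "\<beta>' - \<gamma> \<in> N"
      have "\<beta>' = \<gamma>"
        by (rule heis_roots_unique[OF that(1) top(1) cascade_difference(1)[OF that(1) top(2) d] cascade_self_heis[OF top(1)]])
      then show False using d type_root[OF N] zero_not_root by auto
    qed
    then show ?thesis using top by (auto simp: stab_roots_def)
  qed
qed

text \<open>A cascade root of the form \<beta> - \<delta> would lie both in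
  \<open>heis_roots \<beta>\<close> and in its own set, forcing \<delta> = 0.\<close>

lemma stab_parts_disjoint:
  "{\<beta> - \<gamma> | \<beta> \<gamma>. \<beta> \<in> cascade \<inter> N \<and> \<gamma> \<in> heis_roots \<beta> - N} \<inter> (cascade \<inter> N) = {}"
proof (rule ccontr)
  assume "\<not> ?thesis"
  then obtain \<beta> \<delta> where b: "\<beta> \<in> cascade" "\<beta> \<in> N" "\<delta> \<in> heis_roots \<beta>" "\<delta> \<notin> N" "\<beta> - \<delta> \<in> cascade" by blast
  have ne: "\<delta> \<noteq> \<beta>" using b by blast
  have "\<beta> - \<delta> \<in> heis_roots \<beta>"
    by (rule heis_complement[OF cascade_standard[OF b(1)] cascade_root(2)[OF b(1)] b(3) ne])
  then have "\<beta> = \<beta> - \<delta>"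
    by (rule heis_roots_unique[OF b(1,5) _ cascade_self_heis[OF b(5)]])
  then have "\<delta> = 0" by simp
  then show False using b(3) heis_root_subset zero_not_root by blast
qed

text \<open>Ensures that the double sum over j and \<gamma> repeats no root space. The difference
  lies in both \<open>heis_roots\<close> sets, which determines \<beta>.\<close>

lemma missing_difference_injective:
  assumes "\<beta> \<in> cascade" "\<beta> \<in> N" "\<delta> \<in> heis_roots \<beta> - N" "\<beta>' \<in> cascade" "\<beta>' \<in> N" "\<delta>' \<in> heis_roots \<beta>' - N"
    and e: "\<beta> - \<delta> = \<beta>' - \<delta>'"
  shows "\<beta> = \<beta>'" "\<delta> = \<delta>'"
proof -
  have "\<beta> - \<delta> \<in> heis_roots \<beta>"
    by (rule heis_complement[OF cascade_standard cascade_root(2)]) (use assms in auto)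
  moreover have "\<beta>' - \<delta>' \<in> heis_roots \<beta>'"
    by (rule heis_complement[OF cascade_standard cascade_root(2)]) (use assms in auto)
  ultimately show "\<beta> = \<beta>'" using heis_roots_unique assms by metis
  then show "\<delta> = \<delta>'" using e by simp
qed

lemma \<kappa>_sum_left: "(\<And>i. i \<in> I \<Longrightarrow> f i \<in> \<gg>) \<Longrightarrow> y \<in> \<gg> \<Longrightarrow> \<kappa> (\<Sum>i\<in>I. f i) y = (\<Sum>i\<in>I. \<kappa> (f i) y)"
proof (induction I rule: infinite_finite_induct)
  case (insert i I)
  then show ?case using cmat.subspace_sum[OF \<gg>_subspace, of I f] by (simp add: \<kappa>_add_left)
qed (simp_all add: \<kappa>_zero)

text \<open>Suppose x has a nonzero component at some \<gamma> outside \<open>stab_roots\<close>,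
  and \<beta> - \<gamma> \<in> N. Pairing with a vector y of weight \<beta> - \<gamma> picks the one
  term [w \<gamma>, e \<beta>] out of [x, \<zeta>] and annihilates the parabolic, so [x, \<zeta>] is
  not in the parabolic. The coefficients of \<zeta> matter only through being nonzero, so the result
  is the same for all cascade points.\<close>

lemma stabiliser_root_span:
  assumes z: "\<zeta> \<in> cascade_points (root_span N)"
  shows "stabiliser (root_span N) \<zeta> = root_span stab_roots"
proof -
  let ?K = "cascade \<inter> N" and ?p = "root_span (insert 0 (parabolic_roots N))"
  obtain e where e: "\<And>\<beta>. \<beta> \<in> ?K \<Longrightarrow> e \<beta> \<in> root_space (- \<beta>)" "\<And>\<beta>. \<beta> \<in> ?K \<Longrightarrow> e \<beta> \<noteq> 0"
    and zeta: "\<zeta> = (\<Sum>\<beta>\<in>?K. e \<beta>)"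
    using z by (auto simp: cascade_points_def cascade_of_root_span)
  have Kfin: "finite ?K" using roots_finite type_root[OF N] finite_subset[of ?K roots] by blast
  have eg: "e \<beta> \<in> \<gg>" if "\<beta> \<in> ?K" for \<beta> using e(1)[OF that] root_space_in_\<gg> by blast
  have zg: "\<zeta> \<in> \<gg>" unfolding zeta by (rule cmat.subspace_sum[OF \<gg>_subspace eg])
  have ng: "root_span N \<subseteq> \<gg>" by (rule root_span_in_\<gg>)
  have stab: "stabiliser (root_span N) \<zeta> = {x \<in> root_span N. \<lbrakk>x, \<zeta>\<rbrakk> \<in> ?p}"
    using proj_opposite_zero_iff[OF N \<gg>_bracket[OF _ zg]] ng by (auto simp: stabiliser_def)
  have Sdual: "\<gamma> - \<beta> \<in> dual_space" if "\<gamma> \<in> N" "\<beta> \<in> ?K" for \<gamma> \<beta>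
    using that dual_closed(4)[OF root_dual root_dual] type_root[OF N] by blast
  have br: "\<lbrakk>x, e \<beta>\<rbrakk> \<in> root_space (\<gamma> - \<beta>)" if "x \<in> root_space \<gamma>" "\<beta> \<in> ?K" for x \<gamma> \<beta>
    using root_space_bracket[OF that(1) e(1)[OF that(2)]] by simp
  show ?thesis unfolding stab
  proof (intro equalityI subsetI)
    fix x assume x: "x \<in> root_span stab_roots"
    have "root_span stab_roots \<subseteq> root_span N" by (rule root_span_mono) (auto simp: stab_roots_def)
    moreover have "\<lbrakk>x, \<zeta>\<rbrakk> \<in> ?p"
    proof (rule bracket_in_span[OF x[unfolded root_span_def] cmat.span_base[of \<zeta> "{\<zeta>}"] root_span_subspace])
      fix a b assume "a \<in> (\<Union>\<gamma>\<in>stab_roots. root_space \<gamma>)" "b \<in> {\<zeta>}"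
      then obtain \<gamma> where g: "\<gamma> \<in> stab_roots" "a \<in> root_space \<gamma>" and b: "b = \<zeta>" by auto
      have gN: "\<gamma> \<in> N" using g by (simp add: stab_roots_def)
      have "\<lbrakk>a, e \<beta>\<rbrakk> \<in> ?p" if K: "\<beta> \<in> ?K" for \<beta>
      proof (cases "\<gamma> - \<beta> \<in> weights")
        case False
        then have "\<lbrakk>a, e \<beta>\<rbrakk> = 0" using root_space_eq_zero[OF Sdual[OF gN K]] br[OF g(2) K] by blast
        then show ?thesis using cmat.subspace_0[OF root_span_subspace] by simp
      next
        case True
        have "- (\<gamma> - \<beta>) \<notin> N" using g K by (auto simp: stab_roots_def)
        then have "\<gamma> - \<beta> \<in> insert 0 (parabolic_roots N)"
          using True by (auto simp: parabolic_roots_def weights_def)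
        then show ?thesis using root_span_base br[OF g(2) K] by blast
      qed
      then show "\<lbrakk>a, b\<rbrakk> \<in> ?p" unfolding b zeta lie_bracket_sum by (intro cmat.subspace_sum[OF root_span_subspace])
    qed simp
    ultimately show "x \<in> {x \<in> root_span N. \<lbrakk>x, \<zeta>\<rbrakk> \<in> ?p}" using x by blast
  next
    fix x assume "x \<in> {x \<in> root_span N. \<lbrakk>x, \<zeta>\<rbrakk> \<in> ?p}"
    then have x: "x \<in> root_span N" "\<lbrakk>x, \<zeta>\<rbrakk> \<in> ?p" by auto
    obtain w where w: "\<And>\<gamma>. w \<gamma> \<in> root_space \<gamma>" "x = (\<Sum>\<gamma>\<in>weights. w \<gamma>)"
      using \<gg>_decomp[of x] x ng by blast
    have wN: "w \<gamma> = 0" if "\<gamma> \<in> weights" "\<gamma> \<notin> N" for \<gamma>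
      by (rule root_span_components[OF type_weights[OF N] x(1) w that])
    have "w \<gamma> = 0" if g: "\<gamma> \<in> weights" "\<gamma> \<notin> stab_roots" for \<gamma>
    proof (rule ccontr)
      assume ne: "w \<gamma> \<noteq> 0"
      then have gN: "\<gamma> \<in> N" using wN g by blast
      then obtain \<beta> where b: "\<beta> \<in> ?K" "\<beta> - \<gamma> \<in> N" using g by (auto simp: stab_roots_def)
      have dr: "\<gamma> - \<beta> \<in> roots" using root_neg[OF type_root[OF N b(2)]] by simp
      have "\<lbrakk>w \<gamma>, e \<beta>\<rbrakk> \<noteq> 0"
        by (rule bracket_root_vectors_nonzero[OF type_root[OF N gN] root_neg _ w(1) ne e(1)[OF b(1)] e(2)[OF b(1)]])
           (use dr type_root[OF N] b in auto)
      \<comment> \<open>The bracket is a nonzero vector of weight \<gamma> - \<beta>, so the Killing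
        form detects it in the opposite root space.\<close>
      then obtain y where y: "y \<in> root_space (- (\<gamma> - \<beta>))" "\<kappa> \<lbrakk>w \<gamma>, e \<beta>\<rbrakk> y \<noteq> 0"
        using root_space_pairing[OF root_weight[OF dr] br[OF w(1) b(1)]] by blast
      have yd: "y \<in> root_space (\<beta> - \<gamma>)" using y(1) by simp
      note yg = root_space_in_\<gg>[OF y(1)] and bd = root_dual[OF type_root[OF N b(2)]]
      \<comment> \<open>A second contributing pair would have the same difference; that root of N
        would lie in two sets \<open>heis_roots\<close>, so the pairs coincide.\<close>
      have zero: "\<kappa> \<lbrakk>w \<gamma>', e \<beta>'\<rbrakk> y = 0" if p: "\<gamma>' \<in> weights" "\<beta>' \<in> ?K" "(\<gamma>', \<beta>') \<noteq> (\<gamma>, \<beta>)" for \<gamma>' \<beta>'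
      proof (cases "\<gamma>' \<in> N")
        case False then show ?thesis using wN p(1) \<kappa>_zero(1)[OF yg] by simp
      next
        case True
        have "\<gamma>' - \<beta>' + (\<beta> - \<gamma>) \<noteq> 0"
        proof
          assume "\<gamma>' - \<beta>' + (\<beta> - \<gamma>) = 0"
          then have "\<beta>' - \<gamma>' = \<beta> - \<gamma>" by (simp add: algebra_simps)
          then have d': "\<beta>' - \<gamma>' \<in> N" and d: "\<beta>' - \<gamma>' \<in> heis_roots \<beta>"
            using b cascade_difference(2)[of \<beta> \<gamma>] gN by auto
          have "\<beta>' = \<beta>"
            by (rule heis_roots_unique[OF _ _ cascade_difference(2)[OF _ True d'] d]) (use p b in auto)
          then show False using \<open>\<beta>' - \<gamma>' = \<beta> - \<gamma>\<close> p(3) by simp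
        qed
        then show ?thesis by (rule \<kappa>_root_spaces[OF Sdual[OF True p(2)] bd _ br[OF w(1) p(2)] yd])
      qed
      have bg: "\<lbrakk>w \<gamma>', e \<beta>'\<rbrakk> \<in> \<gg>" if "\<beta>' \<in> ?K" for \<gamma>' \<beta>'
        using \<gg>_bracket root_space_in_\<gg>[OF w(1)] eg[OF that] by blast
      have "\<kappa> \<lbrakk>x, \<zeta>\<rbrakk> y = (\<Sum>\<gamma>'\<in>weights. \<Sum>\<beta>'\<in>?K. \<kappa> \<lbrakk>w \<gamma>', e \<beta>'\<rbrakk> y)"
      proof -
        have "\<lbrakk>x, \<zeta>\<rbrakk> = (\<Sum>\<gamma>'\<in>weights. \<Sum>\<beta>'\<in>?K. \<lbrakk>w \<gamma>', e \<beta>'\<rbrakk>)"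
          unfolding w(2) zeta lie_bracket_sum(1) by (intro sum.cong refl lie_bracket_sum(2))
        then have "\<kappa> \<lbrakk>x, \<zeta>\<rbrakk> y = (\<Sum>\<gamma>'\<in>weights. \<kappa> (\<Sum>\<beta>'\<in>?K. \<lbrakk>w \<gamma>', e \<beta>'\<rbrakk>) y)"
          by (simp only:) (rule \<kappa>_sum_left[OF cmat.subspace_sum[OF \<gg>_subspace bg] yg])
        also have "\<dots> = (\<Sum>\<gamma>'\<in>weights. \<Sum>\<beta>'\<in>?K. \<kappa> \<lbrakk>w \<gamma>', e \<beta>'\<rbrakk> y)"
          by (intro sum.cong refl \<kappa>_sum_left[OF bg yg])
        finally show ?thesis .
      qed
      also have "\<dots> = (\<Sum>\<gamma>'\<in>weights. \<Sum>\<beta>'\<in>?K. if \<gamma>' = \<gamma> \<and> \<beta>' = \<beta> then \<kappa> \<lbrakk>w \<gamma>, e \<beta>\<rbrakk> y else 0)"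
        using zero by (intro sum.cong refl) auto
      also have "\<dots> = (\<Sum>\<gamma>'\<in>weights. if \<gamma>' = \<gamma> then \<kappa> \<lbrakk>w \<gamma>, e \<beta>\<rbrakk> y else 0)"
      proof (intro sum.cong refl)
        fix \<gamma>'
        show "(\<Sum>\<beta>'\<in>?K. if \<gamma>' = \<gamma> \<and> \<beta>' = \<beta> then \<kappa> \<lbrakk>w \<gamma>, e \<beta>\<rbrakk> y else 0) = (if \<gamma>' = \<gamma> then \<kappa> \<lbrakk>w \<gamma>, e \<beta>\<rbrakk> y else 0)"
          using Kfin b(1) by (cases "\<gamma>' = \<gamma>") simp_all
      qed
      also have "\<dots> = \<kappa> \<lbrakk>w \<gamma>, e \<beta>\<rbrakk> y" using weights_finite g(1) by simp
      finally have "\<kappa> \<lbrakk>x, \<zeta>\<rbrakk> y \<noteq> 0" using y(2) by simp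
      \<comment> \<open>The weight \<gamma> - \<beta> opposite to y is not one of the parabolic,
        because its negative lies in N.\<close>
      moreover have "\<kappa> u y = 0" if "u \<in> ?p" for u
      proof -
        have "?p \<subseteq> {u \<in> \<gg>. \<kappa> u y = 0}"
        proof (rule root_span_least)
          show "cmat.subspace {u \<in> \<gg>. \<kappa> u y = 0}"
            using yg by (auto simp: cmat.subspace_def \<gg>_closed \<kappa>_zero \<kappa>_add_left \<kappa>_scale_left)
          fix \<delta> u assume d: "\<delta> \<in> insert 0 (parabolic_roots N)" "u \<in> root_space \<delta>"
          have "\<delta> + (\<beta> - \<gamma>) \<noteq> 0"
          proof
            assume "\<delta> + (\<beta> - \<gamma>) = 0"
            then have "- \<delta> = \<beta> - \<gamma>" by (simp only: neg_eq_iff_add_eq_0)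
            then have "- \<delta> \<in> N" using b by simp
            then show False using d(1) type_root[OF N] zero_not_root by (auto simp: parabolic_roots_def)
          qed
          moreover have "\<delta> \<in> dual_space" using d(1) parabolic_weights weight_dual by blast
          ultimately show "u \<in> {u \<in> \<gg>. \<kappa> u y = 0}"
            using \<kappa>_root_spaces[OF _ bd _ d(2) yd] root_space_in_\<gg>[OF d(2)] by simp
        qed
        then show ?thesis using that by blast
      qed
      ultimately show False using x(2) by blast
    qed
    then show "x \<in> root_span stab_roots" using w by (intro root_spanI[of x w]) auto
  qed
qed

end

text \<open>The optimisation contains each relevant \<open>heis_roots \<beta>\<close> entirely, so
  there are no missing roots, and its cascade is that of N.\<close>

lemma stab_roots_opt:
  assumes N: "parabolic_type N"
  shows "stab_roots (opt_roots N) = cascade \<inter> N"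
proof -
  have "heis_roots \<beta> - opt_roots N = {}" if "\<beta> \<in> cascade \<inter> N" for \<beta>
    using that heis_in_opt[OF N] by blast
  then show ?thesis using stab_roots_eq[OF opt_type[OF N]] opt_cascade[OF N] by auto
qed

section \<open>Direct sums of root spaces\<close>

text \<open>Injectivity of f turns independence of distinct root spaces into directness over the
  index set; a repeated root would break it.\<close>

lemma direct_sum_root_spaces:
  assumes I: "finite I" and inj: "inj_on f I" and f: "f ` I \<subseteq> roots"
  shows "is_direct_sum (root_span (f ` I)) I (\<lambda>i. root_space (f i))"
  unfolding is_direct_sum_def
proof (intro conjI ballI allI impI I root_space_subspace)
  show "root_span (f ` I) = {\<Sum>i\<in>I. w i | w. \<forall>i\<in>I. w i \<in> root_space (f i)}"
  proof (intro equalityI subsetI)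
    fix x assume x: "x \<in> root_span (f ` I)"
    have fw: "f ` I \<subseteq> weights" using f root_weight by blast
    obtain w where w: "\<And>\<gamma>. w \<gamma> \<in> root_space \<gamma>" "\<And>\<gamma>. \<gamma> \<notin> f ` I \<Longrightarrow> w \<gamma> = 0" "x = (\<Sum>\<gamma>\<in>weights. w \<gamma>)"
      using span_root_spaces_decomp[OF fw x[unfolded root_span_def]] by blast
    have "x = (\<Sum>\<gamma>\<in>f ` I. w \<gamma>)"
      unfolding w(3) by (rule sum.mono_neutral_right[OF weights_finite fw]) (use w(2) in blast)
    also have "\<dots> = (\<Sum>i\<in>I. w (f i))" by (rule sum.reindex_cong[OF inj refl refl])
    finally show "x \<in> {\<Sum>i\<in>I. w i | w. \<forall>i\<in>I. w i \<in> root_space (f i)}"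
      using w(1) by (intro CollectI exI[of _ "\<lambda>i. w (f i)"]) simp
  next
    fix x assume "x \<in> {\<Sum>i\<in>I. w i | w. \<forall>i\<in>I. w i \<in> root_space (f i)}"
    then obtain w where w: "\<And>i. i \<in> I \<Longrightarrow> w i \<in> root_space (f i)" "x = (\<Sum>i\<in>I. w i)" by blast
    show "x \<in> root_span (f ` I)"
      unfolding w(2)
    proof (rule cmat.subspace_sum[OF root_span_subspace])
      show "w i \<in> root_span (f ` I)" if "i \<in> I" for i using root_span_base[of "f i"] w(1) that by blast
    qed
  qed
  fix w i assume w: "(\<forall>i\<in>I. w i \<in> root_space (f i)) \<and> (\<Sum>i\<in>I. w i) = 0" and i: "i \<in> I"
  define v where "v = (\<lambda>\<gamma>. w (the_inv_into I f \<gamma>))"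
  have vf: "v (f j) = w j" if "j \<in> I" for j using that inj by (simp add: v_def the_inv_into_f_f)
  have "(\<Sum>\<gamma>\<in>f ` I. v \<gamma>) = (\<Sum>i\<in>I. w i)" by (rule sum.reindex_cong[OF inj refl]) (simp add: vf)
  then have "v (f i) = 0"
    using w i f vf root_dual by (intro root_spaces_independent[of "f ` I" v "f i"]) (auto simp: I)
  then show "w i = 0" using vf i by simp
qed

lemma direct_sum2_root_span:
  assumes A: "A \<subseteq> roots" and B: "B \<subseteq> roots" and disj: "A \<inter> B = {}"
  shows "is_direct_sum2 (root_span (A \<union> B)) (root_span A) (root_span B)"
  unfolding is_direct_sum2_def
proof (intro conjI root_span_subspace)
  show "root_span (A \<union> B) = {a + b | a b. a \<in> root_span A \<and> b \<in> root_span B}"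
    unfolding root_span_def UN_Un cmat.span_Un ..
  show "root_span A \<inter> root_span B = {0}"
  proof (intro equalityI subsetI)
    fix x assume x: "x \<in> root_span A \<inter> root_span B"
    have W: "A \<subseteq> weights" "B \<subseteq> weights" using A B root_weight by blast+
    obtain w where w: "\<And>\<gamma>. w \<gamma> \<in> root_space \<gamma>" "x = (\<Sum>\<gamma>\<in>weights. w \<gamma>)"
      using \<gg>_decomp[of x] x root_span_in_\<gg> by blast
    have "w \<gamma> = 0" if "\<gamma> \<in> weights" for \<gamma>
      using root_span_components[OF W(1) _ w that] root_span_components[OF W(2) _ w that] x disj by blast
    then show "x \<in> {0}" using w(2) by simp
  qed (use cmat.subspace_0[OF root_span_subspace] in blast)
qed

end

section \<open>The adjoint action of the torus\<close>

lemma polyfun_sum: "(\<And>i. i \<in> I \<Longrightarrow> polyfun (f i)) \<Longrightarrow> polyfun (\<lambda>A. \<Sum>i\<in>I. f i A)"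
proof (induction I rule: infinite_finite_induct)
  case (insert i I)
  then show ?case using polyfun.add[of "f i" "\<lambda>A. \<Sum>i\<in>I. f i A"] by simp
qed (simp_all add: polyfun.const)

lemma polyfun_conjugate_entry:
  fixes B C :: "'n::finite cmat"
  shows "polyfun (\<lambda>X. (B ** X ** C) $ i $ j)"
proof -
  have "polyfun (\<lambda>X. \<Sum>k\<in>UNIV. (\<Sum>l\<in>UNIV. B $ i $ l * X $ l $ k) * C $ k $ j)"
    by (intro polyfun_sum polyfun.mult polyfun.const polyfun.entry)
  then show ?thesis by (simp add: matrix_matrix_mult_def)
qed

lemma polyfun_conjugate:
  fixes B C :: "'n::finite cmat"
  assumes "polyfun f" shows "polyfun (\<lambda>X. f (B ** X ** C))"
  using assms by (induction rule: polyfun.induct) (auto intro: polyfun.intros polyfun_conjugate_entry)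

lemma invertible_inv:
  fixes A :: "'n::finite cmat"
  assumes "invertible A" shows "A ** matrix_inv A = mat 1" "matrix_inv A ** A = mat 1"
  using someI_ex[OF assms[unfolded invertible_def]] unfolding matrix_inv_def by auto

lemma conjugate_add:
  fixes B C x y :: "'n::finite cmat"
  shows "B ** (x + y) ** C = B ** x ** C + B ** y ** C"
  by (simp add: matrix_add_ldistrib)
     (simp add: vec_eq_iff matrix_matrix_mult_def sum.distrib algebra_simps)

lemma conjugate_affine:
  fixes B C x :: "'n::finite cmat"
  shows "B ** (mat 1 + mscale s x) ** C = B ** C + mscale s (B ** x ** C)"
  by (simp add: conjugate_add mscale_matrix_mult)

lemma algebraic_group_invertible: "linear_algebraic_group G \<Longrightarrow> A \<in> G \<Longrightarrow> invertible A"
  by (auto simp: linear_algebraic_group_def)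

text \<open>Composing a polynomial that vanishes on G with conjugation by A gives another one, and
  conjugation sends 1 + s x to 1 + s A x A^(-1).\<close>

lemma Lie_conjugate:
  assumes G: "linear_algebraic_group G" and A: "A \<in> G" and x: "x \<in> Lie G"
  shows "A ** x ** matrix_inv A \<in> Lie G"
  unfolding Lie_def
proof (intro CollectI allI impI)
  fix f assume f: "polyfun f \<and> (\<forall>B\<in>G. f B = 0)"
  have "A ** B ** matrix_inv A \<in> G" if "B \<in> G" for B
    using G A that by (auto simp: linear_algebraic_group_def)
  then have "((\<lambda>s. f (A ** (mat 1 + mscale s x) ** matrix_inv A)) has_field_derivative 0) (at 0)"
    using x f polyfun_conjugate[of f A "matrix_inv A"] unfolding Lie_def by blast
  then show "((\<lambda>s. f (mat 1 + mscale s (A ** x ** matrix_inv A))) has_field_derivative 0) (at 0)"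
    by (simp add: conjugate_affine invertible_inv(1)[OF algebraic_group_invertible[OF G A]])
qed

lemma diagonal_commute:
  fixes D E :: "'n::finite cmat"
  assumes D: "\<And>i j. i \<noteq> j \<Longrightarrow> D $ i $ j = 0" and E: "\<And>i j. i \<noteq> j \<Longrightarrow> E $ i $ j = 0"
  shows "D ** E = E ** D"
proof -
  have "(\<Sum>k\<in>UNIV. D $ i $ k * E $ k $ j) = (\<Sum>k\<in>UNIV. E $ i $ k * D $ k $ j)" for i j
    by (rule sum.cong) (use D E in \<open>metis mult.commute mult_zero_left mult_zero_right\<close>)+
  then show ?thesis by (simp add: vec_eq_iff matrix_matrix_mult_def)
qed

text \<open>In coordinates diagonalising T, every off-diagonal entry is a polynomial vanishing on T,
  so its derivative in the direction h vanishes. Thus h is diagonal in the same coordinates.\<close>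

lemma torus_Lie_commute:
  assumes T: "torus T" and A: "A \<in> T" and h: "h \<in> Lie T"
  shows "A ** h = h ** A"
proof -
  obtain P :: "'a cmat" where P: "invertible P"
    "\<And>A i j. A \<in> T \<Longrightarrow> i \<noteq> j \<Longrightarrow> (P ** A ** matrix_inv P) $ i $ j = 0"
    using T by (auto simp: torus_def)
  let ?Q = "matrix_inv P"
  note inv = invertible_inv[OF P(1)]
  have diag: "(P ** h ** ?Q) $ i $ j = 0" if ij: "i \<noteq> j" for i j
  proof -
    have "((\<lambda>s. (P ** (mat 1 + mscale s h) ** ?Q) $ i $ j) has_field_derivative 0) (at 0)"
      using h polyfun_conjugate_entry[of P ?Q i j] P(2)[OF _ ij] unfolding Lie_def by blast
    then have "((\<lambda>s. s * (P ** h ** ?Q) $ i $ j) has_field_derivative 0) (at 0)"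
      unfolding conjugate_affine inv(1) by (simp add: mat_def ij)
    moreover have "((\<lambda>s. s * (P ** h ** ?Q) $ i $ j) has_field_derivative (P ** h ** ?Q) $ i $ j) (at 0)"
      by (auto intro!: derivative_eq_intros)
    ultimately show ?thesis by (rule DERIV_unique[symmetric])
  qed
  have "(P ** A ** ?Q) ** (P ** h ** ?Q) = (P ** h ** ?Q) ** (P ** A ** ?Q)"
    by (rule diagonal_commute) (use P(2)[OF A] diag in auto)
  moreover have "(P ** X ** ?Q) ** (P ** Y ** ?Q) = P ** (X ** Y) ** ?Q" for X Y
  proof -
    have "(P ** X ** ?Q) ** (P ** Y ** ?Q) = P ** X ** (?Q ** P) ** Y ** ?Q"
      by (simp only: matrix_mul_assoc)
    then show ?thesis by (simp add: inv matrix_mul_assoc)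
  qed
  ultimately have e: "P ** (A ** h) ** ?Q = P ** (h ** A) ** ?Q" by simp
  have c: "?Q ** (P ** X ** ?Q) ** P = X" for X
  proof -
    have "?Q ** (P ** X ** ?Q) ** P = (?Q ** P) ** X ** (?Q ** P)" by (simp only: matrix_mul_assoc)
    then show ?thesis by (simp add: inv)
  qed
  show ?thesis using arg_cong[OF e, of "\<lambda>Z. ?Q ** Z ** P"] unfolding c .
qed

context simple_lie
begin

text \<open>An element of T commutes with \<tt>, so conjugation by it commutes with the action of
  \<tt> and preserves each weight space.\<close>

lemma Ad_stable_root_span:
  assumes G: "linear_algebraic_group G" and gg: "\<gg> = Lie G" and T: "torus T" "T \<subseteq> G" and tt: "Lie T = \<tt>"
  shows "Ad_stable T (root_span S)"
  unfolding Ad_stable_def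
proof (intro ballI)
  fix A x assume A: "A \<in> T" and x: "x \<in> root_span S"
  have AG: "A \<in> G" using A T by blast
  let ?c = "\<lambda>x. A ** x ** matrix_inv A"
  note inv = invertible_inv[OF algebraic_group_invertible[OF G AG]]
  have root: "?c x \<in> root_space \<gamma>" if x: "x \<in> root_space \<gamma>" for x \<gamma>
  proof -
    have "\<lbrakk>h, ?c x\<rbrakk> = mscale (\<gamma> h) (?c x)" if h: "h \<in> \<tt>" for h
    proof -
      have com: "A ** h = h ** A" using torus_Lie_commute[OF T(1) A] h tt by blast
      have com': "matrix_inv A ** h = h ** matrix_inv A"
      proof -
        have "matrix_inv A ** h = matrix_inv A ** (h ** A) ** matrix_inv A"
          using inv by (simp add: matrix_mul_assoc[symmetric])
        also have "\<dots> = matrix_inv A ** A ** h ** matrix_inv A"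
          unfolding com[symmetric] by (simp only: matrix_mul_assoc)
        finally show ?thesis using inv by simp
      qed
      have "h ** ?c x = ?c (h ** x)" by (simp only: matrix_mul_assoc com)
      moreover have "?c x ** h = ?c (x ** h)"
      proof -
        have "?c x ** h = A ** x ** (matrix_inv A ** h)" by (simp only: matrix_mul_assoc)
        also have "\<dots> = ?c (x ** h)" unfolding com' by (simp only: matrix_mul_assoc)
        finally show ?thesis .
      qed
      moreover have "?c (y - z) = ?c y - ?c z" for y z
        by (simp add: vec_eq_iff matrix_matrix_mult_def sum_subtractf algebra_simps sum_distrib_left)
      ultimately have "\<lbrakk>h, ?c x\<rbrakk> = ?c \<lbrakk>h, x\<rbrakk>" unfolding lie_bracket_def by metis
      then show ?thesis using root_space_eigen[OF x h] by (simp add: mscale_matrix_mult)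
    qed
    moreover have "?c x \<in> \<gg>" using Lie_conjugate[OF G AG] root_space_in_\<gg>[OF x] gg by blast
    ultimately show ?thesis by (simp add: root_space_def)
  qed
  have lin: "mlinear ?c"
    by (rule mlinearI) (simp_all add: conjugate_add mscale_matrix_mult)
  have "cmat.subspace {x. ?c x \<in> root_span S}"
    using root_span_subspace[of S] module_hom.add[OF lin] module_hom.scale[OF lin] module_hom.zero[OF lin]
    by (simp add: cmat.subspace_def)
  then have "root_span S \<subseteq> {x. ?c x \<in> root_span S}"
    by (rule root_span_least) (use root root_span_base in blast)
  then show "?c x \<in> root_span S" using x by blast
qed

section \<open>Structure of the stabiliser\<close>

text \<open>Stability of root spans under T is a hypothesis here, so that the argument stays inside
  the Lie algebra; \<open>Ad_stable_root_span\<close> supplies it for the torus.\<close>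

theorem stabiliser_structure:
  fixes \<beta> :: "nat \<Rightarrow> 'n functional"
  assumes nil: "nilradical \<nn>" and num: "cascade_numbering \<nn> k m \<beta>"
    and z: "\<zeta> \<in> cascade_points \<nn>" and z': "\<zeta>' \<in> cascade_points (optimisation \<nn>)"
    and stable: "\<And>S. Ad_stable T (root_span S)"
  shows "Ad_stable T (stabiliser \<nn> \<zeta>) \<and>
     (\<exists>M N.
        is_direct_sum M (SIGMA j:{1..k}. missing_roots \<nn> (\<beta> j)) (\<lambda>(j, \<gamma>). root_space (\<beta> j - \<gamma>)) \<and>
        is_direct_sum N (cascade_of \<nn>) root_space \<and>
        is_direct_sum2 (stabiliser \<nn> \<zeta>) M (stabiliser (optimisation \<nn>) \<zeta>') \<and>
        is_direct_sum2 (stabiliser \<nn> \<zeta>) M N) \<and>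
     roots_of (stabiliser \<nn> \<zeta>) =
       {\<beta> j - \<gamma> | j \<gamma>. 1 \<le> j \<and> j \<le> k \<and> \<gamma> \<in> missing_roots \<nn> (\<beta> j)} \<union> cascade_of \<nn> \<and>
     {\<beta> j - \<gamma> | j \<gamma>. 1 \<le> j \<and> j \<le> k \<and> \<gamma> \<in> missing_roots \<nn> (\<beta> j)} \<inter> cascade_of \<nn> = {} \<and>
     (\<forall>\<xi>\<in>cascade_points \<nn>. stabiliser \<nn> \<xi> = stabiliser \<nn> \<zeta>)"
proof -
  obtain N where N: "parabolic_type N" and nN: "\<nn> = root_span N" using nilradical_roots[OF nil] by blast
  let ?K = "cascade \<inter> N" and ?I = "SIGMA j:{1..k}. heis_roots (\<beta> j) - N" and ?f = "\<lambda>(j, \<gamma>). \<beta> j - \<gamma>"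
  have K: "cascade_of \<nn> = ?K" and miss: "missing_roots \<nn> \<delta> = heis_roots \<delta> - N" for \<delta>
    unfolding nN by (rule cascade_of_root_span[OF N], rule missing_roots_root_span[OF N])
  have Kr: "?K \<subseteq> roots" using type_root[OF N] by blast
  have stab: "stabiliser \<nn> \<xi> = root_span (stab_roots N)" if "\<xi> \<in> cascade_points \<nn>" for \<xi>
    using stabiliser_root_span[OF N] that unfolding nN by blast
  have stab': "stabiliser (optimisation \<nn>) \<zeta>' = root_span ?K"
    using stabiliser_root_span[OF opt_type[OF N]] z' stab_roots_opt[OF N]
    unfolding nN optimisation_root_span[OF N] by metis
  have bK: "\<beta> ` {1..k} = ?K" and inj: "inj_on \<beta> {1..k}"
    using num K unfolding cascade_numbering_def bij_betw_def by (auto intro: inj_on_subset)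
  let ?D = "{\<beta> j - \<gamma> | j \<gamma>. 1 \<le> j \<and> j \<le> k \<and> \<gamma> \<in> missing_roots \<nn> (\<beta> j)}"
  have D: "?D = ?f ` ?I"
  proof (intro equalityI subsetI)
    fix \<gamma> assume "\<gamma> \<in> ?D"
    then obtain j \<delta> where "\<gamma> = ?f (j, \<delta>)" "(j, \<delta>) \<in> ?I" by (auto simp: miss)
    then show "\<gamma> \<in> ?f ` ?I" by (rule image_eqI)
  next
    fix \<gamma> assume "\<gamma> \<in> ?f ` ?I"
    then obtain j \<delta> where "\<gamma> = \<beta> j - \<delta>" "1 \<le> j" "j \<le> k" "\<delta> \<in> missing_roots \<nn> (\<beta> j)"
      by (auto simp: miss)
    then show "\<gamma> \<in> ?D" by blast
  qed
  \<comment> \<open>Translates from the numbering used in the statement to the cascade elements used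
    in the lemmas on \<open>stab_roots\<close>.\<close>
  have D': "?D = {\<beta> - \<gamma> | \<beta> \<gamma>. \<beta> \<in> ?K \<and> \<gamma> \<in> heis_roots \<beta> - N}"
  proof (intro equalityI subsetI)
    fix \<gamma> assume "\<gamma> \<in> ?D"
    then obtain j \<delta> where "\<gamma> = \<beta> j - \<delta>" "j \<in> {1..k}" "\<delta> \<in> heis_roots (\<beta> j) - N" by (auto simp: miss)
    then show "\<gamma> \<in> {\<beta> - \<gamma> | \<beta> \<gamma>. \<beta> \<in> ?K \<and> \<gamma> \<in> heis_roots \<beta> - N}" using bK by blast
  next
    fix \<gamma> assume "\<gamma> \<in> {\<beta> - \<gamma> | \<beta> \<gamma>. \<beta> \<in> ?K \<and> \<gamma> \<in> heis_roots \<beta> - N}"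
    then obtain j \<delta> where "\<gamma> = \<beta> j - \<delta>" "j \<in> {1..k}" "\<delta> \<in> heis_roots (\<beta> j) - N"
      unfolding bK[symmetric] by blast
    then show "\<gamma> \<in> ?D" unfolding miss by auto
  qed
  have DK: "stab_roots N = ?D \<union> ?K" "?D \<inter> ?K = {}"
    unfolding D' by (rule stab_roots_eq[OF N], rule stab_parts_disjoint[OF N])
  have sr: "stab_roots N \<subseteq> roots" using type_root[OF N] by (auto simp: stab_roots_def[OF N])
  have Dr: "?D \<subseteq> roots" using sr DK(1) by blast
  have finI: "finite ?I"
    by (intro finite_SigmaI finite_Diff finite_subset[OF heis_root_subset roots_finite]) simp
  have injf: "inj_on ?f ?I"
  proof (rule inj_onI, clarify)
    fix i \<gamma> j \<delta>
    assume i: "i \<in> {1..k}" "\<gamma> \<in> heis_roots (\<beta> i)" "\<gamma> \<notin> N"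
      and j: "j \<in> {1..k}" "\<delta> \<in> heis_roots (\<beta> j)" "\<delta> \<notin> N" and e: "\<beta> i - \<gamma> = \<beta> j - \<delta>"
    have "\<beta> i \<in> ?K" "\<beta> j \<in> ?K" using i j bK by blast+
    then have "\<beta> i = \<beta> j" "\<gamma> = \<delta>"
      using missing_difference_injective[OF N _ _ _ _ _ _ e] i j by blast+
    then show "i = j \<and> \<gamma> = \<delta>" using inj i j by (auto dest: inj_onD)
  qed
  have M: "is_direct_sum (root_span ?D) ?I (\<lambda>(j, \<gamma>). root_space (\<beta> j - \<gamma>))"
    using direct_sum_root_spaces[OF finI injf] Dr unfolding D by (simp add: case_prod_unfold)
  have NN: "is_direct_sum (root_span ?K) ?K root_space"
    using direct_sum_root_spaces[of ?K "\<lambda>x. x"] Kr roots_finite finite_subset by (auto simp: inj_on_def)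
  have two: "is_direct_sum2 (root_span (stab_roots N)) (root_span ?D) (root_span ?K)"
    unfolding DK(1) by (rule direct_sum2_root_span[OF Dr Kr DK(2)])
  show ?thesis
    unfolding stab[OF z] stab' K
  proof (intro conjI exI ballI)
    show "is_direct_sum (root_span ?D) (SIGMA j:{1..k}. missing_roots \<nn> (\<beta> j)) (\<lambda>(j, \<gamma>). root_space (\<beta> j - \<gamma>))"
      using M unfolding miss .
    show "roots_of (root_span (stab_roots N)) = ?D \<union> ?K" using roots_of_root_span[OF sr] DK(1) by simp
  qed (use stable NN two DK(2) stab in blast)+
qed

end

theorem theorem4p4:
  fixes G T \<gg> \<tt> \<nn> :: "(complex^'n::finite^'n) set"
    and \<Psi> :: "(complex^'n^'n \<Rightarrow> complex) set"
    and \<beta> :: "nat \<Rightarrow> complex^'n^'n \<Rightarrow> complex"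
    and k m :: nat
    and \<zeta> \<zeta>' :: "complex^'n^'n"
  assumes "connected_simple_group G"
    and "\<gg> = Lie G"
    and "lie_data.triangular_decomposition \<gg> \<tt> \<Psi>"
    and "maximal_torus G T"
    and "Lie T = \<tt>"
    and "lie_data.nilradical \<gg> \<tt> \<Psi> \<nn>"
    and "lie_data.cascade_numbering \<gg> \<tt> \<Psi> \<nn> k m \<beta>"
    and "\<zeta> \<in> lie_data.cascade_points \<gg> \<tt> \<Psi> \<nn>"
    and "\<zeta>' \<in> lie_data.cascade_points \<gg> \<tt> \<Psi> (lie_data.optimisation \<gg> \<tt> \<Psi> \<nn>)"
  shows
    "Ad_stable T (lie_data.stabiliser \<gg> \<tt> \<Psi> \<nn> \<zeta>) \<and>
     (\<exists>M N.
        is_direct_sum M (SIGMA j:{1..k}. lie_data.missing_roots \<gg> \<tt> \<Psi> \<nn> (\<beta> j))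
          (\<lambda>(j, \<gamma>). lie_data.root_space \<gg> \<tt> (\<beta> j - \<gamma>)) \<and>
        is_direct_sum N (lie_data.cascade_of \<gg> \<tt> \<Psi> \<nn>) (lie_data.root_space \<gg> \<tt>) \<and>
        is_direct_sum2 (lie_data.stabiliser \<gg> \<tt> \<Psi> \<nn> \<zeta>) M
          (lie_data.stabiliser \<gg> \<tt> \<Psi> (lie_data.optimisation \<gg> \<tt> \<Psi> \<nn>) \<zeta>') \<and>
        is_direct_sum2 (lie_data.stabiliser \<gg> \<tt> \<Psi> \<nn> \<zeta>) M N) \<and>
     lie_data.roots_of \<gg> \<tt> (lie_data.stabiliser \<gg> \<tt> \<Psi> \<nn> \<zeta>) =
       {\<beta> j - \<gamma> | j \<gamma>. 1 \<le> j \<and> j \<le> k \<and> \<gamma> \<in> lie_data.missing_roots \<gg> \<tt> \<Psi> \<nn> (\<beta> j)} \<union>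
       lie_data.cascade_of \<gg> \<tt> \<Psi> \<nn> \<and>
     {\<beta> j - \<gamma> | j \<gamma>. 1 \<le> j \<and> j \<le> k \<and> \<gamma> \<in> lie_data.missing_roots \<gg> \<tt> \<Psi> \<nn> (\<beta> j)} \<inter>
       lie_data.cascade_of \<gg> \<tt> \<Psi> \<nn> = {} \<and>
     (\<forall>\<xi>\<in>lie_data.cascade_points \<gg> \<tt> \<Psi> \<nn>.
        lie_data.stabiliser \<gg> \<tt> \<Psi> \<nn> \<xi> = lie_data.stabiliser \<gg> \<tt> \<Psi> \<nn> \<zeta>)"
proof -
  interpret simple_lie \<gg> \<tt> \<Psi>
    using assms(1,2,3) by unfold_locales (auto simp: connected_simple_group_def)
  have "linear_algebraic_group G" using assms(1) by (simp add: connected_simple_group_def)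
  moreover have "torus T" "T \<subseteq> G" using assms(4) by (auto simp: maximal_torus_def)
  ultimately have "\<And>S. Ad_stable T (root_span S)"
    using Ad_stable_root_span assms(2,5) by blast
  then show ?thesis by (rule stabiliser_structure[OF assms(6-9)])
qed

end
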